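(* Let $G=(T\cup N,E)$ be an instance of element connectivity with $n$ vertices and $m$ edges, let $R\subseteq T$, and let $w:N\cup E\to\mathbb{R}_{>0}\cup\{\infty\}$ assign positive (possibly infinite) weights to each non-terminal vertex and edge. Let $k=|T|$. Then one can compute, for all $r\in R$, the minimum weight element $(r,R-r)$-cut in $$O\Big(T_{ec}(m,n)\log k+\max_{m_1,\dots,m_k}\Big\{\sum_{i=1}^k T_{ec}(m_i,n):m_1+\cdots+m_k\le 2m\Big\}\Big)$$ time, where $T_{ec}(m,n)$ is the running time for computing a minimum weight element $(S,T)$-cut in a graph with $m$ edges and $n$ vertices.
   Context: An instance of element connectivity is an undirected graph $G=(V,E)$ with vertex set partitioned into terminals $T$ and non-terminals $N=V\setminus T$; the elements are $E\cup N$. For disjoint sets of terminals $A,B$, an element $(A,B)$-cut is a set of elements whose removal leaves no path between a vertex of $A$ and a vertex of $B$; its weight is the sum of the weights of its elements. The element $(r,R-r)$-cut is an element $(\{r\},R\setminus\{r\})$-cut. *)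

theory Defs
  imports Complex_Main "HOL-Library.Extended_Real"
begin

section \<open>Element connectivity\<close>

datatype 'v element = Vertex 'v | Edge "'v set"

definition elements :: "'v set \<Rightarrow> 'v set set \<Rightarrow> 'v set \<Rightarrow> 'v element set" where
  "elements V E T = Vertex ` (V - T) \<union> Edge ` E"

definition ec_instance ::
    "'v set \<Rightarrow> 'v set set \<Rightarrow> 'v set \<Rightarrow> ('v element \<Rightarrow> ereal) \<Rightarrow> bool" where
  "ec_instance V E T w \<longleftrightarrow>
     finite V \<and> E \<subseteq> {{u, v} | u v. u \<in> V \<and> v \<in> V \<and> u \<noteq> v} \<and> T \<subseteq> V \<and>
     (\<forall>x \<in> elements V E T. 0 < w x)"

definition path_avoiding ::
    "'v set \<Rightarrow> 'v set set \<Rightarrow> 'v element set \<Rightarrow> 'v list \<Rightarrow> bool" where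
  "path_avoiding V E X p \<longleftrightarrow>
     p \<noteq> [] \<and> distinct p \<and> (\<forall>v \<in> set p. v \<in> V \<and> Vertex v \<notin> X) \<and>
     successively (\<lambda>u v. {u, v} \<in> E \<and> Edge {u, v} \<notin> X) p"

definition element_cut ::
    "'v set \<Rightarrow> 'v set set \<Rightarrow> 'v set \<Rightarrow> 'v set \<Rightarrow> 'v set \<Rightarrow> 'v element set \<Rightarrow> bool" where
  "element_cut V E T A B X \<longleftrightarrow>
     X \<subseteq> elements V E T \<and>
     (\<nexists>p. path_avoiding V E X p \<and> hd p \<in> A \<and> last p \<in> B)"

definition min_element_cut ::
    "'v set \<Rightarrow> 'v set set \<Rightarrow> 'v set \<Rightarrow> ('v element \<Rightarrow> ereal) \<Rightarrow> 'v set \<Rightarrow> 'v set \<Rightarrow>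
     'v element set \<Rightarrow> bool" where
  "min_element_cut V E T w A B X \<longleftrightarrow>
     element_cut V E T A B X \<and>
     (\<forall>Y. element_cut V E T A B Y \<longrightarrow> sum w X \<le> sum w Y)"

section \<open>Machine model\<close>

text \<open>
  Running times are measured on a real RAM given by a structured programming language.
  A program works on finitely many named arrays of unbounded length, some holding natural
  numbers and some holding weights; a scalar is cell 0 of an array. Natural numbers admit
  only addition, truncated subtraction and comparison, since multiplication at unit cost
  would allow many numbers to be packed into one cell. Weights admit the field operations
  and comparison at unit cost, but no rounding and no conversion to natural numbers;
  the only weight constants are 0, 1 and infinity, because an arbitrary real
  constant could hold an infinite table.
\<close>

type_synonym name = string

record state =
  nats :: "name \<Rightarrow> nat \<Rightarrow> nat"
  weights :: "name \<Rightarrow> nat \<Rightarrow> ereal"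

datatype nexp =
    NConst nat
  | NCell name nexp
  | NAdd nexp nexp
  | NSub nexp nexp

datatype wexp =
    WZero
  | WOne
  | WInf
  | WCell name nexp
  | WAdd wexp wexp
  | WSub wexp wexp
  | WMul wexp wexp
  | WDiv wexp wexp

datatype bexp =
    NLess nexp nexp
  | NEq nexp nexp
  | WLess wexp wexp
  | WEq wexp wexp
  | BNot bexp
  | BAnd bexp bexp

datatype com =
    Skip
  | NAssign name nexp nexp
  | WAssign name nexp wexp
  | Seq com com
  | If bexp com com
  | While bexp com

primrec nval :: "nexp \<Rightarrow> state \<Rightarrow> nat" where
  "nval (NConst c) s = c"
| "nval (NCell a i) s = nats s a (nval i s)"
| "nval (NAdd e f) s = nval e s + nval f s"
| "nval (NSub e f) s = nval e s - nval f s"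

primrec wval :: "wexp \<Rightarrow> state \<Rightarrow> ereal" where
  "wval WZero s = 0"
| "wval WOne s = 1"
| "wval WInf s = \<infinity>"
| "wval (WCell a i) s = weights s a (nval i s)"
| "wval (WAdd e f) s = wval e s + wval f s"
| "wval (WSub e f) s = wval e s - wval f s"
| "wval (WMul e f) s = wval e s * wval f s"
| "wval (WDiv e f) s = wval e s / wval f s"

primrec bval :: "bexp \<Rightarrow> state \<Rightarrow> bool" where
  "bval (NLess e f) s \<longleftrightarrow> nval e s < nval f s"
| "bval (NEq e f) s \<longleftrightarrow> nval e s = nval f s"
| "bval (WLess e f) s \<longleftrightarrow> wval e s < wval f s"
| "bval (WEq e f) s \<longleftrightarrow> wval e s = wval f s"
| "bval (BNot b) s \<longleftrightarrow> \<not> bval b s"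
| "bval (BAnd b c) s \<longleftrightarrow> bval b s \<and> bval c s"

primrec ncost :: "nexp \<Rightarrow> nat" where
  "ncost (NConst c) = 1"
| "ncost (NCell a i) = 1 + ncost i"
| "ncost (NAdd e f) = 1 + ncost e + ncost f"
| "ncost (NSub e f) = 1 + ncost e + ncost f"

primrec wcost :: "wexp \<Rightarrow> nat" where
  "wcost WZero = 1"
| "wcost WOne = 1"
| "wcost WInf = 1"
| "wcost (WCell a i) = 1 + ncost i"
| "wcost (WAdd e f) = 1 + wcost e + wcost f"
| "wcost (WSub e f) = 1 + wcost e + wcost f"
| "wcost (WMul e f) = 1 + wcost e + wcost f"
| "wcost (WDiv e f) = 1 + wcost e + wcost f"

primrec bcost :: "bexp \<Rightarrow> nat" where
  "bcost (NLess e f) = 1 + ncost e + ncost f"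
| "bcost (NEq e f) = 1 + ncost e + ncost f"
| "bcost (WLess e f) = 1 + wcost e + wcost f"
| "bcost (WEq e f) = 1 + wcost e + wcost f"
| "bcost (BNot b) = 1 + bcost b"
| "bcost (BAnd b c) = 1 + bcost b + bcost c"

definition nupd :: "name \<Rightarrow> nat \<Rightarrow> nat \<Rightarrow> state \<Rightarrow> state" where
  "nupd a i x s = s\<lparr>nats := (nats s)(a := (nats s a)(i := x))\<rparr>"

definition wupd :: "name \<Rightarrow> nat \<Rightarrow> ereal \<Rightarrow> state \<Rightarrow> state" where
  "wupd a i x s = s\<lparr>weights := (weights s)(a := (weights s a)(i := x))\<rparr>"

text \<open>\<open>exec c s t s'\<close>: started in \<open>s\<close>, program \<open>c\<close> halts in \<open>s'\<close> after \<open>t\<close> steps.\<close>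

inductive exec :: "com \<Rightarrow> state \<Rightarrow> nat \<Rightarrow> state \<Rightarrow> bool" where
  Skip: "exec Skip s 1 s"
| NAssign: "exec (NAssign a i e) s (1 + ncost i + ncost e) (nupd a (nval i s) (nval e s) s)"
| WAssign: "exec (WAssign a i e) s (1 + ncost i + wcost e) (wupd a (nval i s) (wval e s) s)"
| Seq: "exec c s t s' \<Longrightarrow> exec d s' t' s'' \<Longrightarrow> exec (Seq c d) s (t + t') s''"
| IfTrue: "bval b s \<Longrightarrow> exec c s t s' \<Longrightarrow> exec (If b c d) s (1 + bcost b + t) s'"
| IfFalse: "\<not> bval b s \<Longrightarrow> exec d s t s' \<Longrightarrow> exec (If b c d) s (1 + bcost b + t) s'"
| WhileFalse: "\<not> bval b s \<Longrightarrow> exec (While b c) s (1 + bcost b) s"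
| WhileTrue: "bval b s \<Longrightarrow> exec c s t s' \<Longrightarrow> exec (While b c) s' t' s'' \<Longrightarrow>
    exec (While b c) s (1 + bcost b + t + t') s''"

section \<open>Input and output conventions\<close>

text \<open>
  The vertices are \<open>0, \<dots>, n - 1\<close>, and the edges are given as a list. Nothing is assumed
  about memory that is not part of the input.
\<close>

definition stores_instance ::
    "state \<Rightarrow> nat \<Rightarrow> nat set list \<Rightarrow> nat set \<Rightarrow> (nat element \<Rightarrow> ereal) \<Rightarrow> bool" where
  "stores_instance s n es T w \<longleftrightarrow>
     nats s ''n'' 0 = n \<and> nats s ''m'' 0 = length es \<and>
     (\<forall>j < length es. es ! j = {nats s ''tail'' j, nats s ''head'' j} \<and>
        weights s ''edge_weight'' j = w (Edge (es ! j))) \<and>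
     (\<forall>v < n. nats s ''terminal'' v = of_bool (v \<in> T) \<and>
        (v \<notin> T \<longrightarrow> weights s ''vertex_weight'' v = w (Vertex v)))"

definition stores_set :: "state \<Rightarrow> name \<Rightarrow> nat \<Rightarrow> nat set \<Rightarrow> bool" where
  "stores_set s a n S \<longleftrightarrow> (\<forall>v < n. nats s a v = of_bool (v \<in> S))"

definition stores_cut :: "state \<Rightarrow> nat \<Rightarrow> nat set list \<Rightarrow> nat element set \<Rightarrow> bool" where
  "stores_cut s n es X \<longleftrightarrow>
     (\<forall>v < n. nats s ''cut_vertex'' v = of_bool (Vertex v \<in> X)) \<and>
     (\<forall>j < length es. nats s ''cut_edge'' j = of_bool (Edge (es ! j) \<in> X))"

text \<open>
  A family of cuts indexed by \<open>R\<close> is output as consecutive segments of one array that lists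
  the elements of each cut, vertex \<open>v\<close> being coded by \<open>v\<close> and the \<open>j\<close>-th edge by \<open>n + j\<close>.
  Characteristic arrays, as used for a single cut, would require \<open>card R * (n + m)\<close> cells.
\<close>

definition decode :: "nat \<Rightarrow> nat set list \<Rightarrow> nat \<Rightarrow> nat element" where
  "decode n es c = (if c < n then Vertex c else Edge (es ! (c - n)))"

definition stores_cuts ::
    "state \<Rightarrow> nat \<Rightarrow> nat set list \<Rightarrow> nat set \<Rightarrow> (nat \<Rightarrow> nat element set) \<Rightarrow> bool" where
  "stores_cuts s n es R X \<longleftrightarrow>
     (\<forall>v < n. nats s ''offset'' v \<le> nats s ''offset'' (Suc v)) \<and>
     (\<forall>r \<in> R. let L = map (nats s ''cuts'') [nats s ''offset'' r ..< nats s ''offset'' (Suc r)]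
        in distinct L \<and> set L \<subseteq> {..<n + length es} \<and> X r = decode n es ` set L)"

text \<open>
  Program \<open>P\<close> computes minimum weight element \<open>(A, B)\<close>-cuts, in at most \<open>Tec m n\<close> steps on graphs
  with \<open>m\<close> edges and \<open>n\<close> vertices. As \<open>P\<close> has to write all \<open>n + m\<close> cells of its output,
  \<open>Tec m n \<ge> n + m\<close> whenever such graphs exist.
\<close>

definition computes_min_element_cuts :: "com \<Rightarrow> (nat \<Rightarrow> nat \<Rightarrow> nat) \<Rightarrow> bool" where
  "computes_min_element_cuts P Tec \<longleftrightarrow>
     (\<forall>s n es T w A B.
        ec_instance {..<n} (set es) T w \<and> distinct es \<and>
        A \<subseteq> T \<and> B \<subseteq> T \<and> A \<inter> B = {} \<and>
        stores_instance s n es T w \<and> stores_set s ''A'' n A \<and> stores_set s ''B'' n B \<longrightarrow>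
        (\<exists>t s' X. exec P s t s' \<and> t \<le> Tec (length es) n \<and>
           min_element_cut {..<n} (set es) T w A B X \<and> stores_cut s' n es X))"

definition computes_isolating_element_cuts :: "com \<Rightarrow> (nat \<Rightarrow> nat \<Rightarrow> nat \<Rightarrow> real) \<Rightarrow> bool" where
  "computes_isolating_element_cuts Q time \<longleftrightarrow>
     (\<forall>s n es T w R.
        ec_instance {..<n} (set es) T w \<and> distinct es \<and> T \<noteq> {} \<and> R \<subseteq> T \<and>
        stores_instance s n es T w \<and> stores_set s ''R'' n R \<longrightarrow>
        (\<exists>t s' X. exec Q s t s' \<and> real t \<le> time (length es) n (card T) \<and>
           (\<forall>r \<in> R. min_element_cut {..<n} (set es) T w {r} (R - {r}) (X r)) \<and>
           stores_cuts s' n es R X))"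

end

theory Submission
  imports Defs
begin

text \<open>
  For every bit of a numbering of \<open>R\<close>, compute a minimum cut between the vertices whose bit is 0
  and those whose bit is 1. Let \<open>X\<close> be the union of these \<open>O(log k)\<close> cuts and \<open>U r\<close> the component
  of \<open>r\<close> in \<open>G - X\<close>. By submodularity of the cut function on bisets, every cut between \<open>r\<close> and
  \<open>R - {r}\<close> can be uncrossed with all computed cuts without increasing its weight, after which its
  side of \<open>r\<close> lies in \<open>U r\<close>. So it suffices to solve, for each \<open>r\<close>, an instance that consists of the
  edges touching \<open>U r\<close> and one additional edge from each removed vertex adjacent to \<open>U r\<close> to a
  common sink. The sets \<open>U r\<close> are disjoint and contain no removed vertex, hence these instances have
  at most \<open>2 * m\<close> edges in total.
\<close>

section \<open>Isolating cuts\<close>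

text \<open>Several obstacles shape the proof. Cuts may contain vertices, so the side of a terminal
  is a biset: an inner and an outer set whose difference is removed. Positivity of the weights
  guarantees that every edge of a minimum cut leaves its side. The bound charges each small graph as
  \<open>Tec m' n\<close> with the same \<open>n\<close>, so no vertex may be added: the sink is
  another terminal \<open>z\<close> of \<open>R\<close>, and the case \<open>R = {r}\<close> is
  treated apart. \<open>P\<close> is known only through its contract and may overwrite every array
  that it names, the input included. All data that must survive a call therefore lie in arrays with
  fresh names, and the arrays read by \<open>P\<close> are prepared anew before each call. Overheads
  are paid by the fact that \<open>P\<close> has to write its output, which makes
  \<open>Tec m' n\<close> at least \<open>n + m'\<close>. For each terminal this covers work linear
  in \<open>n\<close> and in the size of its own graph, but not in \<open>m\<close>; edges are
  therefore marked by stamps that are never cleared.\<close>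

definition gstep :: "'v set \<Rightarrow> 'v set set \<Rightarrow> 'v element set \<Rightarrow> 'v \<Rightarrow> 'v \<Rightarrow> bool" where
  "gstep V E X u v \<longleftrightarrow> {u, v} \<in> E \<and> Edge {u, v} \<notin> X \<and> v \<in> V \<and> Vertex v \<notin> X"

text \<open>Only the vertex entered by a step is tested, so the start \<open>r\<close> belongs to
  the set even if \<open>X\<close> removes it. Where this matters,
  \<open>Vertex r \<notin> X\<close> is assumed; it holds for terminals, which are never
  elements.\<close>

definition reach :: "'v set \<Rightarrow> 'v set set \<Rightarrow> 'v element set \<Rightarrow> 'v \<Rightarrow> 'v set" where
  "reach V E X r = {v. (gstep V E X)\<^sup>*\<^sup>* r v}"

lemma reach_refl [simp]: "r \<in> reach V E X r"
  by (simp add: reach_def)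

lemma reach_step: "u \<in> reach V E X r \<Longrightarrow> gstep V E X u v \<Longrightarrow> v \<in> reach V E X r"
  by (auto simp: reach_def)

lemma reach_induct [consumes 1, case_names refl step]:
  assumes "v \<in> reach V E X r" "Q r"
    "\<And>u v. u \<in> reach V E X r \<Longrightarrow> gstep V E X u v \<Longrightarrow> Q u \<Longrightarrow> Q v"
  shows "Q v"
  using assms(1) unfolding reach_def mem_Collect_eq
  by (induction rule: rtranclp_induct) (use assms in \<open>auto simp: reach_def\<close>)

lemma reach_trans: "u \<in> reach V E X r \<Longrightarrow> v \<in> reach V E X u \<Longrightarrow> v \<in> reach V E X r"
  by (auto simp: reach_def)

lemma reach_avoids:
  assumes "v \<in> reach V E X r" "r \<in> V" "Vertex r \<notin> X"
  shows "v \<in> V \<and> Vertex v \<notin> X"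
  using assms by (induction rule: reach_induct) (auto simp: gstep_def)

lemma reach_sym:
  assumes "v \<in> reach V E X r" "r \<in> V" "Vertex r \<notin> X"
  shows "r \<in> reach V E X v"
  using assms(1)
proof (induction rule: reach_induct)
  case (step u v)
  have "gstep V E X v u"
    using step reach_avoids[OF step(1) assms(2,3)] by (auto simp: gstep_def insert_commute)
  then have "u \<in> reach V E X v" using reach_step reach_refl by metis
  then show ?case using step(3) reach_trans by metis
qed simp

lemma reach_antimono: "X \<subseteq> Y \<Longrightarrow> reach V E Y r \<subseteq> reach V E X r"
proof
  fix v assume "X \<subseteq> Y" "v \<in> reach V E Y r"
  from this(2) show "v \<in> reach V E X r"
    by (induction rule: reach_induct) (use \<open>X \<subseteq> Y\<close> reach_step[of _ V E X r] in \<open>auto simp: gstep_def\<close>)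
qed

lemma path_avoiding_reach: "path_avoiding V E X p \<Longrightarrow> last p \<in> reach V E X (hd p)"
proof (induction p)
  case (Cons u p)
  show ?case
  proof (cases p)
    case (Cons v q)
    then have "path_avoiding V E X p" "gstep V E X u v"
      using Cons.prems by (auto simp: path_avoiding_def gstep_def)
    then have "last p \<in> reach V E X v" "v \<in> reach V E X u"
      using Cons.IH Cons reach_step reach_refl by (metis list.sel(1))+
    then show ?thesis using Cons reach_trans by fastforce
  qed simp
qed (simp add: path_avoiding_def)

lemma reach_path_avoiding:
  assumes "v \<in> reach V E X r" "r \<in> V" "Vertex r \<notin> X"
  shows "\<exists>p. path_avoiding V E X p \<and> hd p = r \<and> last p = v"
  using assms(1)
proof (induction rule: reach_induct)
  case refl
  then show ?case by (intro exI[of _ "[r]"]) (use assms in \<open>auto simp: path_avoiding_def\<close>)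
next
  case (step u v)
  then obtain p where p: "path_avoiding V E X p" "hd p = r" "last p = u" by blast
  show ?case
  \<comment> \<open>Paths have to be distinct: if the new vertex already lies on the path, the path
    is cut off there instead of being extended.\<close>
  proof (cases "v \<in> set p")
    case True
    then obtain ys zs where ys: "p = (ys @ [v]) @ zs" by (metis append.assoc append_Cons append_Nil split_list)
    then have "path_avoiding V E X (ys @ [v])"
      using p(1) unfolding path_avoiding_def ys successively_append_iff[of _ "ys @ [v]"] by auto
    moreover have "hd (ys @ [v]) = r" using p(2) ys by (cases ys) auto
    ultimately show ?thesis by (metis last_snoc)
  next
    case False
    then show ?thesis using p step(2)
      by (intro exI[of _ "p @ [v]"])
        (auto simp: path_avoiding_def successively_append_iff gstep_def hd_append)
  qed
qed

text \<open>Replaces distinct paths by a transitive closure, on which all later inductions run.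
  Sources are terminals and hence never removed.\<close>

lemma element_cut_iff:
  assumes "A \<subseteq> T" "T \<subseteq> V"
  shows "element_cut V E T A B X \<longleftrightarrow>
    X \<subseteq> elements V E T \<and> (\<forall>a\<in>A. reach V E X a \<inter> B = {})"
proof -
  have "(\<nexists>p. path_avoiding V E X p \<and> hd p \<in> A \<and> last p \<in> B) \<longleftrightarrow>
      (\<forall>a\<in>A. reach V E X a \<inter> B = {})" if "X \<subseteq> elements V E T"
  proof -
    have "a \<in> V \<and> Vertex a \<notin> X" if "a \<in> A" for a
      using assms that \<open>X \<subseteq> elements V E T\<close> by (auto simp: elements_def)
    then show ?thesis
      using reach_path_avoiding[of _ V E X] path_avoiding_reach[of V E X] by blast
  qed
  then show ?thesis unfolding element_cut_def by blast
qed

section \<open>Boundaries of bisets and submodularity\<close>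

text \<open>The boundary of the biset \<open>(S, S')\<close>, where \<open>S' - S\<close> are the vertices that are cut.\<close>

definition bd :: "'v set set \<Rightarrow> 'v set \<Rightarrow> 'v set \<Rightarrow> 'v element set" where
  "bd E S S' = Vertex ` (S' - S) \<union> Edge ` {e \<in> E. \<exists>u v. e = {u, v} \<and> u \<in> S \<and> v \<notin> S'}"

lemma Vertex_in_bd [simp]: "Vertex v \<in> bd E S S' \<longleftrightarrow> v \<in> S' \<and> v \<notin> S"
  by (auto simp: bd_def)

lemma Edge_in_bd: "Edge e \<in> bd E S S' \<longleftrightarrow> e \<in> E \<and> (\<exists>u v. e = {u, v} \<and> u \<in> S \<and> v \<notin> S')"
  by (auto simp: bd_def)

lemma bd_union_subset:
  assumes "S \<subseteq> S'" "P \<subseteq> P'"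
  shows "bd E (S \<inter> P) (S' \<inter> P') \<union> bd E (S \<union> P) (S' \<union> P') \<subseteq> bd E S S' \<union> bd E P P'"
proof
  fix x assume "x \<in> bd E (S \<inter> P) (S' \<inter> P') \<union> bd E (S \<union> P) (S' \<union> P')"
  then show "x \<in> bd E S S' \<union> bd E P P'"
    by (cases x) (auto simp: Edge_in_bd)
qed

text \<open>An edge in both boundaries on the left has one end in \<open>S \<inter> P\<close> and
  one end outside \<open>S' \<union> P'\<close>. These are different ends, because inner sets lie in
  outer sets, so the edge crosses both given bisets.\<close>

lemma bd_inter_subset:
  assumes "S \<subseteq> S'" "P \<subseteq> P'"
  shows "bd E (S \<inter> P) (S' \<inter> P') \<inter> bd E (S \<union> P) (S' \<union> P') \<subseteq> bd E S S' \<inter> bd E P P'"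
proof
  fix x assume "x \<in> bd E (S \<inter> P) (S' \<inter> P') \<inter> bd E (S \<union> P) (S' \<union> P')"
  then show "x \<in> bd E S S' \<inter> bd E P P'"
  proof (cases x)
    case (Edge e)
    with \<open>x \<in> _\<close> have e: "Edge e \<in> bd E (S \<inter> P) (S' \<inter> P')" "Edge e \<in> bd E (S \<union> P) (S' \<union> P')"
      by auto
    obtain u v where "e \<in> E" "e = {u, v}" "u \<in> S \<inter> P" "v \<notin> S' \<inter> P'"
      using e(1) unfolding Edge_in_bd by blast
    moreover obtain u' v' where "e = {u', v'}" "u' \<in> S \<union> P" "v' \<notin> S' \<union> P'"
      using e(2) unfolding Edge_in_bd by blast
    moreover have "u = u' \<and> v = v'" using calculation assms by (auto simp: doubleton_eq_iff)
    ultimately show ?thesis using Edge by (auto simp: Edge_in_bd)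
  qed auto
qed

text \<open>Two sums equal the sum over the union plus the sum over the intersection, so the two
  inclusions suffice.\<close>

lemma sum_uncross:
  fixes \<omega> :: "'a \<Rightarrow> real"
  assumes "finite C" "finite D" "\<And>x. x \<in> C \<union> D \<Longrightarrow> 0 \<le> \<omega> x"
    and "A \<union> B \<subseteq> C \<union> D" "A \<inter> B \<subseteq> C \<inter> D"
  shows "sum \<omega> A + sum \<omega> B \<le> sum \<omega> C + sum \<omega> D"
proof -
  have fin: "finite A" "finite B" using assms finite_subset[of _ "C \<union> D"] by auto
  have "sum \<omega> A + sum \<omega> B = sum \<omega> (A \<union> B) + sum \<omega> (A \<inter> B)"
    using fin by (simp add: sum.union_inter)
  also have "\<dots> \<le> sum \<omega> (C \<union> D) + sum \<omega> (C \<inter> D)"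
    using assms by (intro add_mono sum_mono2) auto
  also have "\<dots> = sum \<omega> C + sum \<omega> D" using assms by (simp add: sum.union_inter)
  finally show ?thesis .
qed

section \<open>Minimum cuts with finite weights and their uncrossing\<close>

locale weighted_instance =
  fixes V :: "'v set" and E T and \<omega> :: "'v element \<Rightarrow> real"
  assumes finite_V: "finite V"
    and edges: "E \<subseteq> {{u, v} | u v. u \<in> V \<and> v \<in> V \<and> u \<noteq> v}"
    and T_V: "T \<subseteq> V"
    and pos: "x \<in> elements V E T \<Longrightarrow> 0 < \<omega> x"
begin

lemma nonneg: "x \<in> elements V E T \<Longrightarrow> 0 \<le> \<omega> x"
  using pos less_imp_le by blast

lemma finite_E: "finite E"
proof (rule finite_subset)
  show "E \<subseteq> Pow V" using edges by auto
qed (simp add: finite_V)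

lemma finite_elements: "finite (elements V E T)"
  by (simp add: elements_def finite_V finite_E)

lemma edge_V: "{u, v} \<in> E \<Longrightarrow> u \<in> V \<and> v \<in> V \<and> u \<noteq> v"
  using edges by (fastforce simp: doubleton_eq_iff)

lemma edgeE:
  assumes "e \<in> E"
  obtains u v where "e = {u, v}" "u \<in> V" "v \<in> V" "u \<noteq> v"
  using assms edges by auto

lemma sum_mono_elements: "X \<subseteq> Y \<Longrightarrow> Y \<subseteq> elements V E T \<Longrightarrow> sum \<omega> X \<le> sum \<omega> Y"
  using pos finite_elements by (intro sum_mono2) (auto intro: finite_subset less_imp_le)

abbreviation "ecut \<equiv> element_cut V E T"

lemma element_cut_reach:
  assumes "A \<subseteq> T"
  shows "ecut A B X \<longleftrightarrow>
    X \<subseteq> elements V E T \<and> (\<forall>a\<in>A. reach V E X a \<inter> B = {})"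
  using element_cut_iff[OF assms T_V] .

lemma element_cut_sym:
  assumes "A \<subseteq> T" "B \<subseteq> T" "ecut A B X"
  shows "ecut B A X"
proof -
  have X: "X \<subseteq> elements V E T" using assms by (simp add: element_cut_def)
  have "b \<in> V \<and> Vertex b \<notin> X" if "b \<in> B" for b
    using X that assms T_V by (auto simp: elements_def)
  then show ?thesis using assms reach_sym[of _ V E X] by (fastforce simp: element_cut_reach)
qed

definition side :: "'v element set \<Rightarrow> 'v set \<Rightarrow> 'v set" where
  "side X A = (\<Union>a\<in>A. reach V E X a)"

text \<open>All removed vertices are added, adjacent to the side or not. The boundary then contains
  every vertex of the cut outright, and only edges need an argument.\<close>

definition side' :: "'v element set \<Rightarrow> 'v set \<Rightarrow> 'v set" where
  "side' X A = side X A \<union> {v. Vertex v \<in> X}"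

lemma side_avoids:
  assumes "X \<subseteq> elements V E T" "A \<subseteq> T" "v \<in> side X A"
  shows "v \<in> V" "Vertex v \<notin> X"
proof -
  obtain a where "a \<in> A" "v \<in> reach V E X a" using assms(3) by (auto simp: side_def)
  moreover have "a \<in> V" "Vertex a \<notin> X" using assms \<open>a \<in> A\<close> T_V by (auto simp: elements_def)
  ultimately show "v \<in> V" "Vertex v \<notin> X" using reach_avoids by metis+
qed

lemma bd_side:
  assumes "X \<subseteq> elements V E T"
  shows "bd E (side X A) (side' X A) \<subseteq> X"
proof
  fix x assume x: "x \<in> bd E (side X A) (side' X A)"
  show "x \<in> X"
  proof (cases x)
    case (Edge e)
    then obtain u v where "e \<in> E" "e = {u, v}" "u \<in> side X A" "v \<notin> side' X A"
      using x by (auto simp: Edge_in_bd)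
    moreover have "v \<in> side X A" if "Edge {u, v} \<notin> X"
      using calculation that edge_V reach_step[of u V E X _ v]
      by (auto simp: side_def side'_def gstep_def)
    ultimately show ?thesis using Edge by (auto simp: side'_def)
  qed (use x in \<open>auto simp: side'_def\<close>)
qed

lemma cut_side'_disjoint:
  assumes "A \<subseteq> T" "B \<subseteq> T" "ecut A B X"
  shows "B \<inter> side' X A = {}"
  using assms by (auto simp: element_cut_reach side'_def side_def elements_def)

lemma side'_diff:
  assumes "X \<subseteq> elements V E T"
  shows "side' X A - side X A \<subseteq> V - T"
  using assms by (auto simp: side'_def elements_def)

lemma bd_elements: "S' - S \<subseteq> V - T \<Longrightarrow> bd E S S' \<subseteq> elements V E T"
  by (auto simp: bd_def elements_def)

text \<open>Leaving \<open>S\<close> means entering \<open>S' - S\<close>, whose vertices belong to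
  the boundary, or jumping out of \<open>S'\<close> along a boundary edge.\<close>

lemma cut_bd:
  assumes "A \<subseteq> T" "A \<subseteq> S" "B \<inter> S = {}" "S' - S \<subseteq> V - T"
  shows "ecut A B (bd E S S')"
proof -
  have "v \<in> S" if "v \<in> reach V E (bd E S S') a" "a \<in> A" for a v
    using that(1)
    by (induction rule: reach_induct) (use that assms in \<open>auto simp: gstep_def Edge_in_bd\<close>)
  then show ?thesis using assms bd_elements by (fastforce simp: element_cut_reach)
qed

definition min_cut :: "'v set \<Rightarrow> 'v set \<Rightarrow> 'v element set \<Rightarrow> bool" where
  "min_cut A B X \<longleftrightarrow> ecut A B X \<and> (\<forall>Y. ecut A B Y \<longrightarrow> sum \<omega> X \<le> sum \<omega> Y)"

lemma min_cut_sym: "A \<subseteq> T \<Longrightarrow> B \<subseteq> T \<Longrightarrow> min_cut A B X \<Longrightarrow> min_cut B A X"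
  using element_cut_sym unfolding min_cut_def by blast

lemma min_cut_elements: "min_cut A B X \<Longrightarrow> X \<subseteq> elements V E T"
  by (simp add: min_cut_def element_cut_def)

lemma side_subset_side': "side X A \<subseteq> side' X A"
  by (auto simp: side'_def)

lemma subset_side: "A \<subseteq> side X A"
  by (auto simp: side_def)

text \<open>The boundary is a cut inside \<open>X\<close>, and since weights are positive, a proper
  subset would be strictly lighter. The gain concerns edges: a minimum cut contains no edge within
  its own side.\<close>

lemma min_cut_eq_bd:
  assumes "A \<subseteq> T" "B \<subseteq> T" "min_cut A B X"
  shows "X = bd E (side X A) (side' X A)"
proof (rule ccontr)
  let ?Y = "bd E (side X A) (side' X A)"
  assume "X \<noteq> ?Y"
  have X: "ecut A B X" "X \<subseteq> elements V E T"
    using assms by (auto simp: min_cut_def element_cut_def)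
  have Y: "?Y \<subseteq> X" by (rule bd_side[OF X(2)])
  have "ecut A B ?Y"
    using cut_side'_disjoint[OF assms(1,2) X(1)] side_subset_side'[of X A]
    by (intro cut_bd) (use assms X side'_diff subset_side in auto)
  then have "sum \<omega> X \<le> sum \<omega> ?Y" using assms by (simp add: min_cut_def)
  moreover have "sum \<omega> ?Y < sum \<omega> X"
  proof -
    obtain x where "x \<in> X" "x \<notin> ?Y" using \<open>X \<noteq> ?Y\<close> Y by blast
    then show ?thesis
      using X Y pos finite_elements
      by (intro sum_strict_mono2[where b = x]) (auto intro: finite_subset less_imp_le)
  qed
  ultimately show False by simp
qed

text \<open>The union of the two bisets still separates \<open>A\<close> from \<open>B\<close>, so
  its boundary weighs at least as much as \<open>X\<close>. Submodularity then leaves the boundary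
  of the intersection no heavier than that of \<open>(S, S')\<close>.\<close>

lemma uncross:
  assumes AB: "A \<subseteq> T" "B \<subseteq> T" "min_cut A B X"
    and S: "S \<subseteq> S'" "S' - S \<subseteq> V - T" "S' \<inter> B = {}"
  shows "sum \<omega> (bd E (S \<inter> side X A) (S' \<inter> side' X A)) \<le> sum \<omega> (bd E S S')"
proof -
  let ?P = "side X A" and ?P' = "side' X A"
  have X: "ecut A B X" "X \<subseteq> elements V E T"
    using AB by (auto simp: min_cut_def element_cut_def)
  have d: "B \<inter> ?P' = {}" using cut_side'_disjoint AB X by blast
  have P': "?P' - ?P \<subseteq> V - T" using side'_diff[OF X(2)] .
  have "S' \<union> ?P' - (S \<union> ?P) \<subseteq> V - T" using P' S by blast
  then have "ecut A B (bd E (S \<union> ?P) (S' \<union> ?P'))"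
    using d S AB subset_side[of A X] side_subset_side'[of X A] by (intro cut_bd) auto
  then have "sum \<omega> X \<le> sum \<omega> (bd E (S \<union> ?P) (S' \<union> ?P'))"
    using AB by (simp add: min_cut_def)
  moreover have "sum \<omega> (bd E (S \<inter> ?P) (S' \<inter> ?P')) + sum \<omega> (bd E (S \<union> ?P) (S' \<union> ?P'))
      \<le> sum \<omega> (bd E S S') + sum \<omega> (bd E ?P ?P')"
    using bd_union_subset[OF S(1) side_subset_side', of E] bd_inter_subset[OF S(1) side_subset_side', of E]
      finite_subset[OF bd_elements[OF S(2)] finite_elements] finite_subset[OF bd_elements[OF P'] finite_elements]
      subsetD[OF bd_elements[OF S(2)]] subsetD[OF bd_elements[OF P']] nonneg
    by (intro sum_uncross) blast+
  moreover have "sum \<omega> (bd E ?P ?P') = sum \<omega> X" using min_cut_eq_bd[OF AB] by simp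
  ultimately show ?thesis by linarith
qed

text \<open>Invariant of the successive uncrossing with the cuts in \<open>CS\<close>;
  \<open>c\<close> will be the weight of the cut that is being uncrossed.\<close>

definition confined :: "'v \<Rightarrow> 'v set \<Rightarrow> real \<Rightarrow> ('v set \<times> 'v set \<times> 'v element set) set \<Rightarrow>
    'v set \<Rightarrow> 'v set \<Rightarrow> bool" where
  "confined r R c CS S S' \<longleftrightarrow> r \<in> S \<and> S \<subseteq> S' \<and> S' - S \<subseteq> V - T \<and> S' \<inter> (R - {r}) = {} \<and>
    sum \<omega> (bd E S S') \<le> c \<and> (\<forall>(A, B, X) \<in> CS. S \<subseteq> side X A \<and> S' \<subseteq> side' X A)"

text \<open>Intersecting only shrinks the biset, so containment in the earlier sides and
  disjointness from \<open>R - {r}\<close> survive.\<close>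

lemma confined_insert:
  assumes AB: "A \<subseteq> T" "B \<subseteq> T" "r \<in> A" "B \<subseteq> R - {r}" "min_cut A B X"
    and S: "confined r R c CS S S'"
  shows "confined r R c (insert (A, B, X) CS) (S \<inter> side X A) (S' \<inter> side' X A)"
proof -
  have *: "S' \<inter> B = {}" "S \<subseteq> S'" "S' - S \<subseteq> V - T" using S AB(4) unfolding confined_def by blast+
  have "sum \<omega> (bd E (S \<inter> side X A) (S' \<inter> side' X A)) \<le> c"
    using uncross[OF AB(1,2,5) *(2,3,1)] S unfolding confined_def by linarith
  moreover have "S' \<inter> side' X A - S \<inter> side X A \<subseteq> V - T"
    using * side'_diff[OF min_cut_elements[OF AB(5)], of A] by blast
  moreover have "r \<in> S \<inter> side X A"
    using S AB(3) subset_side[of A X] unfolding confined_def by blast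
  moreover have "S \<inter> side X A \<subseteq> S' \<inter> side' X A"
    using * side_subset_side'[of X A] by blast
  moreover have "S' \<inter> side' X A \<inter> (R - {r}) = {}"
    using S unfolding confined_def by blast
  moreover have "\<forall>(A', B', X') \<in> insert (A, B, X) CS.
      S \<inter> side X A \<subseteq> side X' A' \<and> S' \<inter> side' X A \<subseteq> side' X' A'"
    using S unfolding confined_def by auto
  ultimately show ?thesis unfolding confined_def by (intro conjI)
qed

text \<open>Starts from the biset of \<open>Y\<close> itself and uncrosses it with one cut of the
  family at a time.\<close>

lemma uncross_family:
  assumes fin: "finite CS" and r: "r \<in> T"
    and CS: "\<forall>(A, B, X) \<in> CS.
      A \<subseteq> T \<and> B \<subseteq> T \<and> r \<in> A \<and> B \<subseteq> R - {r} \<and> min_cut A B X"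
    and Y: "ecut {r} (R - {r}) Y" "R \<subseteq> T"
  shows "\<exists>S S'. confined r R (sum \<omega> Y) CS S S'"
  using fin CS
proof (induction rule: finite_induct)
  case empty
  have "Y \<subseteq> elements V E T" using Y by (simp add: element_cut_def)
  moreover have "{r} \<subseteq> T" "R - {r} \<subseteq> T" using r Y(2) by auto
  ultimately have "side' Y {r} - side Y {r} \<subseteq> V - T" "side' Y {r} \<inter> (R - {r}) = {}"
      "sum \<omega> (bd E (side Y {r}) (side' Y {r})) \<le> sum \<omega> Y"
    using side'_diff[of Y "{r}"] cut_side'_disjoint[of "{r}" "R - {r}" Y] Y(1)
      sum_mono_elements[OF bd_side[of Y "{r}"]] by (simp_all add: Int_commute)
  then have "confined r R (sum \<omega> Y) {} (side Y {r}) (side' Y {r})"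
    using subset_side[of "{r}" Y] side_subset_side'[of Y "{r}"] by (simp add: confined_def)
  then show ?case by blast
next
  case (insert C CS)
  obtain A B X where C: "C = (A, B, X)" by (cases C)
  obtain S S' where "confined r R (sum \<omega> Y) CS S S'" using insert by auto
  then have "confined r R (sum \<omega> Y) (insert C CS) (S \<inter> side X A) (S' \<inter> side' X A)"
    unfolding C using insert.prems C by (intro confined_insert) auto
  then show ?case by blast
qed

definition bipartitions :: "'v set \<Rightarrow> ('v set \<times> 'v set \<times> 'v element set) set \<Rightarrow> bool" where
  "bipartitions R CS \<longleftrightarrow> finite CS \<and>
     (\<forall>(A, B, X) \<in> CS. A \<union> B = R \<and> A \<inter> B = {} \<and> min_cut A B X)"

definition separated :: "('v set \<times> 'v set \<times> 'v element set) set \<Rightarrow> 'v \<Rightarrow> 'v \<Rightarrow> bool" where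
  "separated CS r r' \<longleftrightarrow> (\<exists>(A, B, X) \<in> CS. r \<in> A \<and> r' \<in> B \<or> r \<in> B \<and> r' \<in> A)"

end

section \<open>Components of the terminals and their small graphs\<close>

definition removed :: "('v set \<times> 'v set \<times> 'v element set) set \<Rightarrow> 'v element set" where
  "removed CS = (\<Union>(A, B, X) \<in> CS. X)"

locale isolation = weighted_instance +
  fixes R CS
  assumes R_T: "R \<subseteq> T" and bip: "bipartitions R CS"
    and sep: "\<And>r r'. r \<in> R \<Longrightarrow> r' \<in> R \<Longrightarrow> r \<noteq> r' \<Longrightarrow> separated CS r r'"
begin

abbreviation "X\<^sub>0 \<equiv> removed CS"

definition "U r = reach V E X\<^sub>0 r"

lemma CS_D:
  assumes "(A, B, X) \<in> CS"
  shows "A \<union> B = R" "A \<inter> B = {}" "min_cut A B X" "X \<subseteq> X\<^sub>0" "A \<subseteq> T" "B \<subseteq> T"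
  using assms bip R_T unfolding bipartitions_def removed_def by fast+

lemma X0_elements: "X\<^sub>0 \<subseteq> elements V E T"
  using CS_D(3) min_cut_elements unfolding removed_def by fastforce

lemma T_not_X0: "v \<in> T \<Longrightarrow> Vertex v \<notin> X\<^sub>0"
  using X0_elements by (auto simp: elements_def)

lemma U_D:
  assumes "v \<in> U r" "r \<in> R"
  shows "v \<in> V" "Vertex v \<notin> X\<^sub>0"
  using assms reach_avoids[of v V E "X\<^sub>0" r] R_T T_V T_not_X0 unfolding U_def by blast+

text \<open>Some cut of the family has the two terminals on opposite sides, and removing even more
  elements cannot reconnect them.\<close>

lemma R_not_U:
  assumes "r \<in> R" "r' \<in> R" "r \<noteq> r'"
  shows "r' \<notin> U r"
proof
  assume "r' \<in> U r"
  obtain A B X where C: "(A, B, X) \<in> CS" and r: "r \<in> A \<and> r' \<in> B \<or> r \<in> B \<and> r' \<in> A"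
    using sep[OF assms] unfolding separated_def by blast
  note D = CS_D[OF C]
  have "r' \<in> reach V E X r" using \<open>r' \<in> U r\<close> reach_antimono[OF D(4)] U_def by blast
  moreover have "ecut A B X" "ecut B A X"
    using D min_cut_sym[OF D(5,6,3)] unfolding min_cut_def by auto
  ultimately show False using r D by (auto simp: element_cut_reach)
qed

lemma U_disjoint:
  assumes "r \<in> R" "r' \<in> R" "r \<noteq> r'"
  shows "U r \<inter> U r' = {}"
proof (rule ccontr)
  assume "U r \<inter> U r' \<noteq> {}"
  then obtain v where "v \<in> U r" "v \<in> U r'" by blast
  then have "r' \<in> U r"
    using reach_trans[of v V E "X\<^sub>0" r r'] reach_sym[of v V E "X\<^sub>0" r'] assms R_T T_V T_not_X0
    unfolding U_def by blast
  then show False using R_not_U assms by blast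
qed

text \<open>The element \<open>{v, z}\<close> of the graph of \<open>r\<close> stands for the boundary vertex \<open>v\<close>.\<close>

definition "E\<^sub>r r = {e \<in> E. e \<inter> U r \<noteq> {}}"
definition "bnd r = {v. Vertex v \<in> X\<^sub>0 \<and> (\<exists>u \<in> U r. {u, v} \<in> E)}"
definition "G_edges r z = E\<^sub>r r \<union> (\<lambda>v. {v, z}) ` bnd r"
text \<open>Surviving vertices outside \<open>U r\<close> become terminals because all of them serve
  as sinks, and cuts are asked for between sets of terminals. Inside \<open>U r\<close> nothing
  changes, and vertices of \<open>X\<^sub>0\<close> stay removable.\<close>

definition "G_terms r = {v \<in> V. Vertex v \<notin> X\<^sub>0 \<and> (v \<in> U r \<longrightarrow> v \<in> T)}"
definition "G_sink r = {v \<in> V. Vertex v \<notin> X\<^sub>0 \<and> v \<notin> U r}"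
definition "back r z x = (case x of Vertex v \<Rightarrow> Vertex v
   | Edge e \<Rightarrow> if e \<in> E\<^sub>r r then Edge e else Vertex (the_elem (e - {z})))"

lemma back_simps [simp]:
  "back r z (Vertex v) = Vertex v"
  "e \<in> E\<^sub>r r \<Longrightarrow> back r z (Edge e) = Edge e"
  by (simp_all add: back_def)

context
  fixes r z assumes r: "r \<in> R" and z: "z \<in> R" "z \<noteq> r"
begin

lemma z_props: "z \<in> V" "z \<in> T" "z \<notin> U r" "Vertex z \<notin> X\<^sub>0"
  using R_not_U[OF r z(1)] z r R_T T_V T_not_X0 by auto

lemma bnd_D: "v \<in> bnd r \<Longrightarrow> v \<in> V \<and> v \<notin> T \<and> v \<notin> U r \<and> v \<noteq> z \<and> Vertex v \<in> X\<^sub>0"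
  using U_D[OF _ r] X0_elements z_props unfolding bnd_def by (auto simp: elements_def)

text \<open>The pair \<open>{v, z}\<close> may well be an edge of \<open>E\<close>, but both of its
  ends lie outside \<open>U r\<close>. Hence the additional edges never collide with those of
  \<open>E\<^sub>r r\<close>.\<close>

lemma bnd_edge: "v \<in> bnd r \<Longrightarrow> {v, z} \<notin> E\<^sub>r r"
  using bnd_D z_props unfolding E\<^sub>r_def by auto

lemma back_bnd [simp]: "v \<in> bnd r \<Longrightarrow> back r z (Edge {v, z}) = Vertex v"
  using bnd_edge[of v] bnd_D[of v] by (simp add: back_def insert_Diff_if)

lemma G_edges_sub: "G_edges r z \<subseteq> {{u, v} | u v. u \<in> V \<and> v \<in> V \<and> u \<noteq> v}"
proof
  fix e assume "e \<in> G_edges r z"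
  then consider "e \<in> E" | v where "v \<in> bnd r" "e = {v, z}" by (auto simp: G_edges_def E\<^sub>r_def)
  then show "e \<in> {{u, v} | u v. u \<in> V \<and> v \<in> V \<and> u \<noteq> v}"
    by cases (use edges bnd_D z_props in blast)+
qed

lemma G_element_cases:
  assumes "x \<in> elements V (G_edges r z) (G_terms r)"
  obtains (bnd) v where "Vertex v \<in> X\<^sub>0" "x = Vertex v"
    | (vertex) v where "v \<in> U r" "v \<notin> T" "x = Vertex v"
    | (edge) e where "e \<in> E\<^sub>r r" "x = Edge e"
    | (sink) v where "v \<in> bnd r" "x = Edge {v, z}"
  using assms that by (auto simp: elements_def G_terms_def G_edges_def)

lemma back_element:
  assumes "x \<in> elements V (G_edges r z) (G_terms r)"
  shows "back r z x \<in> elements V E T"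
  using assms
proof (cases rule: G_element_cases)
  case (edge e) then show ?thesis by (auto simp: E\<^sub>r_def elements_def)
next
  case (sink v) then show ?thesis using bnd_D by (auto simp: elements_def)
next
  case (vertex v) then show ?thesis using U_D[OF _ r] by (auto simp: elements_def)
next
  case (bnd v) then show ?thesis using X0_elements by auto
qed

lemma G_instance:
  "weighted_instance V (G_edges r z) (G_terms r) (\<omega> \<circ> back r z)"
  using finite_V G_edges_sub pos[OF back_element] by unfold_locales (auto simp: G_terms_def)

text \<open>By induction, whatever \<open>r\<close> reaches in the original graph lies in
  \<open>U r\<close> and is also reached in the small graph. A step out of \<open>U r\<close> would
  end at a sink, or at a boundary vertex whose edge to \<open>z\<close> is not cut and so leads to a
  sink.\<close>

lemma G_cut_back:
  assumes Y: "element_cut V (G_edges r z) (G_terms r) {r} (G_sink r) Y"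
  shows "ecut {r} (R - {r}) (back r z ` Y)"
proof -
  let ?Y = "back r z ` Y"
  have rT: "{r} \<subseteq> G_terms r" "G_terms r \<subseteq> V"
    using r R_T T_V T_not_X0 by (auto simp: G_terms_def)
  have Ye: "Y \<subseteq> elements V (G_edges r z) (G_terms r)"
    and Yr: "reach V (G_edges r z) Y r \<inter> G_sink r = {}"
    using Y element_cut_iff[OF rT, of "G_edges r z" "G_sink r" Y] by auto
  have "v \<in> U r \<and> v \<in> reach V (G_edges r z) Y r" if "v \<in> reach V E ?Y r" for v
    using that
  proof (induction rule: reach_induct)
    case refl then show ?case by (simp add: U_def)
  next
    case (step u v)
    then have u: "u \<in> U r" "u \<in> reach V (G_edges r z) Y r" by auto
    have uv: "{u, v} \<in> E\<^sub>r r" using step(2) u by (auto simp: gstep_def E\<^sub>r_def)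
    have "Edge {u, v} \<notin> Y" "Vertex v \<notin> Y"
      using step(2) uv image_eqI[of "Edge {u, v}" "back r z" "Edge {u, v}" Y]
        image_eqI[of "Vertex v" "back r z" "Vertex v" Y] by (auto simp: gstep_def)
    then have "gstep V (G_edges r z) Y u v"
      using step(2) uv by (auto simp: gstep_def G_edges_def)
    then have v: "v \<in> reach V (G_edges r z) Y r" using u reach_step by metis
    have "v \<in> U r"
    proof (rule ccontr)
      assume nU: "v \<notin> U r"
      show False
      proof (cases "Vertex v \<in> X\<^sub>0")
        case True
        then have b: "v \<in> bnd r" using u step(2) by (auto simp: bnd_def gstep_def)
        then have "Edge {v, z} \<notin> Y"
          using step(2) image_eqI[of "Vertex v" "back r z" "Edge {v, z}" Y] by (auto simp: gstep_def)
        moreover have "Vertex z \<notin> Y" using Ye z_props by (auto simp: elements_def G_terms_def)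
        ultimately have "gstep V (G_edges r z) Y v z"
          using b z_props by (auto simp: gstep_def G_edges_def)
        then have "z \<in> reach V (G_edges r z) Y r" using v reach_step by metis
        then show False using Yr z_props by (auto simp: G_sink_def)
      next
        case False
        then show False using nU v Yr step(2) by (auto simp: G_sink_def gstep_def)
      qed
    qed
    then show ?case using v by blast
  qed
  then have "reach V E ?Y r \<inter> (R - {r}) = {}" using R_not_U[OF r] by blast
  moreover have "?Y \<subseteq> elements V E T" using Ye back_element by auto
  ultimately show ?thesis using r R_T by (auto simp: element_cut_reach)
qed

text \<open>Each cut is also read in the opposite direction, so that uncrossing can always use the
  side that contains \<open>r\<close>.\<close>

lemma oriented_family:
  defines "DS \<equiv> CS \<union> (\<lambda>(A, B, X). (B, A, X)) ` CS"
  shows "finite {(A, B, X) \<in> DS. r \<in> A}"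
    and "(A, B, X) \<in> {(A, B, X) \<in> DS. r \<in> A} \<Longrightarrow>
      A \<subseteq> T \<and> B \<subseteq> T \<and> r \<in> A \<and> B \<subseteq> R - {r} \<and> min_cut A B X"
    and "(A, B, X) \<in> CS \<Longrightarrow> \<exists>A' B'. (A', B', X) \<in> {(A, B, X) \<in> DS. r \<in> A}"
proof -
  have "finite DS" using bip by (auto simp: DS_def bipartitions_def)
  then show "finite {(A, B, X) \<in> DS. r \<in> A}" by (rule rev_finite_subset) auto
next
  assume "(A, B, X) \<in> {(A, B, X) \<in> DS. r \<in> A}"
  then have "r \<in> A" "(A, B, X) \<in> CS \<or> (B, A, X) \<in> CS" by (auto simp: DS_def)
  then show "A \<subseteq> T \<and> B \<subseteq> T \<and> r \<in> A \<and> B \<subseteq> R - {r} \<and> min_cut A B X"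
    using CS_D[of A B X] CS_D[of B A X] min_cut_sym[of B A X] by blast
next
  assume C: "(A, B, X) \<in> CS"
  then have "r \<in> A \<or> r \<in> B" using CS_D(1)[OF C] r by blast
  then show "\<exists>A' B'. (A', B', X) \<in> {(A, B, X) \<in> DS. r \<in> A}"
    using C unfolding DS_def by (auto simp: image_iff split_beta; metis fst_conv snd_conv)
qed

text \<open>Uncrossing a cut with all cuts in \<open>CS\<close> confines its side of \<open>r\<close> to \<open>U r\<close>.\<close>

lemma cut_to_G:
  assumes Y: "ecut {r} (R - {r}) Y"
  shows "\<exists>Z. element_cut V (G_edges r z) (G_terms r) {r} (G_sink r) Z \<and>
    sum (\<omega> \<circ> back r z) Z \<le> sum \<omega> Y"
proof -
  define DS where "DS = {(A, B, X) \<in> CS \<union> (\<lambda>(A, B, X). (B, A, X)) ` CS. r \<in> A}"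
  note DS = oriented_family[folded DS_def]
  have "\<forall>(A, B, X) \<in> DS. A \<subseteq> T \<and> B \<subseteq> T \<and> r \<in> A \<and> B \<subseteq> R - {r} \<and> min_cut A B X"
    by (clarify, rule DS(2))
  then obtain S S' where c: "confined r R (sum \<omega> Y) DS S S'"
    using uncross_family[OF DS(1) _ _ Y R_T] r R_T by blast
  then have S: "r \<in> S" "S \<subseteq> S'" "S' - S \<subseteq> V - T" "S' \<inter> (R - {r}) = {}"
    "sum \<omega> (bd E S S') \<le> sum \<omega> Y"
    and SD: "\<And>A B X. (A, B, X) \<in> DS \<Longrightarrow> S \<subseteq> side X A \<and> S' \<subseteq> side' X A"
    unfolding confined_def by auto
  \<comment> \<open>By \<open>min_cut_eq_bd\<close> an edge of a minimum cut joins its side to a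
    vertex outside the outer set, whereas \<open>u\<close> and \<open>v\<close> both lie in the
    side.\<close>
  have not_X0: "Edge {u, v} \<notin> X\<^sub>0" if "u \<in> S" "v \<in> S'" "Vertex v \<notin> X\<^sub>0" for u v
  proof
    assume "Edge {u, v} \<in> X\<^sub>0"
    then obtain A B X where C: "(A, B, X) \<in> CS" "Edge {u, v} \<in> X" by (auto simp: removed_def)
    then obtain A' B' where D: "(A', B', X) \<in> DS" using DS(3) by blast
    have "Vertex v \<notin> X" using CS_D(4)[OF C(1)] that by blast
    then have in_side: "u \<in> side X A'" "v \<in> side X A'" using SD[OF D] that by (auto simp: side'_def)
    have "Edge {u, v} \<in> bd E (side X A') (side' X A')"
      using min_cut_eq_bd[of A' B' X] DS(2)[OF D] C(2) by blast
    then show False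
      using in_side side_subset_side'[of X A'] by (auto simp: Edge_in_bd doubleton_eq_iff)
  qed
  \<comment> \<open>\<open>S\<close> may have pieces not connected to \<open>r\<close>, and these
    need not lie in \<open>U r\<close>. Only what \<open>r\<close> still reaches is kept.\<close>
  define S1 where "S1 = reach V E (bd E S S') r"
  have S1S: "v \<in> S" if "v \<in> S1" for v
    using that unfolding S1_def
    by (induction rule: reach_induct) (use S in \<open>auto simp: gstep_def Edge_in_bd\<close>)
  have S_not_X0: "Vertex v \<notin> X\<^sub>0" if "v \<in> S" for v
  proof
    assume "Vertex v \<in> X\<^sub>0"
    then obtain A B X where C: "(A, B, X) \<in> CS" "Vertex v \<in> X" by (auto simp: removed_def)
    then obtain A' B' where D: "(A', B', X) \<in> DS" using DS(3) by blast
    have "v \<in> side X A'" using SD[OF D] that by auto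
    then show False
      using side_avoids(2)[OF min_cut_elements[of A' B' X], of A' v] DS(2)[OF D] C(2) by blast
  qed
  have S1U: "v \<in> U r" if "v \<in> S1" for v
    using that unfolding S1_def
  proof (induction rule: reach_induct)
    case refl then show ?case by (simp add: U_def)
  next
    case (step u v)
    have uv: "u \<in> S" "v \<in> S" using S1S step(1) reach_step[OF step(1,2)] by (auto simp: S1_def)
    then have "gstep V E X\<^sub>0 u v"
      using step(2) S_not_X0[OF uv(2)] not_X0[OF uv(1)] S(2) by (auto simp: gstep_def)
    then show ?case using step(3) reach_step unfolding U_def by metis
  qed
  \<comment> \<open>The boundary elements that touch \<open>S1\<close> suffice to enclose it. All of
    them are elements of the original instance, so \<open>back\<close> fixes them and their weights
    are unchanged.\<close>
  define Z where "Z = {x \<in> bd E S S'. (\<exists>v u. x = Vertex v \<and> u \<in> S1 \<and> {u, v} \<in> E) \<or>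
     (\<exists>u v. x = Edge {u, v} \<and> u \<in> S1)}"
  have Z_elem: "x \<in> elements V (G_edges r z) (G_terms r)" and Z_back: "back r z x = x"
    if "x \<in> Z" for x
  proof -
    consider v u where "x = Vertex v" "v \<in> S'" "v \<notin> S" "u \<in> S1" "{u, v} \<in> E"
      | u v where "x = Edge {u, v}" "u \<in> S1" "{u, v} \<in> E"
      using \<open>x \<in> Z\<close> by (auto simp: Z_def Edge_in_bd)
    then have "x \<in> elements V (G_edges r z) (G_terms r) \<and> back r z x = x"
    proof cases
      case 1
      have "v \<in> V" "v \<notin> T" using 1 S(3) by auto
      moreover have "v \<in> U r" if "Vertex v \<notin> X\<^sub>0"
      proof -
        have "gstep V E X\<^sub>0 u v"
          using that 1 S1S not_X0[OF _ 1(2) that] \<open>v \<in> V\<close> by (auto simp: gstep_def)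
        then show ?thesis using S1U[OF 1(4)] reach_step unfolding U_def by metis
      qed
      ultimately show ?thesis using 1 by (auto simp: elements_def G_terms_def)
    next
      case 2
      then have "{u, v} \<in> E\<^sub>r r" using S1U by (auto simp: E\<^sub>r_def)
      then show ?thesis using 2 by (auto simp: elements_def G_edges_def)
    qed
    then show "x \<in> elements V (G_edges r z) (G_terms r)" "back r z x = x" by auto
  qed
  have closed: "v \<in> S1" if "v \<in> reach V (G_edges r z) Z r" for v
    using that
  proof (induction rule: reach_induct)
    case refl then show ?case by (simp add: S1_def)
  next
    case (step u v)
    have "u \<in> U r" using step S1U by blast
    then have uv: "{u, v} \<in> E"
      using step(2) bnd_D z_props by (auto simp: gstep_def G_edges_def E\<^sub>r_def doubleton_eq_iff)
    then have "gstep V E (bd E S S') u v"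
      using step(2,3) by (auto simp: gstep_def Z_def)
    then show ?case using step(3) reach_step unfolding S1_def by metis
  qed
  have rT: "{r} \<subseteq> G_terms r" "G_terms r \<subseteq> V"
    using r R_T T_V T_not_X0 by (auto simp: G_terms_def)
  have "element_cut V (G_edges r z) (G_terms r) {r} (G_sink r) Z"
    unfolding element_cut_iff[OF rT] using Z_elem closed S1U by (auto simp: G_sink_def)
  moreover have "sum (\<omega> \<circ> back r z) Z = sum \<omega> Z"
    by (intro sum.cong) (auto simp: Z_back)
  moreover have "sum \<omega> Z \<le> sum \<omega> (bd E S S')"
    by (intro sum_mono_elements bd_elements S(3)) (auto simp: Z_def)
  ultimately show ?thesis using S(5) by (intro exI[of _ Z]) simp
qed

text \<open>\<open>back\<close> may send a boundary vertex and its edge to \<open>z\<close> to the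
  same element, so weights can only drop. Together with \<open>cut_to_G\<close> this compares the
  image with an arbitrary cut of the original instance.\<close>

theorem G_min_cut:
  assumes Y: "weighted_instance.min_cut V (G_edges r z) (G_terms r) (\<omega> \<circ> back r z) {r} (G_sink r) Y"
  shows "min_cut {r} (R - {r}) (back r z ` Y)"
proof -
  interpret G: weighted_instance V "G_edges r z" "G_terms r" "\<omega> \<circ> back r z" by (rule G_instance)
  have Y': "G.ecut {r} (G_sink r) Y" "Y \<subseteq> elements V (G_edges r z) (G_terms r)"
    using Y by (auto simp: G.min_cut_def element_cut_def)
  have le: "sum \<omega> (back r z ` Y) \<le> sum (\<omega> \<circ> back r z) Y"
    using Y'(2) G.finite_elements G.nonneg finite_subset by (intro sum_image_le) auto
  have "sum \<omega> (back r z ` Y) \<le> sum \<omega> Y0" if "ecut {r} (R - {r}) Y0" for Y0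
    using cut_to_G[OF that] Y le unfolding G.min_cut_def by (meson order_trans)
  then show ?thesis using G_cut_back[OF Y'(1)] by (auto simp: min_cut_def)
qed

end

section \<open>Total size of the small graphs\<close>

lemma finite_R: "finite R"
  by (rule finite_subset[OF order_trans[OF R_T T_V] finite_V])

lemma finite_Er: "finite (E\<^sub>r r)"
  using finite_E by (simp add: E\<^sub>r_def)

lemma finite_bnd: "r \<in> R \<Longrightarrow> finite (bnd r)"
proof (rule finite_subset[OF _ finite_V])
  show "bnd r \<subseteq> V" using X0_elements by (auto simp: bnd_def elements_def)
qed

definition "X_ends e \<longleftrightarrow> (\<exists>v\<in>e. Vertex v \<in> X\<^sub>0)"

text \<open>A vertex of \<open>bnd r\<close> is charged to an edge joining it to \<open>U r\<close>.\<close>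

lemma card_bnd:
  assumes "r \<in> R"
  shows "card (bnd r) \<le> card {e \<in> E\<^sub>r r. X_ends e}"
proof -
  have sub: "bnd r \<subseteq> (\<lambda>e. THE v. v \<in> e \<and> Vertex v \<in> X\<^sub>0) ` {e \<in> E\<^sub>r r. X_ends e}"
  proof
    fix v assume "v \<in> bnd r"
    then obtain u where u: "Vertex v \<in> X\<^sub>0" "u \<in> U r" "{u, v} \<in> E" by (auto simp: bnd_def)
    have "(THE v'. v' \<in> {u, v} \<and> Vertex v' \<in> X\<^sub>0) = v"
      using u U_D(2)[OF u(2) assms] by (intro the_equality) auto
    moreover have "{u, v} \<in> {e \<in> E\<^sub>r r. X_ends e}" using u by (auto simp: E\<^sub>r_def X_ends_def)
    ultimately show "v \<in> (\<lambda>e. THE v. v \<in> e \<and> Vertex v \<in> X\<^sub>0) ` {e \<in> E\<^sub>r r. X_ends e}"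
      by (intro rev_image_eqI[of "{u, v}"]) simp_all
  qed
  have fin: "finite {e \<in> E\<^sub>r r. X_ends e}" using finite_Er by simp
  show ?thesis by (rule order_trans[OF card_mono[OF finite_imageI[OF fin] sub] card_image_le[OF fin]])
qed

text \<open>Each end of \<open>e\<close> lies in at most one component. If an end is removed, only
  the other end counts, and the edge is charged at most twice for that terminal: once for itself and
  once for a boundary vertex.\<close>

lemma card_touching:
  assumes "e \<in> E"
  shows "card {r \<in> R. e \<in> E\<^sub>r r} + card {r \<in> R. e \<in> E\<^sub>r r \<and> X_ends e} \<le> 2"
proof -
  obtain u v where e: "e = {u, v}" using edgeE[OF assms] by metis
  let ?C = "\<lambda>v. {r \<in> R. v \<in> U r}"
  have C1: "card (?C v) \<le> 1" for v
    using U_disjoint finite_R by (subst card_le_Suc0_iff_eq[unfolded One_nat_def[symmetric]]) auto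
  have C0: "?C v = {}" if "Vertex v \<in> X\<^sub>0" for v
    using U_D(2) that by blast
  have RE: "{r \<in> R. e \<in> E\<^sub>r r} = ?C u \<union> ?C v" using assms by (auto simp: E\<^sub>r_def e)
  have "card (?C u \<union> ?C v) \<le> card (?C u) + card (?C v)" by (rule card_Un_le)
  show ?thesis
  proof (cases "X_ends e")
    case True
    then have "?C u = {} \<or> ?C v = {}" using C0 by (auto simp: X_ends_def e)
    then have "card (?C u \<union> ?C v) \<le> 1" using C1[of u] C1[of v] by (elim disjE) (simp_all only: Un_empty_left Un_empty_right)
    moreover have "{r \<in> R. e \<in> E\<^sub>r r \<and> X_ends e} = {r \<in> R. e \<in> E\<^sub>r r}" using True by simp
    ultimately show ?thesis using RE by simp
  next
    case False
    then have "card {r \<in> R. e \<in> E\<^sub>r r \<and> X_ends e} = 0" by simp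
    moreover have "card {r \<in> R. e \<in> E\<^sub>r r} \<le> 2"
      unfolding RE using \<open>card (?C u \<union> ?C v) \<le> _\<close> C1[of u] C1[of v] by linarith
    ultimately show ?thesis by linarith
  qed
qed

theorem sum_G_edges: "(\<Sum>r\<in>R. card (E\<^sub>r r) + card (bnd r)) \<le> 2 * card E"
proof -
  \<comment> \<open>Double counting reduces the claim to a bound of 2 per edge.\<close>
  have swap: "(\<Sum>r\<in>R. card {e \<in> E. Q r e}) = (\<Sum>e\<in>E. card {r \<in> R. Q r e})" for Q
  proof -
    have "card {e \<in> E. Q r e} = (\<Sum>e\<in>E. of_bool (Q r e))"
      "card {r \<in> R. Q r e} = (\<Sum>r\<in>R. of_bool (Q r e))" for r e
      using finite_E finite_R by (simp_all add: Int_def)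
    then show ?thesis using sum.swap by simp
  qed
  have "card (bnd r) \<le> card {e \<in> E. e \<in> E\<^sub>r r \<and> X_ends e}" if "r \<in> R" for r
  proof -
    have "{e \<in> E\<^sub>r r. X_ends e} = {e \<in> E. e \<in> E\<^sub>r r \<and> X_ends e}" by (auto simp: E\<^sub>r_def)
    then show ?thesis using card_bnd[OF that] by simp
  qed
  moreover have "card (E\<^sub>r r) = card {e \<in> E. e \<in> E\<^sub>r r}" for r
    by (rule arg_cong[where f = card]) (auto simp: E\<^sub>r_def)
  ultimately have "(\<Sum>r\<in>R. card (E\<^sub>r r) + card (bnd r))
      \<le> (\<Sum>r\<in>R. card {e \<in> E. e \<in> E\<^sub>r r} + card {e \<in> E. e \<in> E\<^sub>r r \<and> X_ends e})"
    by (intro sum_mono add_mono) simp_all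
  also have "\<dots> = (\<Sum>e\<in>E. card {r \<in> R. e \<in> E\<^sub>r r} + card {r \<in> R. e \<in> E\<^sub>r r \<and> X_ends e})"
    unfolding sum.distrib swap ..
  also have "\<dots> \<le> (\<Sum>e\<in>E. 2)" using card_touching by (intro sum_mono)
  finally show ?thesis by (simp add: mult.commute)
qed

end

section \<open>From infinite to finite weights\<close>

text \<open>Infinite weights break the uncrossing argument, as a minimum cut in a bipartition may then be
  arbitrary. They are replaced by a finite weight that exceeds the sum of all finite weights.\<close>

definition cap :: "real \<Rightarrow> ('a \<Rightarrow> ereal) \<Rightarrow> 'a \<Rightarrow> real" where
  "cap b w x = (if w x = \<infinity> then b else real_of_ereal (w x))"

lemma sum_ereal_cong:
  fixes w :: "'a \<Rightarrow> ereal" and \<omega> :: "'a \<Rightarrow> real"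
  shows "(\<And>x. x \<in> X \<Longrightarrow> w x = ereal (\<omega> x)) \<Longrightarrow> sum w X = ereal (sum \<omega> X)"
  by (simp add: sum_ereal)

lemma (in weighted_instance) min_element_cut_iff:
  assumes "\<And>x. x \<in> elements V E T \<Longrightarrow> w x = ereal (\<omega> x)"
  shows "min_element_cut V E T w A B X \<longleftrightarrow> min_cut A B X"
proof -
  have *: "sum w Y = ereal (sum \<omega> Y)" if "ecut A B Y" for Y
    using that assms by (intro sum_ereal_cong) (auto simp: element_cut_def)
  show ?thesis unfolding min_element_cut_def min_cut_def using * by auto
qed

lemma cap_weighted_instance:
  fixes w :: "'v element \<Rightarrow> ereal"
  assumes "ec_instance V E T w" "0 < b"
  shows "weighted_instance V E T (cap b w)"
proof
  fix x assume "x \<in> elements V E T"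
  then have "0 < w x" using assms by (auto simp: ec_instance_def)
  then show "0 < cap b w x" using assms(2) by (cases "w x") (auto simp: cap_def)
qed (use assms in \<open>auto simp: ec_instance_def\<close>)

text \<open>A finite cut stays below \<open>b\<close> after capping, whereas a single infinite
  element already costs \<open>b\<close>. So if a finite cut exists, \<open>X\<close> contains no
  infinite element and both weights agree on it; otherwise every cut is minimum.\<close>

lemma cap_min_cut:
  fixes w :: "'v element \<Rightarrow> ereal"
  assumes inst: "ec_instance V E T w"
    and b: "0 < b" "(\<Sum>x | x \<in> elements V E T \<and> w x \<noteq> \<infinity>. real_of_ereal (w x)) < b"
    and X: "weighted_instance.min_cut V E T (cap b w) A B X"
  shows "min_element_cut V E T w A B X"
proof -
  interpret weighted_instance V E T "cap b w" by (rule cap_weighted_instance[OF inst b(1)])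
  have w: "0 < w x" if "x \<in> elements V E T" for x
    using inst that by (auto simp: ec_instance_def)
  have cut: "ecut A B X" "X \<subseteq> elements V E T" using X by (auto simp: min_cut_def element_cut_def)
  have "sum w X \<le> sum w Y" if Y: "ecut A B Y" for Y
  proof (cases "\<infinity> \<in> w ` Y")
    case True
    have Ye: "Y \<subseteq> elements V E T" using Y by (simp add: element_cut_def)
    obtain y where y: "y \<in> Y" "w y = \<infinity>" using True by force
    have "sum w {y} \<le> sum w Y"
      using y(1) Ye w finite_subset[OF Ye finite_elements] by (intro sum_mono2) (auto intro: less_imp_le)
    then have "sum w Y = \<infinity>" using y(2) by simp
    then show ?thesis by simp
  next
    case False
    have Ye: "Y \<subseteq> elements V E T" using Y by (simp add: element_cut_def)
    have fin: "w x = ereal (cap b w x)" if "x \<in> elements V E T" "w x \<noteq> \<infinity>" for x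
      using w[OF that(1)] that by (cases "w x") (auto simp: cap_def)
    have wY: "w x \<noteq> \<infinity>" if "x \<in> Y" for x using False that by (metis imageI)
    have sY: "sum w Y = ereal (sum (cap b w) Y)"
      using wY Ye by (intro sum_ereal_cong fin) auto
    have "sum (cap b w) Y = (\<Sum>x\<in>Y. real_of_ereal (w x))"
      using wY by (intro sum.cong) (auto simp: cap_def)
    also have "\<dots> \<le> (\<Sum>x | x \<in> elements V E T \<and> w x \<noteq> \<infinity>. real_of_ereal (w x))"
    proof (rule sum_mono2)
      show "Y \<subseteq> {x \<in> elements V E T. w x \<noteq> \<infinity>}" using wY Ye by blast
    qed (simp_all add: finite_elements real_of_ereal_pos less_imp_le[OF w])
    finally have sb: "sum (cap b w) X < b"
      using X Y b(2) unfolding min_cut_def by fastforce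
    have "w x \<noteq> \<infinity>" if "x \<in> X" for x
    proof
      assume "w x = \<infinity>"
      moreover have "cap b w x \<le> sum (cap b w) X"
        using that cut(2) nonneg finite_elements by (intro member_le_sum) (auto intro: finite_subset)
      ultimately show False using sb by (simp add: cap_def)
    qed
    then have "sum w X = ereal (sum (cap b w) X)"
      using cut(2) by (intro sum_ereal_cong fin) auto
    then show ?thesis using sY X Y by (simp add: min_cut_def)
  qed
  then show ?thesis using cut(1) by (simp add: min_element_cut_def)
qed

section \<open>Running programs within a time bound\<close>

primrec writes :: "com \<Rightarrow> name set" where
  "writes Skip = {}"
| "writes (NAssign a i e) = {a}"
| "writes (WAssign a i e) = {a}"
| "writes (Seq c d) = writes c \<union> writes d"
| "writes (If b c d) = writes c \<union> writes d"
| "writes (While b c) = writes c"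

text \<open>Changes are tracked per array name and not per cell: the set of written names bounds
  what a call of the black box can affect.\<close>

definition frame :: "name set \<Rightarrow> state \<Rightarrow> state \<Rightarrow> bool" where
  "frame W s s' \<longleftrightarrow> (\<forall>a. a \<notin> W \<longrightarrow> nats s' a = nats s a \<and> weights s' a = weights s a)"

lemma frame_refl: "frame W s s"
  by (simp add: frame_def)

lemma frame_trans: "frame W s s' \<Longrightarrow> frame W' s' s'' \<Longrightarrow> frame (W \<union> W') s s''"
  by (simp add: frame_def)

lemma frame_nats: "frame W s s' \<Longrightarrow> a \<notin> W \<Longrightarrow> nats s' a = nats s a"
  and frame_weights: "frame W s s' \<Longrightarrow> a \<notin> W \<Longrightarrow> weights s' a = weights s a"
  by (simp_all add: frame_def)

lemma nats_nupd [simp]: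
    "nats (nupd a i x s) = (nats s)(a := (nats s a)(i := x))"
    "weights (nupd a i x s) = weights s"
  and weights_wupd [simp]:
    "weights (wupd a i y s) = (weights s)(a := (weights s a)(i := y))"
    "nats (wupd a i y s) = nats s"
  by (simp_all add: nupd_def wupd_def)

lemma exec_frame: "exec c s t s' \<Longrightarrow> frame (writes c) s s'"
  by (induction rule: exec.induct) (auto simp: frame_def)

lemma finite_writes: "finite (writes c)"
  by (induction c) auto

text \<open>An assignment changes at most one cell and takes at least one step. The lower bound on
  \<open>Tec\<close> rests on this.\<close>

lemma exec_changes:
  "exec c s t s' \<Longrightarrow>
    finite {(a, i). nats s' a i \<noteq> nats s a i} \<and> card {(a, i). nats s' a i \<noteq> nats s a i} \<le> t"
proof (induction rule: exec.induct)
  case (NAssign a i e s)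
  have "{(b, j). nats (nupd a (nval i s) (nval e s) s) b j \<noteq> nats s b j} \<subseteq> {(a, nval i s)}"
    by (auto split: if_splits)
  then show ?case by (auto dest: finite_subset card_mono[rotated])
next
  case (Seq c s t s' d t' s'')
  have "{(a, i). nats s'' a i \<noteq> nats s a i} \<subseteq>
      {(a, i). nats s' a i \<noteq> nats s a i} \<union> {(a, i). nats s'' a i \<noteq> nats s' a i}"
    by auto
  then show ?case using Seq.IH
    by (meson finite_UnI finite_subset card_mono card_Un_le order_trans add_mono)
next
  case (WhileTrue b s c t s' t' s'')
  have "{(a, i). nats s'' a i \<noteq> nats s a i} \<subseteq>
      {(a, i). nats s' a i \<noteq> nats s a i} \<union> {(a, i). nats s'' a i \<noteq> nats s' a i}"
    by auto
  then have "finite {(a, i). nats s'' a i \<noteq> nats s a i} \<and>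
      card {(a, i). nats s'' a i \<noteq> nats s a i} \<le> t + t'"
    using WhileTrue.IH by (meson finite_UnI finite_subset card_mono card_Un_le order_trans add_mono)
  then show ?case by simp
qed simp_all

text \<open>Total correctness with a time budget. Existence of an execution is enough, as the
  specifications of the programs ask for no more.\<close>

definition run :: "com \<Rightarrow> state \<Rightarrow> nat \<Rightarrow> (state \<Rightarrow> bool) \<Rightarrow> bool" where
  "run c s \<tau> Q \<longleftrightarrow> (\<exists>t s'. exec c s t s' \<and> t \<le> \<tau> \<and> Q s')"

lemma run_mono: "run c s \<tau> Q \<Longrightarrow> \<tau> \<le> \<tau>' \<Longrightarrow> (\<And>s'. Q s' \<Longrightarrow> Q' s') \<Longrightarrow> run c s \<tau>' Q'"
  unfolding run_def by (meson order_trans)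

lemma run_frame: "run c s \<tau> Q \<Longrightarrow> run c s \<tau> (\<lambda>s'. Q s' \<and> frame (writes c) s s')"
  unfolding run_def using exec_frame by blast

text \<open>The frame of the first program is handed to the second, so postconditions only need to
  mention what was changed.\<close>

lemma run_Seq:
  assumes "run c s \<tau> Q" "\<And>s'. Q s' \<Longrightarrow> frame (writes c) s s' \<Longrightarrow> run d s' \<tau>' Q'"
  shows "run (Seq c d) s (\<tau> + \<tau>') Q'"
proof -
  obtain t s' where c: "exec c s t s'" "t \<le> \<tau>" "Q s'" using assms(1) by (auto simp: run_def)
  then obtain t' s'' where "exec d s' t' s''" "t' \<le> \<tau>'" "Q' s''"
    using assms(2)[OF c(3) exec_frame[OF c(1)]] by (auto simp: run_def)
  then show ?thesis using c unfolding run_def by (meson exec.Seq add_mono)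
qed

lemma run_If_True: "bval b s \<Longrightarrow> run c s \<tau> Q \<Longrightarrow> 1 + bcost b + \<tau> \<le> \<tau>' \<Longrightarrow> run (If b c d) s \<tau>' Q"
  unfolding run_def using exec.IfTrue by (meson add_le_mono order_refl order_trans)

lemma run_If_False: "\<not> bval b s \<Longrightarrow> run d s \<tau> Q \<Longrightarrow> 1 + bcost b + \<tau> \<le> \<tau>' \<Longrightarrow> run (If b c d) s \<tau>' Q"
  unfolding run_def using exec.IfFalse by (meson add_le_mono order_refl order_trans)

text \<open>The potential \<open>\<Phi>\<close> pays for the remaining iterations.\<close>

lemma run_While:
  fixes \<Phi> :: "state \<Rightarrow> nat"
  assumes init: "I s"
    and step: "\<And>s'. I s' \<Longrightarrow> frame (writes c) s s' \<Longrightarrow> bval b s' \<Longrightarrow>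
      \<exists>\<tau>. run c s' \<tau> (\<lambda>s''. I s'' \<and> 1 + bcost b + \<tau> + \<Phi> s'' \<le> \<Phi> s')"
  shows "run (While b c) s (\<Phi> s + 1 + bcost b) (\<lambda>s'. I s' \<and> \<not> bval b s' \<and> frame (writes c) s s')"
proof -
  have "\<exists>t s''. exec (While b c) s' t s'' \<and> t \<le> \<Phi> s' + 1 + bcost b \<and>
      I s'' \<and> \<not> bval b s'' \<and> frame (writes c) s s''" if "I s'" "frame (writes c) s s'" for s'
    using that
  proof (induction "\<Phi> s'" arbitrary: s' rule: less_induct)
    case less
    show ?case
    proof (cases "bval b s'")
      case True
      obtain t s'' \<tau> where c: "exec c s' t s''" "t \<le> \<tau>" "I s''" "1 + bcost b + \<tau> + \<Phi> s'' \<le> \<Phi> s'"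
        using step[OF less.prems True] unfolding run_def by blast
      have "frame (writes c) s s''" using frame_trans[OF less.prems(2) exec_frame[OF c(1)]] by simp
      moreover have "\<Phi> s'' < \<Phi> s'" using c(4) by simp
      ultimately obtain t' s3 where "exec (While b c) s'' t' s3" "t' \<le> \<Phi> s'' + 1 + bcost b"
        "I s3" "\<not> bval b s3" "frame (writes c) s s3"
        using less.hyps[of s''] c(3) by blast
      then show ?thesis
        using exec.WhileTrue[OF True c(1), of t' s3] c(2,4)
        by (intro exI[of _ "1 + bcost b + t + t'"] exI[of _ s3]) simp
    next
      case False
      then show ?thesis using exec.WhileFalse[OF False, of c] less.prems
        by (intro exI[of _ "1 + bcost b"] exI[of _ s']) simp
    qed
  qed
  then show ?thesis using init frame_refl unfolding run_def by blast
qed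

primrec loopfree :: "com \<Rightarrow> bool" where
  "loopfree Skip \<longleftrightarrow> True"
| "loopfree (NAssign a i e) \<longleftrightarrow> True"
| "loopfree (WAssign a i e) \<longleftrightarrow> True"
| "loopfree (Seq c d) \<longleftrightarrow> loopfree c \<and> loopfree d"
| "loopfree (If b c d) \<longleftrightarrow> loopfree c \<and> loopfree d"
| "loopfree (While b c) \<longleftrightarrow> False"

primrec seval :: "com \<Rightarrow> state \<Rightarrow> state" where
  "seval Skip s = s"
| "seval (NAssign a i e) s = nupd a (nval i s) (nval e s) s"
| "seval (WAssign a i e) s = wupd a (nval i s) (wval e s) s"
| "seval (Seq c d) s = seval d (seval c s)"
| "seval (If b c d) s = (if bval b s then seval c s else seval d s)"
| "seval (While b c) s = s"

text \<open>Adding the costs of both branches bounds either of them and keeps the value independent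
  of the state.\<close>

primrec scost :: "com \<Rightarrow> nat" where
  "scost Skip = 1"
| "scost (NAssign a i e) = 1 + ncost i + ncost e"
| "scost (WAssign a i e) = 1 + ncost i + wcost e"
| "scost (Seq c d) = scost c + scost d"
| "scost (If b c d) = 1 + bcost b + (scost c + scost d)"
| "scost (While b c) = 0"

text \<open>Straight-line code is executed symbolically: the simplifier evaluates
  \<open>seval\<close> and \<open>scost\<close>.\<close>

lemma run_loopfree: "loopfree c \<Longrightarrow> Q (seval c s) \<Longrightarrow> scost c \<le> \<tau> \<Longrightarrow> run c s \<tau> Q"
proof -
  have "loopfree c \<Longrightarrow> \<exists>t \<le> scost c. exec c s t (seval c s)"
  proof (induction c arbitrary: s)
    case (Seq c d)
    obtain t where "t \<le> scost c" "exec c s t (seval c s)" using Seq by auto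
    moreover obtain t' where "t' \<le> scost d" "exec d (seval c s) t' (seval d (seval c s))"
      using Seq by auto
    ultimately show ?case using exec.Seq by (intro exI[of _ "t + t'"]) simp
  next
    case (If b c d)
    obtain t where t: "t \<le> scost c" "exec c s t (seval c s)" using If by auto
    obtain t' where t': "t' \<le> scost d" "exec d s t' (seval d s)" using If by auto
    show ?case
    proof (cases "bval b s")
      case True
      then show ?thesis using t exec.IfTrue[OF True t(2)] by (intro exI[of _ "1 + bcost b + t"]) simp
    next
      case False
      then show ?thesis using t' exec.IfFalse[OF False t'(2)] by (intro exI[of _ "1 + bcost b + t'"]) simp
    qed
  qed (use exec.Skip exec.NAssign exec.WAssign in \<open>fastforce+\<close>)
  then show "loopfree c \<Longrightarrow> Q (seval c s) \<Longrightarrow> scost c \<le> \<tau> \<Longrightarrow> run c s \<tau> Q"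
    unfolding run_def by (meson order_trans)
qed

lemma run_prefix:
  "run d (seval c s) \<tau>' Q \<Longrightarrow> loopfree c \<Longrightarrow> scost c + \<tau>' \<le> \<tau> \<Longrightarrow> run (Seq c d) s \<tau> Q"
  by (rule run_mono[OF run_Seq[OF run_loopfree[where Q = "\<lambda>s'. s' = seval c s"]]]) auto

abbreviation sc :: "name \<Rightarrow> nexp" where
  "sc a \<equiv> NCell a (NConst 0)"

definition For :: "name \<Rightarrow> name \<Rightarrow> com \<Rightarrow> com" where
  "For i n c = Seq (NAssign i (NConst 0) (NConst 0))
     (While (NLess (sc i) (sc n)) (Seq c (NAssign i (NConst 0) (NAdd (sc i) (NConst 1)))))"

lemma writes_For [simp]: "writes (For i n c) = insert i (writes c)"
  by (auto simp: For_def)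

text \<open>Each iteration pays 6 steps for the test and 6 for the increment. The 9 remaining steps
  are 3 for the initialisation and 6 for the last test. The invariant after the body refers to the
  state with the counter already advanced.\<close>

lemma run_For:
  assumes names: "i \<noteq> n" "n \<notin> writes c" "i \<notin> writes c" and N: "nats s n 0 = N"
    and init: "Inv 0 (nupd i 0 0 s)"
    and step: "\<And>k s'. k < N \<Longrightarrow> nats s' i 0 = k \<Longrightarrow> frame (insert i (writes c)) s s' \<Longrightarrow> Inv k s' \<Longrightarrow>
      run c s' (\<tau> k) (\<lambda>s''. Inv (Suc k) (nupd i 0 (Suc k) s''))"
  shows "run (For i n c) s ((\<Sum>k<N. \<tau> k + 12) + 9) (\<lambda>s'. Inv N s' \<and> frame (insert i (writes c)) s s')"
proof -
  let ?s0 = "nupd i 0 0 s"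
  let ?inc = "NAssign i (NConst 0) (NAdd (sc i) (NConst 1))"
  let ?b = "NLess (sc i) (sc n)"
  let ?I = "\<lambda>s'. Inv (nats s' i 0) s' \<and> nats s' i 0 \<le> N \<and> nats s' n 0 = N \<and>
    frame (insert i (writes c)) s s'"
  define \<Phi> :: "state \<Rightarrow> nat" where "\<Phi> s' = (\<Sum>k=nats s' i 0..<N. \<tau> k + 12)" for s'
  have \<Phi>: "\<Phi> s' = \<tau> (nats s' i 0) + 12 + (\<Sum>k=Suc (nats s' i 0)..<N. \<tau> k + 12)"
    if "nats s' i 0 < N" for s'
    unfolding \<Phi>_def using that by (simp add: sum.atLeast_Suc_lessThan)
  have "run (While ?b (Seq c ?inc)) ?s0 (\<Phi> ?s0 + 1 + bcost ?b)
     (\<lambda>s'. ?I s' \<and> \<not> bval ?b s' \<and> frame (writes (Seq c ?inc)) ?s0 s')"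
  proof (rule run_While)
    show "?I ?s0" using init N names by (auto simp: frame_def)
  next
    fix s' assume I: "?I s'" and fr: "frame (writes (Seq c ?inc)) ?s0 s'" and b: "bval ?b s'"
    let ?k = "nats s' i 0"
    have k: "?k < N" using b I by simp
    have r: "run c s' (\<tau> ?k) (\<lambda>s''. Inv (Suc ?k) (nupd i 0 (Suc ?k) s''))"
      using step[OF k refl] I by blast
    have "run (Seq c ?inc) s' (\<tau> ?k + 6)
        (\<lambda>s''. ?I s'' \<and> 1 + bcost ?b + (\<tau> ?k + 6) + \<Phi> s'' \<le> \<Phi> s')"
    proof (rule run_Seq[OF r], rule run_loopfree)
      fix s'' assume i: "Inv (Suc ?k) (nupd i 0 (Suc ?k) s'')" and f: "frame (writes c) s' s''"
      have eq: "nats s'' i = nats s' i" "nats s'' n = nats s' n" using f names by (simp_all add: frame_def)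
      then have ev: "seval ?inc s'' = nupd i 0 (Suc ?k) s''" by simp
      have "frame (insert i (writes c)) s (nupd i 0 (Suc ?k) s'')"
        using I f by (auto simp: frame_def)
      moreover have "\<Phi> s' = \<tau> ?k + 12 + \<Phi> (nupd i 0 (Suc ?k) s'')" using \<Phi>[OF k] by (simp add: \<Phi>_def)
      ultimately show "?I (seval ?inc s'') \<and>
          1 + bcost ?b + (\<tau> ?k + 6) + \<Phi> (seval ?inc s'') \<le> \<Phi> s'"
        unfolding ev using i k I eq names by simp
    qed simp_all
    then show "\<exists>\<tau>. run (Seq c ?inc) s' \<tau> (\<lambda>s''. ?I s'' \<and> 1 + bcost ?b + \<tau> + \<Phi> s'' \<le> \<Phi> s')" by blast
  qed
  moreover have "\<Phi> ?s0 = (\<Sum>k<N. \<tau> k + 12)" by (simp add: \<Phi>_def atLeast0LessThan)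
  ultimately have w: "run (While ?b (Seq c ?inc)) ?s0 ((\<Sum>k<N. \<tau> k + 12) + 6)
      (\<lambda>s'. Inv N s' \<and> frame (insert i (writes c)) s s')"
    by (elim run_mono) auto
  have a: "run (NAssign i (NConst 0) (NConst 0)) s 3 (\<lambda>s'. s' = ?s0)" by (rule run_loopfree) simp_all
  have "run (For i n c) s (3 + ((\<Sum>k<N. \<tau> k + 12) + 6)) (\<lambda>s'. Inv N s' \<and> frame (insert i (writes c)) s s')"
    unfolding For_def using w by (intro run_Seq[OF a]) simp
  then show ?thesis by (rule run_mono) simp_all
qed

lemma run_For_loopfree:
  assumes "i \<noteq> n" "n \<notin> writes c" "i \<notin> writes c" "nats s n 0 = N"
    and "loopfree c" "scost c + 12 \<le> K"
    and "Inv 0 (nupd i 0 0 s)"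
    and "\<And>k s'. k < N \<Longrightarrow> nats s' i 0 = k \<Longrightarrow> frame (insert i (writes c)) s s' \<Longrightarrow> Inv k s' \<Longrightarrow>
      Inv (Suc k) (nupd i 0 (Suc k) (seval c s'))"
  shows "run (For i n c) s (K * N + 9) (\<lambda>s'. Inv N s' \<and> frame (insert i (writes c)) s s')"
proof -
  have "run (For i n c) s ((\<Sum>k<N. scost c + 12) + 9) (\<lambda>s'. Inv N s' \<and> frame (insert i (writes c)) s s')"
    using assms by (intro run_For run_loopfree) auto
  then show ?thesis using assms(6) by (elim run_mono) (auto simp: mult.commute)
qed

text \<open>The output of \<open>P\<close> may initially hold the junk value 2 in every cell.\<close>

lemma Tec_ge:
  assumes P: "computes_min_element_cuts P Tec"
    and inst: "ec_instance {..<n} (set es) T w" "distinct es"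
  shows "n + length es \<le> Tec (length es) n"
proof -
  have "\<exists>u v. es ! j = {u, v}" if "j < length es" for j
    using inst(1) nth_mem[OF that] unfolding ec_instance_def by blast
  then obtain tl hd where th: "\<And>j. j < length es \<Longrightarrow> es ! j = {tl j, hd j}" by metis
  \<comment> \<open>Both terminal sets of the call are empty, which every instance admits. Since a
    correct output consists of zeros and ones, each prefilled cell has to change.\<close>
  define s where "s = \<lparr>
    nats = (\<lambda>_ _. 0)(''n'' := \<lambda>_. n, ''m'' := \<lambda>_. length es, ''tail'' := tl, ''head'' := hd,
      ''terminal'' := (\<lambda>v. of_bool (v \<in> T)), ''cut_vertex'' := \<lambda>_. 2, ''cut_edge'' := \<lambda>_. 2),
    weights = (\<lambda>_ _. 0)(''edge_weight'' := (\<lambda>j. w (Edge (es ! j))), ''vertex_weight'' := (\<lambda>v. w (Vertex v)))\<rparr>"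
  have "stores_instance s n es T w" "stores_set s ''A'' n {}" "stores_set s ''B'' n {}"
    using th by (simp_all add: s_def stores_instance_def stores_set_def)
  then obtain t s' X where ex: "exec P s t s'" "t \<le> Tec (length es) n" "stores_cut s' n es X"
    using P inst unfolding computes_min_element_cuts_def by (metis empty_subsetI inf_bot_left)
  let ?D = "{(a, i). nats s' a i \<noteq> nats s a i}"
  have "Pair ''cut_vertex'' ` {..<n} \<union> Pair ''cut_edge'' ` {..<length es} \<subseteq> ?D"
    using ex(3) by (auto simp: s_def stores_cut_def of_bool_def split: if_splits)
  moreover have "finite ?D" "card ?D \<le> t" using exec_changes[OF ex(1)] by auto
  ultimately have "card (Pair ''cut_vertex'' ` {..<n} \<union> Pair ''cut_edge'' ` {..<length es}) \<le> t"
    by (meson card_mono order_trans)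
  also have "card (Pair ''cut_vertex'' ` {..<n} \<union> Pair ''cut_edge'' ` {..<length es}) = n + length es"
    by (subst card_Un_disjoint) (auto simp: card_image inj_on_def)
  finally show ?thesis using ex(2) by simp
qed

text \<open>Longer than every name that \<open>P\<close> writes and than the names of the input and the output.\<close>

definition fresh :: "com \<Rightarrow> nat \<Rightarrow> name" where
  "fresh P i = replicate (20 + (\<Sum>a\<in>writes P. length a) + i) CHR ''x''"

lemma fresh_eq_iff [simp]: "fresh P i = fresh P j \<longleftrightarrow> i = j"
  by (auto simp: fresh_def dest: arg_cong[where f = length])

lemma fresh_notin_writes [simp]: "fresh P i \<notin> writes P"
proof
  assume "fresh P i \<in> writes P"
  then have "length (fresh P i) \<le> (\<Sum>a\<in>writes P. length a)"
    by (intro member_le_sum finite_writes) auto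
  then show False by (simp add: fresh_def)
qed

lemma fresh_neq: "length a < 20 \<Longrightarrow> fresh P i \<noteq> a \<and> a \<noteq> fresh P i"
  by (auto simp: fresh_def)

lemmas fresh_neqs [simp] =
  fresh_neq[of "''n''", simplified] fresh_neq[of "''m''", simplified]
  fresh_neq[of "''tail''", simplified] fresh_neq[of "''head''", simplified]
  fresh_neq[of "''edge_weight''", simplified] fresh_neq[of "''vertex_weight''", simplified]
  fresh_neq[of "''terminal''", simplified] fresh_neq[of "''A''", simplified] fresh_neq[of "''B''", simplified]
  fresh_neq[of "''R''", simplified] fresh_neq[of "''cut_vertex''", simplified]
  fresh_neq[of "''cut_edge''", simplified] fresh_neq[of "''cuts''", simplified]
  fresh_neq[of "''offset''", simplified]

section \<open>The rounds\<close>

abbreviation nset :: "name \<Rightarrow> nexp \<Rightarrow> com" where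
  "nset a e \<equiv> NAssign a (NConst 0) e"

abbreviation When :: "bexp \<Rightarrow> com \<Rightarrow> com" where
  "When b c \<equiv> If b c Skip"

abbreviation cell :: "name \<Rightarrow> name \<Rightarrow> nexp" where
  "cell a i \<equiv> NCell a (sc i)"

abbreviation wcell :: "name \<Rightarrow> name \<Rightarrow> wexp" where
  "wcell a i \<equiv> WCell a (sc i)"

abbreviation is0 :: "nexp \<Rightarrow> bexp" where
  "is0 e \<equiv> NEq e (NConst 0)"

abbreviation is1 :: "nexp \<Rightarrow> bexp" where
  "is1 e \<equiv> NEq e (NConst 1)"

notation Seq (infixr ";;" 60)

definition big :: "nat \<Rightarrow> nat set list \<Rightarrow> nat set \<Rightarrow> (nat element \<Rightarrow> ereal) \<Rightarrow> real" where
  "big n es T w = 1 +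
    (\<Sum>x | x \<in> elements {..<n} (set es) T \<and> w x \<noteq> \<infinity>. real_of_ereal (w x))"

abbreviation capped :: "nat \<Rightarrow> nat set list \<Rightarrow> nat set \<Rightarrow> (nat element \<Rightarrow> ereal) \<Rightarrow> nat element \<Rightarrow> real" where
  "capped n es T w \<equiv> cap (big n es T w) w"

text \<open>Follows the order in which the program accumulates the sum: vertices first, then
  positions of the edge list.\<close>

lemma big_split:
  assumes "distinct es"
  shows "big n es T w = 1 +
    (\<Sum>v<n. if v \<notin> T \<and> w (Vertex v) \<noteq> \<infinity> then real_of_ereal (w (Vertex v)) else 0) +
    (\<Sum>j<length es. if w (Edge (es ! j)) \<noteq> \<infinity> then real_of_ereal (w (Edge (es ! j))) else 0)"
proof -
  let ?f = "\<lambda>x. if w x \<noteq> \<infinity> then real_of_ereal (w x) else 0"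
  have "(\<Sum>x | x \<in> elements {..<n} (set es) T \<and> w x \<noteq> \<infinity>. real_of_ereal (w x))
      = sum ?f (elements {..<n} (set es) T)"
    by (subst sum.inter_filter[symmetric]) (auto simp: elements_def intro!: sum.cong)
  also have "\<dots> = sum ?f (Vertex ` ({..<n} - T)) + sum ?f (Edge ` set es)"
    unfolding elements_def by (intro sum.union_disjoint) auto
  also have "sum ?f (Vertex ` ({..<n} - T)) = (\<Sum>v\<in>{..<n} - T. ?f (Vertex v))"
    by (subst sum.reindex) (auto simp: inj_on_def)
  also have "\<dots> = (\<Sum>v<n. if v \<notin> T \<and> w (Vertex v) \<noteq> \<infinity> then real_of_ereal (w (Vertex v)) else 0)"
    by (intro sum.mono_neutral_cong_left) auto
  also have "sum ?f (Edge ` set es) = (\<Sum>e\<in>set es. ?f (Edge e))"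
    by (subst sum.reindex) (auto simp: inj_on_def)
  also have "\<dots> = (\<Sum>j<length es. ?f (Edge (es ! j)))"
    by (rule sum.reindex_bij_betw[OF bij_betw_nth[OF assms refl refl], symmetric])
  finally show ?thesis by (simp add: big_def)
qed

section \<open>Saving the input, capping the weights and numbering the terminals\<close>

locale blackbox =
  fixes P :: com and Tec :: "nat \<Rightarrow> nat \<Rightarrow> nat"
  assumes P: "computes_min_element_cuts P Tec"
begin

abbreviation "N \<equiv> fresh P 0"
abbreviation "M \<equiv> fresh P 38"
abbreviation "TL \<equiv> fresh P 2"
abbreviation "HD \<equiv> fresh P 3"
abbreviation "EW \<equiv> fresh P 4"
abbreviation "TM \<equiv> fresh P 5"
abbreviation "VW \<equiv> fresh P 6"
abbreviation "RR \<equiv> fresh P 7"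
abbreviation "XV \<equiv> fresh P 8"
abbreviation "XE \<equiv> fresh P 9"
abbreviation "FIRST \<equiv> fresh P 10"
abbreviation "STAMP \<equiv> fresh P 11"
abbreviation "BIG \<equiv> fresh P 12"
abbreviation "IDX \<equiv> fresh P 13"
abbreviation "HALF \<equiv> fresh P 14"
abbreviation "PAR \<equiv> fresh P 15"
abbreviation "KK \<equiv> fresh P 16"
abbreviation "CNT \<equiv> fresh P 17"
abbreviation "I \<equiv> fresh P 18"

text \<open>Besides saving the input, this clears arrays on which later programs rely, since memory
  may hold anything. The test for non-terminals is essential: the weight cell of a terminal is
  unspecified and must not enter the sum.\<close>

definition save_vertex :: com where
  "save_vertex =
    NAssign TM (sc I) (cell ''terminal'' I) ;; NAssign RR (sc I) (cell ''R'' I) ;;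
    WAssign VW (sc I) (wcell ''vertex_weight'' I) ;;
    NAssign XV (sc I) (NConst 0) ;; NAssign FIRST (sc I) (NConst 0) ;;
    When (BAnd (is0 (cell TM I)) (BNot (WEq (wcell VW I) WInf)))
      (WAssign BIG (NConst 0) (WAdd (WCell BIG (NConst 0)) (wcell VW I)))"

definition save_edge :: com where
  "save_edge =
    NAssign TL (sc I) (cell ''tail'' I) ;; NAssign HD (sc I) (cell ''head'' I) ;;
    WAssign EW (sc I) (wcell ''edge_weight'' I) ;;
    NAssign XE (sc I) (NConst 0) ;; NAssign STAMP (sc I) (NConst 0) ;;
    When (BNot (WEq (wcell EW I) WInf))
      (WAssign BIG (NConst 0) (WAdd (WCell BIG (NConst 0)) (wcell EW I)))"

definition save :: com where
  "save = (nset N (sc ''n'') ;; nset M (sc ''m'') ;; WAssign BIG (NConst 0) WOne) ;;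
    For I N save_vertex ;; For I M save_edge"

text \<open>Capping takes a second pass because \<open>BIG\<close> is complete only after all finite
  weights have been added.\<close>

definition cap_vertex :: com where
  "cap_vertex = When (WEq (wcell VW I) WInf) (WAssign VW (sc I) (WCell BIG (NConst 0)))"

definition cap_edge :: com where
  "cap_edge = When (WEq (wcell EW I) WInf) (WAssign EW (sc I) (WCell BIG (NConst 0)))"

definition cap_weights :: com where
  "cap_weights = For I N cap_vertex ;; For I M cap_edge"

text \<open>The tables of halves and parities are filled in the same loop, by
  \<open>Suc x div 2 = x div 2 + x mod 2\<close> and
  \<open>Suc x mod 2 = 1 - x mod 2\<close>.\<close>

definition number_vertex :: com where
  "number_vertex =
    When (is1 (cell RR I)) (NAssign IDX (sc I) (sc CNT) ;; nset CNT (NAdd (sc CNT) (NConst 1))) ;;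
    NAssign HALF (NAdd (sc I) (NConst 1)) (NAdd (cell HALF I) (cell PAR I)) ;;
    NAssign PAR (NAdd (sc I) (NConst 1)) (NSub (NConst 1) (cell PAR I))"

text \<open>For nonempty \<open>R\<close>, \<open>KK\<close> is the largest number given to a
  terminal. Halving it along with the numbers tells when all bits are used up.\<close>

definition index :: com where
  "index = (nset CNT (NConst 0) ;; NAssign HALF (NConst 0) (NConst 0) ;; NAssign PAR (NConst 0) (NConst 0)) ;;
    For I N number_vertex ;; nset KK (NSub (sc CNT) (NConst 1))"

lemma writes_save_vertex [simp]: "writes save_vertex = {TM, RR, VW, XV, FIRST, BIG}"
  by (auto simp: save_vertex_def)

lemma writes_save_edge [simp]: "writes save_edge = {TL, HD, EW, XE, STAMP, BIG}"
  by (auto simp: save_edge_def)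

lemma writes_cap_vertex [simp]: "writes cap_vertex = {VW}"
  by (auto simp: cap_vertex_def)

lemma writes_cap_edge [simp]: "writes cap_edge = {EW}"
  by (auto simp: cap_edge_def)

lemma writes_number_vertex [simp]: "writes number_vertex = {IDX, CNT, HALF, PAR}"
  by (auto simp: number_vertex_def)

lemma writes_index [simp]: "writes index = {CNT, HALF, PAR, I, IDX, KK}"
  by (auto simp: index_def)

end

text \<open>The list \<open>es\<close> records edges as sets. The orientation in which the arrays
  happen to store them is fixed separately by \<open>tl\<close> and \<open>hd\<close>.\<close>

locale input = blackbox +
  fixes n :: nat and es :: "nat set list" and T :: "nat set" and w :: "nat element \<Rightarrow> ereal"
    and R :: "nat set" and tl hd :: "nat \<Rightarrow> nat"
  assumes inst: "ec_instance {..<n} (set es) T w" and distinct_es: "distinct es"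
    and T_nonempty: "T \<noteq> {}" and R_sub: "R \<subseteq> T"
    and es_nth: "j < length es \<Longrightarrow> es ! j = {tl j, hd j}"
begin

abbreviation "m \<equiv> length es"
abbreviation "\<omega> \<equiv> capped n es T w"

lemma big_pos: "0 < big n es T w"
  unfolding big_def using inst
  by (intro add_pos_nonneg sum_nonneg real_of_ereal_pos) (auto simp: ec_instance_def less_imp_le)

lemma weighted: "weighted_instance {..<n} (set es) T \<omega>"
  by (rule cap_weighted_instance[OF inst big_pos])

sublocale weighted_instance "{..<n}" "set es" T \<omega>
  by (rule weighted)

lemma es_V: "j < m \<Longrightarrow> tl j < n \<and> hd j < n \<and> tl j \<noteq> hd j"
  using edge_V[of "tl j" "hd j"] es_nth[of j] nth_mem[of j es] by auto

lemma R_n: "r \<in> R \<Longrightarrow> r < n" and T_n: "r \<in> T \<Longrightarrow> r < n"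
  using R_sub T_V by auto

text \<open>The part of memory that is settled once the weights are capped, whatever
  \<open>P\<close> does to its own arrays.\<close>

definition saved :: "state \<Rightarrow> bool" where
  "saved s \<longleftrightarrow> nats s N 0 = n \<and> nats s M 0 = m \<and>
    (\<forall>j<m. nats s TL j = tl j \<and> nats s HD j = hd j \<and> weights s EW j = ereal (\<omega> (Edge (es ! j)))) \<and>
    (\<forall>v<n. nats s TM v = of_bool (v \<in> T) \<and> nats s RR v = of_bool (v \<in> R) \<and>
      (v \<notin> T \<longrightarrow> weights s VW v = ereal (\<omega> (Vertex v))))"

lemma saved_frame:
  assumes "saved s" "frame W s s'" "N \<notin> W" "M \<notin> W" "TL \<notin> W" "HD \<notin> W" "EW \<notin> W" "TM \<notin> W" "VW \<notin> W" "RR \<notin> W"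
  shows "saved s'"
  using assms by (simp add: saved_def frame_def)

definition saved0 :: "state \<Rightarrow> bool" where
  "saved0 s \<longleftrightarrow> nats s N 0 = n \<and> nats s M 0 = m \<and> weights s BIG 0 = ereal (big n es T w) \<and>
    (\<forall>j<m. nats s TL j = tl j \<and> nats s HD j = hd j \<and> weights s EW j = w (Edge (es ! j))) \<and>
    (\<forall>v<n. nats s TM v = of_bool (v \<in> T) \<and> nats s RR v = of_bool (v \<in> R) \<and>
      (v \<notin> T \<longrightarrow> weights s VW v = w (Vertex v)))"

definition cleared :: "state \<Rightarrow> bool" where
  "cleared s \<longleftrightarrow> (\<forall>v<n. nats s XV v = 0 \<and> nats s FIRST v = 0) \<and> (\<forall>j<m. nats s XE j = 0 \<and> nats s STAMP j = 0)"

lemma w_ereal: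
  assumes "x \<in> elements {..<n} (set es) T" "w x \<noteq> \<infinity>"
  shows "w x = ereal (real_of_ereal (w x))"
  using inst assms by (cases "w x") (auto simp: ec_instance_def)

definition finite_weight :: "nat element \<Rightarrow> real" where
  "finite_weight x = (if w x \<noteq> \<infinity> then real_of_ereal (w x) else 0)"

lemma run_save_vertices:
  assumes s: "nats s N 0 = n" "weights s BIG 0 = 1" "stores_instance s n es T w" "stores_set s ''R'' n R"
  defines "Inv \<equiv> \<lambda>k s'. weights s' BIG 0 = ereal (1 + (\<Sum>v<k. if v \<notin> T then finite_weight (Vertex v) else 0)) \<and>
       (\<forall>v<k. nats s' TM v = of_bool (v \<in> T) \<and> nats s' RR v = of_bool (v \<in> R) \<and>
         (v \<notin> T \<longrightarrow> weights s' VW v = w (Vertex v)) \<and> nats s' XV v = 0 \<and> nats s' FIRST v = 0)"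
  shows "run (For I N save_vertex) s (200 * n + 9) (\<lambda>s'. Inv n s' \<and> frame (insert I (writes save_vertex)) s s')"
proof (rule run_For_loopfree)
  fix k s'
  assume k: "k < n" "nats s' I 0 = k" and fr: "frame (insert I (writes save_vertex)) s s'"
    and inv: "Inv k s'"
  have eqs: "nats s' ''terminal'' k = of_bool (k \<in> T)" "nats s' ''R'' k = of_bool (k \<in> R)"
    "k \<notin> T \<Longrightarrow> weights s' ''vertex_weight'' k = w (Vertex k)"
    using frame_nats[OF fr] frame_weights[OF fr] s k by (simp_all add: stores_instance_def stores_set_def)
  have "w (Vertex k) = ereal (finite_weight (Vertex k))" if "k \<notin> T" "w (Vertex k) \<noteq> \<infinity>"
    using w_ereal[of "Vertex k"] that k by (simp add: elements_def finite_weight_def)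
  moreover have "finite_weight (Vertex k) = 0" if "w (Vertex k) = \<infinity>"
    using that by (simp add: finite_weight_def)
  ultimately show "Inv (Suc k) (nupd I 0 (Suc k) (seval save_vertex s'))"
    using inv eqs k by (auto simp: save_vertex_def less_Suc_eq Inv_def)
qed (use s in \<open>simp_all add: save_vertex_def Inv_def\<close>)

lemma run_save_edges:
  assumes s: "nats s M 0 = m" "weights s BIG 0 = ereal c" "stores_instance s n es T w"
    and th: "\<And>j. j < m \<Longrightarrow> nats s ''tail'' j = tl j \<and> nats s ''head'' j = hd j"
  defines "Inv \<equiv> \<lambda>k s'. weights s' BIG 0 = ereal (c + (\<Sum>j<k. finite_weight (Edge (es ! j)))) \<and>
       (\<forall>j<k. nats s' TL j = tl j \<and> nats s' HD j = hd j \<and>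
         weights s' EW j = w (Edge (es ! j)) \<and> nats s' XE j = 0 \<and> nats s' STAMP j = 0)"
  shows "run (For I M save_edge) s (200 * m + 9) (\<lambda>s'. Inv m s' \<and> frame (insert I (writes save_edge)) s s')"
proof (rule run_For_loopfree)
  fix k s'
  assume k: "k < m" "nats s' I 0 = k" and fr: "frame (insert I (writes save_edge)) s s'"
    and inv: "Inv k s'"
  have eqs: "nats s' ''tail'' k = tl k" "nats s' ''head'' k = hd k"
    "weights s' ''edge_weight'' k = w (Edge (es ! k))"
    using frame_nats[OF fr] frame_weights[OF fr] s k th by (simp_all add: stores_instance_def)
  have "w (Edge (es ! k)) = ereal (finite_weight (Edge (es ! k)))" if "w (Edge (es ! k)) \<noteq> \<infinity>"
    using w_ereal[of "Edge (es ! k)"] that k by (simp add: elements_def finite_weight_def)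
  moreover have "finite_weight (Edge (es ! k)) = 0" if "w (Edge (es ! k)) = \<infinity>"
    using that by (simp add: finite_weight_def)
  ultimately show "Inv (Suc k) (nupd I 0 (Suc k) (seval save_edge s'))"
    using inv eqs k by (auto simp: save_edge_def less_Suc_eq Inv_def add.assoc)
qed (use s in \<open>simp_all add: save_edge_def Inv_def\<close>)

lemma stores_instance_frame:
  assumes "stores_instance s n' es' T' w'" "frame W s s'"
    "W \<inter> {''n'', ''m'', ''tail'', ''head'', ''edge_weight'', ''terminal'', ''vertex_weight''} = {}"
  shows "stores_instance s' n' es' T' w'"
  using assms by (simp add: stores_instance_def frame_def)

lemma run_save:
  assumes s: "stores_instance s n es T w" "stores_set s ''R'' n R"
    and th: "\<And>j. j < m \<Longrightarrow> nats s ''tail'' j = tl j \<and> nats s ''head'' j = hd j"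
  shows "run save s (200 * n + 200 * m + 40) (\<lambda>s'. saved0 s' \<and> cleared s')"
proof -
  let ?s1 = "wupd BIG 0 1 (nupd M 0 m (nupd N 0 n s))"
  have s1: "stores_instance ?s1 n es T w" "stores_set ?s1 ''R'' n R"
    using s by (simp_all add: stores_instance_def stores_set_def)
  have "run (For I N save_vertex ;; For I M save_edge) ?s1 ((200 * n + 9) + (200 * m + 9))
      (\<lambda>s'. saved0 s' \<and> cleared s')"
  proof (rule run_Seq[OF run_save_vertices[OF _ _ s1]])
    fix s' assume s': "(weights s' BIG 0 = ereal (1 + (\<Sum>v<n. if v \<notin> T then finite_weight (Vertex v) else 0)) \<and>
       (\<forall>v<n. nats s' TM v = of_bool (v \<in> T) \<and> nats s' RR v = of_bool (v \<in> R) \<and>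
         (v \<notin> T \<longrightarrow> weights s' VW v = w (Vertex v)) \<and> nats s' XV v = 0 \<and> nats s' FIRST v = 0)) \<and>
       frame (insert I (writes save_vertex)) ?s1 s'"
    then have fr: "frame (insert I (writes save_vertex)) ?s1 s'" by simp
    show "run (For I M save_edge) s' (200 * m + 9) (\<lambda>s'. saved0 s' \<and> cleared s')"
    proof (rule run_mono[OF run_save_edges])
      show "nats s' M 0 = m" "stores_instance s' n es T w"
        using frame_nats[OF fr] stores_instance_frame[OF s1(1) fr] by simp_all
      show "nats s' ''tail'' j = tl j \<and> nats s' ''head'' j = hd j" if "j < m" for j
        using frame_nats[OF fr] th[OF that] by simp
      show "weights s' BIG 0 = ereal (1 + (\<Sum>v<n. if v \<notin> T then finite_weight (Vertex v) else 0))"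
        using s' by simp
    next
      fix s'' assume s'': "(weights s'' BIG 0 = ereal (1 + (\<Sum>v<n. if v \<notin> T then finite_weight (Vertex v) else 0)
          + (\<Sum>j<m. finite_weight (Edge (es ! j)))) \<and>
        (\<forall>j<m. nats s'' TL j = tl j \<and> nats s'' HD j = hd j \<and>
         weights s'' EW j = w (Edge (es ! j)) \<and> nats s'' XE j = 0 \<and> nats s'' STAMP j = 0)) \<and>
        frame (insert I (writes save_edge)) s' s''"
      then have fr': "frame (insert I (writes save_edge)) s' s''" by simp
      have b: "big n es T w = 1 + (\<Sum>v<n. if v \<notin> T then finite_weight (Vertex v) else 0)
          + (\<Sum>j<m. finite_weight (Edge (es ! j)))"
        unfolding big_split[OF distinct_es] finite_weight_def
        by (intro arg_cong2[where f = "(+)"] arg_cong[where f = "(+) 1"] sum.cong) auto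
      show "saved0 s'' \<and> cleared s''"
        using s' s'' frame_nats[OF fr] frame_weights[OF fr] frame_nats[OF fr'] frame_weights[OF fr']
        unfolding saved0_def cleared_def b by simp
    qed simp
  qed simp_all
  moreover have "?s1 = seval (nset N (sc ''n'') ;; nset M (sc ''m'') ;; WAssign BIG (NConst 0) WOne) s"
    using s by (simp add: stores_instance_def)
  ultimately show ?thesis unfolding save_def by (simp only:, elim run_prefix) simp_all
qed

lemma run_cap_weights:
  assumes s: "saved0 s" "cleared s"
  shows "run cap_weights s (200 * n + 200 * m + 18) (\<lambda>s'. saved s' \<and> cleared s')"
proof -
  let ?VI = "\<lambda>k s'. \<forall>v<n. v \<notin> T \<longrightarrow> weights s' VW v = (if v < k then ereal (\<omega> (Vertex v)) else w (Vertex v))"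
  let ?EI = "\<lambda>k s'. \<forall>j<m. weights s' EW j = (if j < k then ereal (\<omega> (Edge (es ! j))) else w (Edge (es ! j)))"
  have V: "run (For I N cap_vertex) s (200 * n + 9) (\<lambda>s'. ?VI n s' \<and> frame (insert I (writes cap_vertex)) s s')"
  proof (rule run_For_loopfree[where Inv = ?VI])
    fix k s' assume k: "k < n" "nats s' I 0 = k" and fr: "frame (insert I (writes cap_vertex)) s s'"
      and inv: "?VI k s'"
    have "weights s' BIG 0 = ereal (big n es T w)"
      using frame_weights[OF fr] s by (simp add: saved0_def)
    moreover have "k \<notin> T \<Longrightarrow> w (Vertex k) \<noteq> \<infinity> \<Longrightarrow> w (Vertex k) = ereal (\<omega> (Vertex k))"
      using w_ereal[of "Vertex k"] k by (simp add: cap_def elements_def)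
    ultimately show "?VI (Suc k) (nupd I 0 (Suc k) (seval cap_vertex s'))"
      using inv k by (auto simp: cap_vertex_def less_Suc_eq cap_def)
  qed (use s in \<open>simp_all add: cap_vertex_def saved0_def\<close>)
  have "run cap_weights s ((200 * n + 9) + (200 * m + 9)) (\<lambda>s'. saved s' \<and> cleared s')"
    unfolding cap_weights_def
  proof (rule run_Seq[OF V])
    fix s1 assume s1: "?VI n s1 \<and> frame (insert I (writes cap_vertex)) s s1"
    then have fr1: "frame (insert I (writes cap_vertex)) s s1" by simp
    have "run (For I M cap_edge) s1 (200 * m + 9) (\<lambda>s'. ?EI m s' \<and> frame (insert I (writes cap_edge)) s1 s')"
    proof (rule run_For_loopfree[where Inv = ?EI])
      fix k s' assume k: "k < m" "nats s' I 0 = k" and fr: "frame (insert I (writes cap_edge)) s1 s'"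
        and inv: "?EI k s'"
      have "weights s' BIG 0 = ereal (big n es T w)"
        using frame_weights[OF fr] frame_weights[OF fr1] s by (simp add: saved0_def)
      moreover have "w (Edge (es ! k)) \<noteq> \<infinity> \<Longrightarrow> w (Edge (es ! k)) = ereal (\<omega> (Edge (es ! k)))"
        using w_ereal[of "Edge (es ! k)"] k by (simp add: cap_def elements_def)
      ultimately show "?EI (Suc k) (nupd I 0 (Suc k) (seval cap_edge s'))"
        using inv k by (auto simp: cap_edge_def less_Suc_eq cap_def)
    qed (use s frame_nats[OF fr1] frame_weights[OF fr1] in \<open>simp_all add: cap_edge_def saved0_def\<close>)
    then show "run (For I M cap_edge) s1 (200 * m + 9) (\<lambda>s'. saved s' \<and> cleared s')"
    proof (rule run_mono)
      fix s2 assume s2: "?EI m s2 \<and> frame (insert I (writes cap_edge)) s1 s2"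
      then have fr2: "frame (insert I (writes cap_edge)) s1 s2" by simp
      show "saved s2 \<and> cleared s2"
        using s s1 s2 frame_nats[OF fr1] frame_weights[OF fr1] frame_nats[OF fr2] frame_weights[OF fr2]
        by (simp add: saved0_def saved_def cleared_def)
    qed simp
  qed
  then show ?thesis by (rule run_mono) simp_all
qed

lemma run_index:
  assumes s: "saved s"
  shows "run index s (200 * n + 50) (\<lambda>s'. nats s' KK 0 = card R - 1 \<and>
    (\<forall>r\<in>R. nats s' IDX r < card R) \<and> inj_on (nats s' IDX) R \<and>
    (\<forall>x\<le>n. nats s' HALF x = x div 2 \<and> nats s' PAR x = x mod 2))"
proof -
  let ?R = "\<lambda>k. {r \<in> R. r < k}"
  let ?Inv = "\<lambda>k s'. nats s' CNT 0 = card (?R k) \<and> (\<forall>r \<in> ?R k. nats s' IDX r < card (?R k)) \<and>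
    inj_on (nats s' IDX) (?R k) \<and> (\<forall>x\<le>k. nats s' HALF x = x div 2 \<and> nats s' PAR x = x mod 2)"
  let ?init = "nset CNT (NConst 0) ;; NAssign HALF (NConst 0) (NConst 0) ;; NAssign PAR (NConst 0) (NConst 0)"
  have Rn: "?R n = R" using R_n by auto
  have loop: "run (For I N number_vertex) (seval ?init s) (200 * n + 9)
      (\<lambda>s'. ?Inv n s' \<and> frame (insert I (writes number_vertex)) (seval ?init s) s')"
  proof (rule run_For_loopfree[where Inv = ?Inv])
    fix k s' assume k: "k < n" "nats s' I 0 = k"
      and fr: "frame (insert I (writes number_vertex)) (seval ?init s) s'" and inv: "?Inv k s'"
    have RR: "nats s' RR k = of_bool (k \<in> R)" using frame_nats[OF fr] s k by (simp add: saved_def)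
    have hp: "Suc k div 2 = k div 2 + k mod 2" "Suc k mod 2 = 1 - k mod 2" by presburger+
    show "?Inv (Suc k) (nupd I 0 (Suc k) (seval number_vertex s'))"
    proof (cases "k \<in> R")
      case True
      then have "?R (Suc k) = insert k (?R k)" by auto
      moreover have "card (insert k (?R k)) = Suc (card (?R k))" by simp
      ultimately show ?thesis using inv k RR True hp
        by (auto simp: number_vertex_def le_Suc_eq inj_on_def)
    next
      case False
      then have "?R (Suc k) = ?R k" using less_Suc_eq by auto
      then show ?thesis using inv k RR False hp by (simp add: number_vertex_def le_Suc_eq)
    qed
  qed (use s in \<open>simp_all add: number_vertex_def saved_def\<close>)
  have "run (For I N number_vertex ;; nset KK (NSub (sc CNT) (NConst 1))) (seval ?init s)
      ((200 * n + 9) + 20) (\<lambda>s'. nats s' KK 0 = card R - 1 \<and>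
    (\<forall>r\<in>R. nats s' IDX r < card R) \<and> inj_on (nats s' IDX) R \<and>
    (\<forall>x\<le>n. nats s' HALF x = x div 2 \<and> nats s' PAR x = x mod 2))"
    by (rule run_Seq[OF loop], rule run_loopfree) (simp_all add: Rn)
  then show ?thesis unfolding index_def by (elim run_prefix) simp_all
qed

end

section \<open>One round: a cut along one bit\<close>

context blackbox
begin

lemma run_P:
  assumes "ec_instance {..<n} (set es) T w" "distinct es" "A \<subseteq> T" "B \<subseteq> T" "A \<inter> B = {}"
    "stores_instance s n es T w" "stores_set s ''A'' n A" "stores_set s ''B'' n B"
  shows "run P s (Tec (length es) n)
    (\<lambda>s'. \<exists>X. min_element_cut {..<n} (set es) T w A B X \<and> stores_cut s' n es X)"
proof -
  have "\<exists>t s' X. exec P s t s' \<and> t \<le> Tec (length es) n \<and>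
      min_element_cut {..<n} (set es) T w A B X \<and> stores_cut s' n es X"
    using assms by (intro P[unfolded computes_min_element_cuts_def, rule_format]) simp
  then show ?thesis unfolding run_def by auto
qed

definition load_vertex :: com where
  "load_vertex =
    NAssign ''terminal'' (sc I) (cell TM I) ;; WAssign ''vertex_weight'' (sc I) (wcell VW I) ;;
    If (is1 (cell RR I))
      (NAssign ''A'' (sc I) (NSub (NConst 1) (NCell PAR (cell IDX I))) ;;
       NAssign ''B'' (sc I) (NCell PAR (cell IDX I)) ;;
       NAssign IDX (sc I) (NCell HALF (cell IDX I)))
      (NAssign ''A'' (sc I) (NConst 0) ;; NAssign ''B'' (sc I) (NConst 0))"

definition load_edge :: com where
  "load_edge = NAssign ''tail'' (sc I) (cell TL I) ;; NAssign ''head'' (sc I) (cell HD I) ;;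
    WAssign ''edge_weight'' (sc I) (wcell EW I)"

definition collect_vertex :: com where
  "collect_vertex = When (is1 (cell ''cut_vertex'' I)) (NAssign XV (sc I) (NConst 1))"

definition collect_edge :: com where
  "collect_edge = When (is1 (cell ''cut_edge'' I)) (NAssign XE (sc I) (NConst 1))"

definition load :: com where
  "load = For I N load_vertex ;; For I M load_edge ;; nset ''n'' (sc N) ;; nset ''m'' (sc M)"

definition collect :: com where
  "collect = For I N collect_vertex ;; For I M collect_edge"

text \<open>One bit of the numbering \<open>IDX\<close> per round: the sides are given by the parity, and \<open>IDX\<close> is halved
  by table lookup, as the machine cannot divide.\<close>

definition round :: com where
  "round = load ;; P ;; collect ;; nset KK (NCell HALF (sc KK))"

definition rounds :: com where
  "rounds = While (NLess (NConst 0) (sc KK)) round"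

lemma writes_load_vertex [simp]:
  "writes load_vertex = {''terminal'', ''vertex_weight'', ''A'', ''B'', IDX}"
  by (auto simp: load_vertex_def)

lemma writes_load_edge [simp]: "writes load_edge = {''tail'', ''head'', ''edge_weight''}"
  by (auto simp: load_edge_def)

lemma writes_collect_vertex [simp]: "writes collect_vertex = {XV}"
  by (auto simp: collect_vertex_def)

lemma writes_collect_edge [simp]: "writes collect_edge = {XE}"
  by (auto simp: collect_edge_def)

lemma writes_load [simp]: "writes load = {''terminal'', ''vertex_weight'', ''A'', ''B'', IDX, I,
    ''tail'', ''head'', ''edge_weight'', ''n'', ''m''}"
  by (auto simp: load_def)

lemma writes_collect [simp]: "writes collect = {I, XV, XE}"
  by (auto simp: collect_def)

lemma writes_round [simp]: "writes round = writes load \<union> writes P \<union> writes collect \<union> {KK}"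
  by (auto simp: round_def)

lemma writes_rounds [simp]: "writes rounds = writes round"
  by (simp add: rounds_def)

end

context input
begin

definition tables :: "state \<Rightarrow> bool" where
  "tables s \<longleftrightarrow> (\<forall>x\<le>n. nats s HALF x = x div 2 \<and> nats s PAR x = x mod 2)"

lemma run_load:
  assumes s: "saved s" "tables s" and idx: "\<And>r. r \<in> R \<Longrightarrow> nats s IDX r \<le> n"
  shows "run load s (200 * n + 200 * m + 40) (\<lambda>s'. stores_instance s' n es T (\<lambda>x. ereal (\<omega> x)) \<and>
    stores_set s' ''A'' n {r \<in> R. even (nats s IDX r)} \<and>
    stores_set s' ''B'' n {r \<in> R. odd (nats s IDX r)} \<and>
    (\<forall>r\<in>R. nats s' IDX r = nats s IDX r div 2))"
proof -
  let ?VI = "\<lambda>k s'. (\<forall>v<k. nats s' ''terminal'' v = of_bool (v \<in> T) \<and>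
      (v \<notin> T \<longrightarrow> weights s' ''vertex_weight'' v = ereal (\<omega> (Vertex v))) \<and>
      nats s' ''A'' v = of_bool (v \<in> R \<and> even (nats s IDX v)) \<and>
      nats s' ''B'' v = of_bool (v \<in> R \<and> odd (nats s IDX v))) \<and>
      (\<forall>r\<in>R. nats s' IDX r = (if r < k then nats s IDX r div 2 else nats s IDX r))"
  let ?EI = "\<lambda>k s'. (\<forall>j<k. nats s' ''tail'' j = tl j \<and> nats s' ''head'' j = hd j \<and>
      weights s' ''edge_weight'' j = ereal (\<omega> (Edge (es ! j))))"
  let ?Q = "\<lambda>s'. stores_instance s' n es T (\<lambda>x. ereal (\<omega> x)) \<and>
    stores_set s' ''A'' n {r \<in> R. even (nats s IDX r)} \<and>
    stores_set s' ''B'' n {r \<in> R. odd (nats s IDX r)} \<and>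
    (\<forall>r\<in>R. nats s' IDX r = nats s IDX r div 2)"
  have V: "run (For I N load_vertex) s (200 * n + 9) (\<lambda>s'. ?VI n s' \<and> frame (insert I (writes load_vertex)) s s')"
  proof (rule run_For_loopfree[where Inv = ?VI])
    fix k s' assume k: "k < n" "nats s' I 0 = k" and fr: "frame (insert I (writes load_vertex)) s s'"
      and inv: "?VI k s'"
    have eqs: "nats s' TM k = of_bool (k \<in> T)" "nats s' RR k = of_bool (k \<in> R)"
      "k \<notin> T \<Longrightarrow> weights s' VW k = ereal (\<omega> (Vertex k))"
      using frame_nats[OF fr] frame_weights[OF fr] s(1) k(1) by (simp_all add: saved_def)
    show "?VI (Suc k) (nupd I 0 (Suc k) (seval load_vertex s'))"
    proof (cases "k \<in> R")
      case True
      have tab: "nats s' HALF (nats s IDX k) = nats s IDX k div 2" "nats s' PAR (nats s IDX k) = nats s IDX k mod 2"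
        using frame_nats[OF fr] s(2) idx[OF True] by (simp_all add: tables_def)
      show ?thesis using inv k eqs True tab
        by (auto simp: load_vertex_def less_Suc_eq odd_iff_mod_2_eq_one)
    next
      case False
      show ?thesis using inv k eqs False
        by (auto simp: load_vertex_def less_Suc_eq)
    qed
  qed (use s in \<open>simp_all add: load_vertex_def saved_def\<close>)
  have "run load s ((200 * n + 9) + ((200 * m + 9) + 20)) ?Q"
    unfolding load_def
  proof (rule run_Seq[OF V])
    fix s1 assume s1: "?VI n s1 \<and> frame (insert I (writes load_vertex)) s s1"
    then have fr1: "frame (insert I (writes load_vertex)) s s1" by simp
    have E: "run (For I M load_edge) s1 (200 * m + 9) (\<lambda>s'. ?EI m s' \<and> frame (insert I (writes load_edge)) s1 s')"
    proof (rule run_For_loopfree[where Inv = ?EI])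
      fix k s' assume k: "k < m" "nats s' I 0 = k" and fr: "frame (insert I (writes load_edge)) s1 s'"
        and inv: "?EI k s'"
      show "?EI (Suc k) (nupd I 0 (Suc k) (seval load_edge s'))"
        using inv k s(1) frame_nats[OF fr] frame_weights[OF fr] frame_nats[OF fr1] frame_weights[OF fr1]
        by (simp add: load_edge_def less_Suc_eq saved_def)
    qed (use s frame_nats[OF fr1] in \<open>simp_all add: load_edge_def saved_def\<close>)
    show "run (For I M load_edge ;; nset ''n'' (sc N) ;; nset ''m'' (sc M)) s1 ((200 * m + 9) + 20) ?Q"
    proof (rule run_Seq[OF E], rule run_loopfree)
      fix s2 assume s2: "?EI m s2 \<and> frame (insert I (writes load_edge)) s1 s2"
      then have fr2: "frame (insert I (writes load_edge)) s1 s2" by simp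
      show "?Q (seval (nset ''n'' (sc N) ;; nset ''m'' (sc M)) s2)"
        using s(1) s1 s2 frame_nats[OF fr1] frame_weights[OF fr1] frame_nats[OF fr2] frame_weights[OF fr2] R_n
        by (simp add: stores_instance_def stores_set_def saved_def es_nth)
    qed simp_all
  qed
  then show ?thesis by (rule run_mono) simp_all
qed

definition collected :: "nat element set \<Rightarrow> state \<Rightarrow> bool" where
  "collected X s \<longleftrightarrow> (\<forall>v<n. nats s XV v = of_bool (Vertex v \<in> X)) \<and>
    (\<forall>j<m. nats s XE j = of_bool (Edge (es ! j) \<in> X))"

lemma run_collect:
  assumes s: "saved s" "collected X s" "stores_cut s n es Y"
  shows "run collect s (200 * n + 200 * m + 40) (collected (X \<union> Y))"
proof -
  let ?VI = "\<lambda>k s'. \<forall>v<n. nats s' XV v = of_bool (Vertex v \<in> X \<or> v < k \<and> Vertex v \<in> Y)"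
  let ?EI = "\<lambda>k s'. \<forall>j<m. nats s' XE j = of_bool (Edge (es ! j) \<in> X \<or> j < k \<and> Edge (es ! j) \<in> Y)"
  have V: "run (For I N collect_vertex) s (200 * n + 9) (\<lambda>s'. ?VI n s' \<and> frame (insert I (writes collect_vertex)) s s')"
  proof (rule run_For_loopfree[where Inv = ?VI])
    fix k s' assume k: "k < n" "nats s' I 0 = k" and fr: "frame (insert I (writes collect_vertex)) s s'"
      and inv: "?VI k s'"
    have "nats s' ''cut_vertex'' k = of_bool (Vertex k \<in> Y)"
      using frame_nats[OF fr] s(3) k(1) by (simp add: stores_cut_def)
    then show "?VI (Suc k) (nupd I 0 (Suc k) (seval collect_vertex s'))"
      using inv k by (auto simp: collect_vertex_def less_Suc_eq)
  qed (use s in \<open>simp_all add: collect_vertex_def saved_def collected_def\<close>)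
  have "run collect s ((200 * n + 9) + (200 * m + 9)) (collected (X \<union> Y))"
    unfolding collect_def
  proof (rule run_Seq[OF V])
    fix s1 assume s1: "?VI n s1 \<and> frame (insert I (writes collect_vertex)) s s1"
    then have fr1: "frame (insert I (writes collect_vertex)) s s1" by simp
    have E: "run (For I M collect_edge) s1 (200 * m + 9) (\<lambda>s'. ?EI m s' \<and> frame (insert I (writes collect_edge)) s1 s')"
    proof (rule run_For_loopfree[where Inv = ?EI])
      fix k s' assume k: "k < m" "nats s' I 0 = k" and fr: "frame (insert I (writes collect_edge)) s1 s'"
        and inv: "?EI k s'"
      have "nats s' ''cut_edge'' k = of_bool (Edge (es ! k) \<in> Y)"
        using frame_nats[OF fr] frame_nats[OF fr1] s(3) k(1) by (simp add: stores_cut_def)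
      then show "?EI (Suc k) (nupd I 0 (Suc k) (seval collect_edge s'))"
        using inv k by (auto simp: collect_edge_def less_Suc_eq)
    qed (use s frame_nats[OF fr1] in \<open>simp_all add: collect_edge_def saved_def collected_def\<close>)
    show "run (For I M collect_edge) s1 (200 * m + 9) (collected (X \<union> Y))"
    proof (rule run_mono[OF E])
      fix s2 assume s2: "?EI m s2 \<and> frame (insert I (writes collect_edge)) s1 s2"
      then have fr2: "frame (insert I (writes collect_edge)) s1 s2" by simp
      show "collected (X \<union> Y) s2"
        using s1 s2 frame_nats[OF fr2] by (simp add: collected_def)
    qed simp
  qed
  then show ?thesis by (rule run_mono) simp_all
qed

text \<open>\<open>IDX\<close> holds the bits not yet used: terminals that agree on them have
  already been separated. Once \<open>KK\<close> is 0, all remaining numbers are 0, so every pair is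
  separated. The bound \<open>n\<close> on \<open>KK\<close> keeps lookups inside the
  tables.\<close>

definition rinv :: "state \<Rightarrow> bool" where
  "rinv s \<longleftrightarrow> saved s \<and> tables s \<and> nats s KK 0 \<le> n \<and> (\<forall>r\<in>R. nats s IDX r \<le> nats s KK 0) \<and>
    (\<exists>CS. bipartitions R CS \<and> collected (removed CS) s \<and>
      (\<forall>r\<in>R. \<forall>r'\<in>R. r \<noteq> r' \<longrightarrow> nats s IDX r \<noteq> nats s IDX r' \<or> separated CS r r'))"

lemma ereal_instance: "ec_instance {..<n} (set es) T (\<lambda>x. ereal (\<omega> x))"
  using inst pos by (auto simp: ec_instance_def)

lemma run_round:
  assumes s: "rinv s"
  shows "run round s (Tec m n + 400 * n + 400 * m + 100)
    (\<lambda>s'. rinv s' \<and> nats s' KK 0 = nats s KK 0 div 2)"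
proof -
  let ?A = "{r \<in> R. even (nats s IDX r)}" and ?B = "{r \<in> R. odd (nats s IDX r)}"
  obtain CS where CS: "bipartitions R CS" "collected (removed CS) s"
    "\<forall>r\<in>R. \<forall>r'\<in>R. r \<noteq> r' \<longrightarrow> nats s IDX r \<noteq> nats s IDX r' \<or> separated CS r r'"
    using s by (auto simp: rinv_def)
  have s': "saved s" "tables s" "nats s KK 0 \<le> n" "\<forall>r\<in>R. nats s IDX r \<le> nats s KK 0"
    using s by (auto simp: rinv_def)
  then have idx: "nats s IDX r \<le> n" if "r \<in> R" for r using that by (meson order_trans)
  have "run round s ((200 * n + 200 * m + 40) + (Tec m n + ((200 * n + 200 * m + 40) + 20)))
    (\<lambda>s'. rinv s' \<and> nats s' KK 0 = nats s KK 0 div 2)"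
    unfolding round_def
  proof (rule run_Seq[OF run_load[OF s'(1,2) idx]], assumption)
    fix s1 assume s1: "stores_instance s1 n es T (\<lambda>x. ereal (\<omega> x)) \<and>
      stores_set s1 ''A'' n ?A \<and> stores_set s1 ''B'' n ?B \<and> (\<forall>r\<in>R. nats s1 IDX r = nats s IDX r div 2)"
      and fr1: "frame (writes load) s s1"
    have P1: "run P s1 (Tec m n)
        (\<lambda>s'. \<exists>X. min_element_cut {..<n} (set es) T (\<lambda>x. ereal (\<omega> x)) ?A ?B X \<and> stores_cut s' n es X)"
      using s1 R_sub by (intro run_P ereal_instance distinct_es) auto
    show "run (P ;; collect ;; nset KK (NCell HALF (sc KK))) s1 (Tec m n + ((200 * n + 200 * m + 40) + 20))
        (\<lambda>s'. rinv s' \<and> nats s' KK 0 = nats s KK 0 div 2)"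
    proof (rule run_Seq[OF P1], elim exE conjE)
      fix s2 X assume X: "min_element_cut {..<n} (set es) T (\<lambda>x. ereal (\<omega> x)) ?A ?B X" "stores_cut s2 n es X"
        and fr2: "frame (writes P) s1 s2"
      have X': "min_cut ?A ?B X" using X(1) min_element_cut_iff by simp
      have sv1: "saved s1" using saved_frame[OF s'(1) fr1] by simp
      have sv2: "saved s2" using saved_frame[OF sv1 fr2] by simp
      have col: "collected (removed CS) s2"
        using CS(2) frame_nats[OF fr1] frame_nats[OF fr2] by (simp add: collected_def)
      show "run (collect ;; nset KK (NCell HALF (sc KK))) s2 ((200 * n + 200 * m + 40) + 20)
        (\<lambda>s'. rinv s' \<and> nats s' KK 0 = nats s KK 0 div 2)"
      proof (rule run_Seq[OF run_collect[OF sv2 col X(2)]], rule run_loopfree)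
        fix s3 assume s3: "collected (removed CS \<union> X) s3" and fr3: "frame (writes collect) s2 s3"
        let ?CS = "insert (?A, ?B, X) CS"
        let ?s4 = "nupd KK 0 (nats s3 HALF (nats s3 KK 0)) s3"
        have eqs: "nats s3 HALF = nats s HALF" "nats s3 PAR = nats s PAR" "nats s3 KK = nats s KK" "nats s3 IDX = nats s1 IDX"
          using frame_nats[OF fr1] frame_nats[OF fr2] frame_nats[OF fr3] by simp_all
        have half: "nats s HALF (nats s KK 0) = nats s KK 0 div 2" using s' by (simp add: tables_def)
        have "saved s3" using saved_frame[OF sv2 fr3] by simp
        then have "saved ?s4" by (simp add: saved_def)
        moreover have "tables ?s4" using s'(2) eqs by (simp add: tables_def)
        moreover have "bipartitions R ?CS" using CS(1) X' by (auto simp: bipartitions_def)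
        moreover have "collected (removed ?CS) ?s4" using s3 by (simp add: removed_def collected_def Un_commute)
        moreover have "\<forall>r\<in>R. nats ?s4 IDX r \<le> nats ?s4 KK 0"
          using s'(4) s1 by (simp add: eqs half div_le_mono)
        moreover have "nats ?s4 IDX r \<noteq> nats ?s4 IDX r' \<or> separated ?CS r r'"
          if r: "r \<in> R" "r' \<in> R" "r \<noteq> r'" for r r'
        proof (cases "separated CS r r'")
          case True
          then show ?thesis unfolding separated_def by blast
        next
          case False
          then have ne: "nats s IDX r \<noteq> nats s IDX r'" using CS(3) r by blast
          show ?thesis
          \<comment> \<open>Different numbers of equal parity still differ after halving; numbers of
            different parity are separated by the cut of this round.\<close>
          proof (cases "even (nats s IDX r) = even (nats s IDX r')")
            case True
            then have "nats s IDX r div 2 \<noteq> nats s IDX r' div 2" using ne by presburger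
            then show ?thesis using s1 r by (simp add: eqs)
          next
            case False
            then show ?thesis using r by (auto simp: separated_def)
          qed
        qed
        ultimately have "rinv ?s4" unfolding rinv_def using s'(3) by (auto simp: eqs half)
        then show "rinv (seval (nset KK (NCell HALF (sc KK))) s3) \<and>
            nats (seval (nset KK (NCell HALF (sc KK))) s3) KK 0 = nats s KK 0 div 2"
          by (simp add: eqs half)
      qed simp_all
    qed
  qed
  then show ?thesis by (rule run_mono) simp_all
qed

end

section \<open>Number of rounds\<close>

fun nbits :: "nat \<Rightarrow> nat" where
  "nbits k = (if k = 0 then 0 else Suc (nbits (k div 2)))"

declare nbits.simps [simp del]

lemma nbits_le_log: "0 < k \<Longrightarrow> real (nbits k) \<le> 1 + log 2 (real k)"
proof (induction k rule: nbits.induct)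
  case (1 k)
  show ?case
  proof (cases "k = 1")
    case True
    then show ?thesis by (simp add: nbits.simps)
  next
    case False
    then have k: "0 < k div 2" using 1 by presburger
    have "real (nbits k) = 1 + real (nbits (k div 2))" using 1 by (simp add: nbits.simps[of k])
    also have "\<dots> \<le> 1 + (1 + log 2 (real (k div 2)))" using 1 k by simp
    also have "1 + log 2 (real (k div 2)) = log 2 (2 * real (k div 2))"
      using k by (simp add: log_mult)
    also have "\<dots> \<le> log 2 (real k)" using k by (subst log_le_cancel_iff) auto
    finally show ?thesis by simp
  qed
qed

lemma removed_empty [simp]: "removed {} = {}"
  by (simp add: removed_def)

context input
begin

lemma run_rounds:
  assumes s: "saved s" "tables s" "collected {} s" "nats s KK 0 = card R - 1"
    "\<forall>r\<in>R. nats s IDX r < card R" "inj_on (nats s IDX) R"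
  shows "run rounds s (nbits (card R - 1) * (Tec m n + 400 * n + 400 * m + 110) + 5)
    (\<lambda>s'. saved s' \<and> (\<exists>CS. isolation {..<n} (set es) T \<omega> R CS \<and> collected (removed CS) s'))"
proof -
  \<comment> \<open>The cost of a round, with 10 more steps that cover the loop test. Each round
    uses up one bit of \<open>KK\<close>, so \<open>K\<close> per remaining bit is a valid
    potential.\<close>
  define K where "K = Tec m n + 400 * n + 400 * m + 110"
  let ?b = "NLess (NConst 0) (sc KK)"
  have "card R \<le> n"
    using R_n card_mono[of "{..<n}" R] by auto
  moreover have "bipartitions R {}" by (simp add: bipartitions_def)
  ultimately have init: "rinv s"
    unfolding rinv_def using s by (auto simp: inj_on_def intro!: exI[of _ "{}"] dest: Suc_pred)
  have "run (While ?b round) s (nbits (nats s KK 0) * K + 1 + bcost ?b)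
      (\<lambda>s'. rinv s' \<and> \<not> bval ?b s' \<and> frame (writes round) s s')"
  proof (rule run_While[where \<Phi> = "\<lambda>s. nbits (nats s KK 0) * K" and I = rinv])
    show "rinv s" by (rule init)
  next
    fix s' assume "rinv s'" and b: "bval ?b s'"
    have "nbits (nats s' KK 0) = Suc (nbits (nats s' KK 0 div 2))"
      using b by (simp add: nbits.simps[of "nats s' KK 0"])
    then show "\<exists>\<tau>. run round s' \<tau> (\<lambda>s''. rinv s'' \<and>
        1 + bcost ?b + \<tau> + nbits (nats s'' KK 0) * K \<le> nbits (nats s' KK 0) * K)"
      by (intro exI[of _ "Tec m n + 400 * n + 400 * m + 100"],
          intro run_mono[OF run_round[OF \<open>rinv s'\<close>] order_refl]) (simp add: K_def)
  qed
  then have "run rounds s (nbits (card R - 1) * K + 5)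
      (\<lambda>s'. rinv s' \<and> \<not> bval ?b s' \<and> frame (writes round) s s')"
    unfolding rounds_def s(4) by (rule run_mono) simp_all
  then show ?thesis
  proof (rule run_mono)
    fix s' assume s': "rinv s' \<and> \<not> bval ?b s' \<and> frame (writes round) s s'"
    then obtain CS where CS: "bipartitions R CS" "collected (removed CS) s'"
      "\<forall>r\<in>R. \<forall>r'\<in>R. r \<noteq> r' \<longrightarrow> separated CS r r'"
      by (auto simp: rinv_def)
    then have "isolation {..<n} (set es) T \<omega> R CS"
      using R_sub by unfold_locales auto
    then show "saved s' \<and> (\<exists>CS. isolation {..<n} (set es) T \<omega> R CS \<and> collected (removed CS) s')"
      using CS s' by (auto simp: rinv_def)
  qed (simp add: K_def)
qed

end

section \<open>Searching the component of a terminal\<close>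

text \<open>Arrays with a fill pointer serve as the queue, the code list and the output, all without
  repetitions; this is the push operation.\<close>

lemma bij_betw_append:
  assumes "bij_betw f {a..<k} S" "x \<notin> S" "a \<le> k"
  shows "bij_betw (f(k := x)) {a..<Suc k} (insert x S)"
proof -
  have "bij_betw (f(k := x)) {a..<k} S"
    using assms(1) by (rule bij_betw_cong[THEN iffD1, rotated]) simp
  moreover have "bij_betw (f(k := x)) {k} {x}" by (simp add: bij_betw_def)
  ultimately have "bij_betw (f(k := x)) ({a..<k} \<union> {k}) (S \<union> {x})"
    using assms(2) by (intro bij_betw_combine) auto
  then show ?thesis using assms(3) by (simp add: atLeastLessThanSuc)
qed

context blackbox
begin

abbreviation "NEXT \<equiv> fresh P 19"
abbreviation "EID \<equiv> fresh P 20"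
abbreviation "OTH \<equiv> fresh P 21"
abbreviation "Z \<equiv> fresh P 22"
abbreviation "RC \<equiv> fresh P 23"
abbreviation "MARK \<equiv> fresh P 24"
abbreviation "QUE \<equiv> fresh P 25"
abbreviation "QH \<equiv> fresh P 26"
abbreviation "QT \<equiv> fresh P 27"
abbreviation "PP \<equiv> fresh P 28"
abbreviation "CC \<equiv> fresh P 29"
abbreviation "CODE \<equiv> fresh P 30"
abbreviation "JJ \<equiv> fresh P 35"
abbreviation "VV \<equiv> fresh P 36"

definition link :: "name \<Rightarrow> name \<Rightarrow> com" where
  "link a b = nset CNT (NAdd (sc CNT) (NConst 1)) ;; NAssign EID (sc CNT) (sc I) ;;
    NAssign OTH (sc CNT) (cell b I) ;; NAssign NEXT (sc CNT) (NCell FIRST (cell a I)) ;;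
    NAssign FIRST (cell a I) (sc CNT)"

definition adjacency :: com where
  "adjacency = nset CNT (NConst 0) ;; For I M (link TL HD ;; link HD TL)"

text \<open>Terminals are treated in increasing order, so stamps of earlier searches are at most
  \<open>r\<close> and differ from \<open>r + 1\<close>. Thus no search has to clear the stamps,
  which would cost \<open>m\<close> steps per terminal.\<close>

definition stamp_edge :: com where
  "stamp_edge = When (BNot (NEq (cell STAMP JJ) (NAdd (sc RC) (NConst 1))))
    (NAssign STAMP (sc JJ) (NAdd (sc RC) (NConst 1)) ;;
     NAssign ''tail'' (sc CC) (cell TL JJ) ;; NAssign ''head'' (sc CC) (cell HD JJ) ;;
     WAssign ''edge_weight'' (sc CC) (wcell EW JJ) ;;
     NAssign CODE (sc CC) (NAdd (sc N) (sc JJ)) ;; nset CC (NAdd (sc CC) (NConst 1)))"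

text \<open>A removed vertex yields an edge to the sink whichever edge leads to it, as
  \<open>bnd\<close> also admits removed edges. A surviving vertex behind a removed edge stays
  unmarked, because another edge may still reach it.\<close>

definition mark_vertex :: com where
  "mark_vertex = When (is0 (cell MARK VV))
    (If (is1 (cell XV VV))
      (NAssign MARK (sc VV) (NConst 2) ;;
       NAssign ''tail'' (sc CC) (sc VV) ;; NAssign ''head'' (sc CC) (sc Z) ;;
       WAssign ''edge_weight'' (sc CC) (wcell VW VV) ;;
       NAssign CODE (sc CC) (sc VV) ;; nset CC (NAdd (sc CC) (NConst 1)))
      (When (is0 (cell XE JJ))
        (NAssign MARK (sc VV) (NConst 1) ;; NAssign QUE (sc QT) (sc VV) ;;
         nset QT (NAdd (sc QT) (NConst 1)))))"

definition scan_slot :: com where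
  "scan_slot = nset JJ (cell EID PP) ;; nset VV (cell OTH PP) ;; stamp_edge ;; mark_vertex ;;
    nset PP (cell NEXT PP)"

definition scan_vertex :: com where
  "scan_vertex = (nset PP (NCell FIRST (cell QUE QH)) ;; nset QH (NAdd (sc QH) (NConst 1))) ;;
    While (NLess (NConst 0) (sc PP)) scan_slot"

definition search :: com where
  "search = (NAssign MARK (sc RC) (NConst 1) ;; NAssign QUE (NConst 0) (sc RC) ;;
    nset QH (NConst 0) ;; nset QT (NConst 1) ;; nset CC (NConst 0)) ;;
    While (NLess (sc QH) (sc QT)) scan_vertex"

lemma writes_link [simp]: "writes (link a b) = {CNT, EID, OTH, NEXT, FIRST}"
  by (auto simp: link_def)

lemma writes_adjacency [simp]: "writes adjacency = {I, CNT, EID, OTH, NEXT, FIRST}"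
  by (auto simp: adjacency_def)

lemma writes_stamp_edge [simp]:
  "writes stamp_edge = {STAMP, ''tail'', ''head'', ''edge_weight'', CODE, CC}"
  by (auto simp: stamp_edge_def)

lemma writes_mark_vertex [simp]:
  "writes mark_vertex = {MARK, QUE, QT, ''tail'', ''head'', ''edge_weight'', CODE, CC}"
  by (auto simp: mark_vertex_def)

lemma writes_scan_slot [simp]:
  "writes scan_slot = {JJ, VV, PP, STAMP, MARK, QUE, QT, ''tail'', ''head'', ''edge_weight'', CODE, CC}"
  by (auto simp: scan_slot_def)

lemma writes_scan_vertex [simp]: "writes scan_vertex = insert QH (writes scan_slot)"
  by (auto simp: scan_vertex_def)

lemma writes_search [simp]: "writes search = insert QH (writes scan_slot)"
  by (auto simp: search_def)

end

context input
begin

text \<open>The \<open>j\<close>-th edge occupies the slots \<open>2 * j + 1\<close> (seen from its tail) and \<open>2 * j + 2\<close>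
  (seen from its head); slot 0 ends a list.\<close>

definition "eid p = (p - 1) div (2::nat)"
definition "src p = (if odd p then tl (eid p) else hd (eid p))"
definition "oth p = (if odd p then hd (eid p) else tl (eid p))"
definition "slots = {1..2 * m}"

text \<open>The links of the adjacency lists in closed form: the latest slot below the given one
  with source \<open>v\<close>, or 0 if there is none.\<close>

primrec prev :: "nat \<Rightarrow> nat \<Rightarrow> nat" where
  "prev v 0 = 0"
| "prev v (Suc q) = (if 0 < q \<and> src q = v then q else prev v q)"

lemma prev_src: "prev v p \<noteq> 0 \<Longrightarrow> prev v p < p \<and> src (prev v p) = v"
  by (induction p) (auto split: if_splits)

lemma prev_gap: "prev v p < q \<Longrightarrow> q < p \<Longrightarrow> src q \<noteq> v"
  by (induction p) (auto split: if_splits simp: less_Suc_eq)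

lemma slot_props:
  assumes "p \<in> slots"
  shows "eid p < m" "es ! eid p = {src p, oth p}" "src p < n" "oth p < n"
proof -
  show j: "eid p < m" using assms by (auto simp: slots_def eid_def)
  show "es ! eid p = {src p, oth p}" "src p < n" "oth p < n"
    using es_nth[OF j] es_V[OF j] by (auto simp: src_def oth_def)
qed

lemma slot_ex:
  assumes "{u, v} \<in> set es"
  shows "\<exists>p \<in> slots. src p = u \<and> oth p = v \<and> es ! eid p = {u, v}"
proof -
  obtain j where j: "j < m" "es ! j = {u, v}" using assms by (metis in_set_conv_nth)
  have e: "eid (2 * j + 1) = j" "eid (2 * j + 2) = j" by (simp_all add: eid_def)
  have "{tl j, hd j} = {u, v}" using es_nth[OF j(1)] j(2) by simp
  then consider "tl j = u" "hd j = v" | "tl j = v" "hd j = u" by (auto simp: doubleton_eq_iff)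
  then show ?thesis
  proof cases
    case 1
    then show ?thesis using e j by (intro bexI[of _ "2 * j + 1"]) (auto simp: src_def oth_def slots_def)
  next
    case 2
    then show ?thesis using e j by (intro bexI[of _ "2 * j + 2"]) (auto simp: src_def oth_def slots_def)
  qed
qed

lemma slot_of_end:
  assumes "j < m" "u \<in> es ! j"
  shows "\<exists>p \<in> slots. src p = u \<and> eid p = j"
proof -
  have e: "eid (2 * j + 1) = j" "eid (2 * j + 2) = j" by (simp_all add: eid_def)
  have "u = tl j \<or> u = hd j" using assms es_nth[OF assms(1)] by simp
  then show ?thesis
  proof
    assume "u = tl j"
    then show ?thesis using e assms(1) by (intro bexI[of _ "2 * j + 1"]) (auto simp: src_def slots_def)
  next
    assume "u = hd j"
    then show ?thesis using e assms(1) by (intro bexI[of _ "2 * j + 2"]) (auto simp: src_def slots_def)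
  qed
qed

definition adjacent :: "state \<Rightarrow> bool" where
  "adjacent s \<longleftrightarrow> (\<forall>p\<in>slots. nats s EID p = eid p \<and> nats s OTH p = oth p \<and> nats s NEXT p = prev (src p) p) \<and>
    (\<forall>v<n. nats s FIRST v = prev v (2 * m + 1))"

text \<open>Every edge adds two slots. As its ends differ, the second insertion does not see the
  first, so both links point to slots of earlier edges.\<close>

lemma run_adjacency:
  assumes s: "saved s" "\<forall>v<n. nats s FIRST v = 0"
  shows "run adjacency s (200 * m + 20) adjacent"
proof -
  let ?Inv = "\<lambda>k s'. nats s' CNT 0 = 2 * k \<and>
    (\<forall>p\<in>{1..2 * k}. nats s' EID p = eid p \<and> nats s' OTH p = oth p \<and> nats s' NEXT p = prev (src p) p) \<and>
    (\<forall>v<n. nats s' FIRST v = prev v (2 * k + 1))"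
  let ?body = "link TL HD ;; link HD TL"
  let ?s0 = "seval (nset CNT (NConst 0)) s"
  have "run (For I M ?body) ?s0 (200 * m + 9) (\<lambda>s'. ?Inv m s' \<and> frame (insert I (writes ?body)) ?s0 s')"
  proof (rule run_For_loopfree[where Inv = ?Inv])
    fix k s' assume k: "k < m" "nats s' I 0 = k" and fr: "frame (insert I (writes ?body)) ?s0 s'"
      and inv: "?Inv k s'"
    have eqs: "nats s' TL k = tl k" "nats s' HD k = hd k" "tl k < n" "hd k < n" "tl k \<noteq> hd k"
      using frame_nats[OF fr] s(1) es_V k by (simp_all add: saved_def)
    have e: "eid (Suc (2 * k)) = k" "eid (Suc (Suc (2 * k))) = k" by (simp_all add: eid_def)
    have src: "src (Suc (2 * k)) = tl k" "src (Suc (Suc (2 * k))) = hd k"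
      "oth (Suc (2 * k)) = hd k" "oth (Suc (Suc (2 * k))) = tl k" by (simp_all add: src_def oth_def e)
    let ?s = "nupd I 0 (Suc k) (seval ?body s')"
    have st: "nats ?s CNT 0 = Suc (Suc (2 * k))"
      "nats ?s EID = (nats s' EID)(Suc (2 * k) := k, Suc (Suc (2 * k)) := k)"
      "nats ?s OTH = (nats s' OTH)(Suc (2 * k) := hd k, Suc (Suc (2 * k)) := tl k)"
      "nats ?s NEXT = (nats s' NEXT)(Suc (2 * k) := nats s' FIRST (tl k), Suc (Suc (2 * k)) := nats s' FIRST (hd k))"
      "nats ?s FIRST = (nats s' FIRST)(tl k := Suc (2 * k), hd k := Suc (Suc (2 * k)))"
      using inv k(2) eqs(1,2,5) by (simp_all add: link_def)
    have FIRST: "nats s' FIRST v = prev v (Suc (2 * k))" if "v < n" for v using inv that by simp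
    have old: "nats ?s EID p = eid p \<and> nats ?s OTH p = oth p \<and> nats ?s NEXT p = prev (src p) p"
      if "p \<in> {1..2 * k}" for p
      using inv that unfolding st by simp
    have new: "nats ?s EID p = eid p \<and> nats ?s OTH p = oth p \<and> nats ?s NEXT p = prev (src p) p"
      if "p = Suc (2 * k) \<or> p = Suc (Suc (2 * k))" for p
      using that unfolding st by (elim disjE) (simp_all add: e src FIRST eqs(3-5) del: prev.simps, simp add: src eqs(5))
    have "nats ?s FIRST v = prev v (2 * Suc k + 1)" if "v < n" for v
      unfolding st using FIRST[OF that] eqs(5) by (simp add: src)
    moreover have "{1..2 * Suc k} = {1..2 * k} \<union> {Suc (2 * k), Suc (Suc (2 * k))}" by auto
    ultimately show "?Inv (Suc k) ?s"
      using old new st(1) by (simp only: ball_Un ball_simps mult_Suc_right) simp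
  qed (use s in \<open>simp_all add: saved_def link_def\<close>)
  then have "run (For I M ?body) ?s0 (200 * m + 9) adjacent"
    by (elim run_mono) (auto simp: adjacent_def slots_def)
  then show ?thesis unfolding adjacency_def by (rule run_prefix) simp_all
qed

end

section \<open>Correctness and cost of the search\<close>

locale main = input P Tec n es T w R tl hd +
  isolation "{..<n}" "set es" T "capped n es T w" R CS
  for P Tec n es T w R tl hd CS
begin

text \<open>An edge of the graph of \<open>r\<close> is coded like the element that it stands for: \<open>n + j\<close> codes the
  \<open>j\<close>-th edge and \<open>v < n\<close> codes \<open>{v, z}\<close>.\<close>

definition "tail_of z x = (if x < n then x else tl (x - n))"
definition "head_of z x = (if x < n then z else hd (x - n))"

definition listed :: "nat \<Rightarrow> (nat \<Rightarrow> nat) \<Rightarrow> nat \<Rightarrow> (nat \<Rightarrow> nat) \<Rightarrow> (nat \<Rightarrow> nat) \<Rightarrow> (nat \<Rightarrow> ereal) \<Rightarrow> bool" where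
  "listed z code cc ta ha ea \<longleftrightarrow> (\<forall>c<cc. ta c = tail_of z (code c) \<and> ha c = head_of z (code c) \<and>
     ea c = ereal (\<omega> (decode n es (code c))))"

text \<open>During the search from \<open>r\<close>, mark 1 means reached and mark 2 means removed but adjacent to a reached
  vertex; stamp \<open>Suc r\<close> marks the edges already copied to the graph of \<open>r\<close>.\<close>

definition core :: "nat \<Rightarrow> nat \<Rightarrow> (nat \<Rightarrow> nat) \<Rightarrow> (nat \<Rightarrow> nat) \<Rightarrow> nat \<Rightarrow> (nat \<Rightarrow> nat) \<Rightarrow> (nat \<Rightarrow> nat) \<Rightarrow> nat \<Rightarrow>
    (nat \<Rightarrow> nat) \<Rightarrow> (nat \<Rightarrow> nat) \<Rightarrow> (nat \<Rightarrow> ereal) \<Rightarrow> bool" where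
  "core r z mark que qt stamp code cc ta ha ea \<longleftrightarrow>
     (\<forall>v<n. mark v \<le> 2 \<and> (mark v = 1 \<longrightarrow> v \<in> U r) \<and> (mark v = 2 \<longrightarrow> v \<in> bnd r)) \<and>
     bij_betw que {0..<qt} {v. v < n \<and> mark v = 1} \<and>
     (\<forall>j<m. stamp j \<le> Suc r \<and> (stamp j = Suc r \<longrightarrow> es ! j \<in> E\<^sub>r r)) \<and>
     bij_betw code {0..<cc} ({v. v < n \<and> mark v = 2} \<union> (+) n ` {j. j < m \<and> stamp j = Suc r}) \<and>
     listed z code cc ta ha ea"

lemma core_stamp:
  assumes c: "core r z mark que qt stamp code cc ta ha ea"
    and j: "j < m" "stamp j \<noteq> Suc r" "es ! j \<in> E\<^sub>r r"
  shows "core r z mark que qt (stamp(j := Suc r)) (code(cc := n + j)) (Suc cc)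
    (ta(cc := tl j)) (ha(cc := hd j)) (ea(cc := ereal (\<omega> (Edge (es ! j)))))"
proof -
  have "{v. v < n \<and> mark v = 2} \<union> (+) n ` {i. i < m \<and> (stamp(j := Suc r)) i = Suc r}
      = insert (n + j) ({v. v < n \<and> mark v = 2} \<union> (+) n ` {i. i < m \<and> stamp i = Suc r})"
    using j(1) by auto
  moreover have "bij_betw (code(cc := n + j)) {0..<Suc cc}
      (insert (n + j) ({v. v < n \<and> mark v = 2} \<union> (+) n ` {i. i < m \<and> stamp i = Suc r}))"
    using c j(2) by (intro bij_betw_append) (auto simp: core_def)
  ultimately show ?thesis
    using c j by (simp add: core_def listed_def less_Suc_eq tail_of_def head_of_def decode_def)
qed

lemma core_bnd:
  assumes c: "core r z mark que qt stamp code cc ta ha ea"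
    and v: "v < n" "mark v = 0" "v \<in> bnd r"
  shows "core r z (mark(v := 2)) que qt stamp (code(cc := v)) (Suc cc)
    (ta(cc := v)) (ha(cc := z)) (ea(cc := ereal (\<omega> (Vertex v))))"
proof -
  have "{x. x < n \<and> (mark(v := 2)) x = 2} \<union> (+) n ` {i. i < m \<and> stamp i = Suc r}
      = insert v ({x. x < n \<and> mark x = 2} \<union> (+) n ` {i. i < m \<and> stamp i = Suc r})"
    using v by auto
  moreover have "bij_betw (code(cc := v)) {0..<Suc cc}
      (insert v ({x. x < n \<and> mark x = 2} \<union> (+) n ` {i. i < m \<and> stamp i = Suc r}))"
    using c v by (intro bij_betw_append) (auto simp: core_def)
  moreover have "{x. x < n \<and> (mark(v := 2)) x = 1} = {x. x < n \<and> mark x = 1}" using v by auto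
  ultimately show ?thesis
    using c v by (simp add: core_def listed_def less_Suc_eq tail_of_def head_of_def decode_def)
qed

lemma core_push:
  assumes c: "core r z mark que qt stamp code cc ta ha ea"
    and v: "v < n" "mark v = 0" "v \<in> U r"
  shows "core r z (mark(v := 1)) (que(qt := v)) (Suc qt) stamp code cc ta ha ea"
proof -
  have "{x. x < n \<and> (mark(v := 1)) x = 1} = insert v {x. x < n \<and> mark x = 1}"
    using v by auto
  moreover have "bij_betw (que(qt := v)) {0..<Suc qt} (insert v {x. x < n \<and> mark x = 1})"
    using c v by (intro bij_betw_append) (auto simp: core_def)
  moreover have "{x. x < n \<and> (mark(v := 1)) x = 2} = {x. x < n \<and> mark x = 2}" using v by auto
  ultimately show ?thesis
    using c v by (simp add: core_def)
qed

text \<open>The second alternative is the only excuse for leaving the far end unmarked: it survives,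
  but the edge to it is removed.\<close>

definition scanned :: "nat \<Rightarrow> (nat \<Rightarrow> nat) \<Rightarrow> (nat \<Rightarrow> nat) \<Rightarrow> nat \<Rightarrow> bool" where
  "scanned r mark stamp p \<longleftrightarrow> stamp (eid p) = Suc r \<and>
    (mark (oth p) \<noteq> 0 \<or> Vertex (oth p) \<notin> X\<^sub>0 \<and> Edge (es ! eid p) \<in> X\<^sub>0)"

text \<open>\<open>core\<close> says that marks and stamps are sound. Once all slots of reached
  vertices are scanned, induction along steps that avoid \<open>X\<^sub>0\<close> shows that all of
  \<open>U r\<close> is marked; boundary vertices and edges follow through slots at their end in
  \<open>U r\<close>.\<close>

lemma core_complete:
  assumes c: "core r z mark que qt stamp code cc ta ha ea" and r: "r \<in> R" "mark r = 1"
    and scanned: "\<And>p. p \<in> slots \<Longrightarrow> mark (src p) = 1 \<Longrightarrow> scanned r mark stamp p"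
  shows "{v. v < n \<and> mark v = 1} = U r" "{v. v < n \<and> mark v = 2} = bnd r"
    "{j. j < m \<and> stamp j = Suc r} = {j. j < m \<and> es ! j \<in> E\<^sub>r r}"
proof -
  have U_n: "v < n" if "v \<in> U r" for v using U_D(1)[OF that r(1)] by simp
  have "mark v = 1" if "v \<in> U r" for v
    using that unfolding U_def
  proof (induction rule: reach_induct)
    case refl then show ?case by (rule r(2))
  next
    case (step u v)
    have uv: "{u, v} \<in> set es" "Edge {u, v} \<notin> X\<^sub>0" "v < n" "Vertex v \<notin> X\<^sub>0"
      using step(2) by (auto simp: gstep_def)
    obtain p where p: "p \<in> slots" "src p = u" "oth p = v" "es ! eid p = {u, v}"
      using slot_ex[OF uv(1)] by blast
    have "mark v \<noteq> 0" using scanned[OF p(1)] step(3) p uv by (auto simp: scanned_def)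
    moreover have "mark v \<noteq> 2" using c uv by (auto simp: core_def bnd_def)
    moreover have "mark v \<le> 2" using c uv by (auto simp: core_def)
    ultimately show ?case by linarith
  qed
  then show U: "{v. v < n \<and> mark v = 1} = U r" using c U_n by (auto simp: core_def)
  have m1: "mark v = 1" if "v \<in> U r" for v using U that by blast
  have "v < n \<and> mark v = 2" if "v \<in> bnd r" for v
  proof -
    obtain u where u: "Vertex v \<in> X\<^sub>0" "u \<in> U r" "{u, v} \<in> set es" using \<open>v \<in> bnd r\<close> by (auto simp: bnd_def)
    obtain p where p: "p \<in> slots" "src p = u" "oth p = v" "es ! eid p = {u, v}"
      using slot_ex[OF u(3)] by blast
    have "mark v \<noteq> 0" using scanned[OF p(1)] m1[OF u(2)] p u by (auto simp: scanned_def)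
    moreover have "v < n" using slot_props(4)[OF p(1)] p by simp
    moreover have "mark v \<noteq> 1" using c U_D(2)[of v, OF _ r(1)] u(1) \<open>v < n\<close> by (auto simp: core_def)
    moreover have "mark v \<le> 2" using c \<open>v < n\<close> by (auto simp: core_def)
    ultimately show ?thesis by linarith
  qed
  then show "{v. v < n \<and> mark v = 2} = bnd r" using c by (auto simp: core_def)
  have "stamp j = Suc r" if "j < m" "es ! j \<in> E\<^sub>r r" for j
  proof -
    obtain u where u: "u \<in> es ! j" "u \<in> U r" using \<open>es ! j \<in> E\<^sub>r r\<close> by (auto simp: E\<^sub>r_def)
    obtain p where p: "p \<in> slots" "src p = u" "eid p = j"
      using slot_of_end[OF \<open>j < m\<close> u(1)] by blast
    then show ?thesis using scanned[OF p(1)] m1[OF u(2)] by (simp add: scanned_def)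
  qed
  then show "{j. j < m \<and> stamp j = Suc r} = {j. j < m \<and> es ! j \<in> E\<^sub>r r}" using c by (auto simp: core_def)
qed

definition static :: "nat \<Rightarrow> nat \<Rightarrow> state \<Rightarrow> bool" where
  "static r z s \<longleftrightarrow> saved s \<and> adjacent s \<and> collected X\<^sub>0 s \<and> nats s RC 0 = r \<and> nats s Z 0 = z"

lemma static_frame:
  assumes "static r z s" "frame W s s'"
    "W \<inter> {N, M, TL, HD, EW, TM, VW, RR, EID, OTH, NEXT, FIRST, XV, XE, RC, Z} = {}"
  shows "static r z s'"
  using assms by (simp add: static_def saved_def adjacent_def collected_def frame_def)

definition core_at :: "nat \<Rightarrow> nat \<Rightarrow> state \<Rightarrow> bool" where
  "core_at r z s \<longleftrightarrow> core r z (nats s MARK) (nats s QUE) (nats s QT 0) (nats s STAMP) (nats s CODE)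
     (nats s CC 0) (nats s ''tail'') (nats s ''head'') (weights s ''edge_weight'')"

text \<open>During one search marks and stamps of the current terminal are never taken back and the
  queue only grows, so scanned slots remain scanned.\<close>

definition extends :: "nat \<Rightarrow> state \<Rightarrow> state \<Rightarrow> bool" where
  "extends r s s' \<longleftrightarrow> (\<forall>i. nats s STAMP i = Suc r \<longrightarrow> nats s' STAMP i = Suc r) \<and>
     (\<forall>x. nats s MARK x \<noteq> 0 \<longrightarrow> nats s' MARK x = nats s MARK x) \<and>
     nats s QT 0 \<le> nats s' QT 0 \<and> (\<forall>i<nats s QT 0. nats s' QUE i = nats s QUE i)"

definition scanned_at :: "nat \<Rightarrow> state \<Rightarrow> nat \<Rightarrow> bool" where
  "scanned_at r s p \<longleftrightarrow> scanned r (nats s MARK) (nats s STAMP) p"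

lemma extends_refl: "extends r s s"
  by (simp add: extends_def)

lemma extends_trans: "extends r s s' \<Longrightarrow> extends r s' s'' \<Longrightarrow> extends r s s''"
  unfolding extends_def by (auto dest: order_trans)

lemma extends_scanned: "extends r s s' \<Longrightarrow> scanned_at r s p \<Longrightarrow> scanned_at r s' p"
  unfolding extends_def scanned_at_def scanned_def by metis

lemma stamp_edge_step:
  assumes "static r z s" "core_at r z s" and j: "nats s JJ 0 = j" "j < m" "es ! j \<in> E\<^sub>r r"
  defines "s' \<equiv> seval stamp_edge s"
  shows "core_at r z s'" "extends r s s'" "nats s' STAMP j = Suc r"
proof -
  have st: "nats s RC 0 = r" "nats s TL j = tl j" "nats s HD j = hd j" "nats s N 0 = n"
    "weights s EW j = ereal (\<omega> (Edge (es ! j)))"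
    using assms(1) j by (simp_all add: static_def saved_def)
  have "core_at r z s' \<and> extends r s s' \<and> nats s' STAMP j = Suc r"
  proof (cases "nats s STAMP j = Suc r")
    case True
    then show ?thesis using assms(2) st j by (simp add: s'_def stamp_edge_def extends_refl)
  next
    case False
    have "core_at r z s'"
      using core_stamp[OF assms(2)[unfolded core_at_def] j(2) False j(3)] st j(1) False
      by (simp add: s'_def stamp_edge_def core_at_def)
    then show ?thesis using False st j by (simp add: s'_def stamp_edge_def extends_def)
  qed
  then show "core_at r z s'" "extends r s s'" "nats s' STAMP j = Suc r" by auto
qed

lemma mark_vertex_step:
  assumes "static r z s" "core_at r z s" and j: "nats s JJ 0 = j" "j < m" "es ! j = {u, v}"
    and v: "nats s VV 0 = v" "v < n" and u: "u \<in> U r"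
  defines "s' \<equiv> seval mark_vertex s"
  shows "core_at r z s'" "extends r s s'"
    "nats s' MARK v \<noteq> 0 \<or> Vertex v \<notin> X\<^sub>0 \<and> Edge (es ! j) \<in> X\<^sub>0"
proof -
  have st: "nats s Z 0 = z" "nats s XV v = of_bool (Vertex v \<in> X\<^sub>0)"
    "nats s XE j = of_bool (Edge (es ! j) \<in> X\<^sub>0)" "v \<notin> T \<Longrightarrow> weights s VW v = ereal (\<omega> (Vertex v))"
    using assms(1) j v by (simp_all add: static_def saved_def collected_def)
  have e: "{u, v} \<in> set es" using j nth_mem[of j es] by simp
  consider "nats s MARK v \<noteq> 0" | "nats s MARK v = 0" "Vertex v \<in> X\<^sub>0"
    | "nats s MARK v = 0" "Vertex v \<notin> X\<^sub>0" "Edge (es ! j) \<in> X\<^sub>0"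
    | "nats s MARK v = 0" "Vertex v \<notin> X\<^sub>0" "Edge (es ! j) \<notin> X\<^sub>0" by blast
  then have "core_at r z s' \<and> extends r s s' \<and> (nats s' MARK v \<noteq> 0 \<or> Vertex v \<notin> X\<^sub>0 \<and> Edge (es ! j) \<in> X\<^sub>0)"
  proof cases
    case 1
    then show ?thesis using assms(2) v by (simp add: s'_def mark_vertex_def extends_refl)
  next
    case 2
    have b: "v \<in> bnd r" using 2 u e by (auto simp: bnd_def)
    have "v \<notin> T" using 2(2) T_not_X0 by blast
    have "core_at r z s'"
      using core_bnd[OF assms(2)[unfolded core_at_def] v(2) 2(1) b] st(1,2,4) 2 v \<open>v \<notin> T\<close>
      by (simp add: s'_def mark_vertex_def core_at_def)
    then show ?thesis using 2 st v by (simp add: s'_def mark_vertex_def extends_def)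
  next
    case 3
    then show ?thesis using assms(2) v st j by (simp add: s'_def mark_vertex_def extends_refl)
  next
    case 4
    have "v \<in> U r" using reach_step[of u "{..<n}" "set es" X\<^sub>0 r v] u e 4 v(2) j(3)
      by (auto simp: U_def gstep_def)
    then have "core_at r z s'"
      using core_push[OF assms(2)[unfolded core_at_def] v(2) 4(1)] st 4 v j(1)
      by (simp add: s'_def mark_vertex_def core_at_def)
    then show ?thesis using 4 st v j(1) by (simp add: s'_def mark_vertex_def extends_def)
  qed
  then show "core_at r z s'" "extends r s s'"
    "nats s' MARK v \<noteq> 0 \<or> Vertex v \<notin> X\<^sub>0 \<and> Edge (es ! j) \<in> X\<^sub>0" by auto
qed

lemma seval_frame: "loopfree c \<Longrightarrow> frame (writes c) s (seval c s)"
  by (induction c arbitrary: s) (auto simp: frame_def)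

lemma scan_slot_step:
  assumes s: "static r z s" "core_at r z s" and p: "nats s PP 0 = p" "p \<in> slots" "nats s MARK (src p) = 1"
  defines "s' \<equiv> seval scan_slot s"
  shows "core_at r z s'" "extends r s s'" "scanned_at r s' p" "nats s' PP 0 = prev (src p) p"
proof -
  note sp = slot_props[OF p(2)]
  let ?s1 = "seval (nset JJ (cell EID PP) ;; nset VV (cell OTH PP)) s"
  let ?s2 = "seval stamp_edge ?s1"
  let ?s3 = "seval mark_vertex ?s2"
  have e: "nats s EID p = eid p" "nats s OTH p = oth p" "nats s NEXT p = prev (src p) p"
    using s(1) p(2) by (simp_all add: static_def adjacent_def)
  have s1: "core_at r z ?s1" "static r z ?s1" "nats ?s1 JJ 0 = eid p" "nats ?s1 VV 0 = oth p"
    "extends r s ?s1" "nats ?s1 PP 0 = p"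
    using s p(1) e by (simp_all add: core_at_def static_def saved_def adjacent_def collected_def extends_def)
  have u: "src p \<in> U r" using s(2) p(3) sp(3) by (auto simp: core_at_def core_def)
  have "es ! eid p \<in> E\<^sub>r r" using u sp nth_mem[OF sp(1)] by (auto simp: E\<^sub>r_def)
  note s2 = stamp_edge_step[OF s1(2,1,3) sp(1) this]
  have fr2: "frame (writes stamp_edge) ?s1 ?s2" by (rule seval_frame) (simp add: stamp_edge_def)
  have st2: "static r z ?s2" by (rule static_frame[OF s1(2) fr2]) simp
  have s2': "nats ?s2 JJ 0 = eid p" "nats ?s2 VV 0 = oth p" "nats ?s2 PP 0 = p"
    using frame_nats[OF fr2] s1(3,4,6) by simp_all
  note s3 = mark_vertex_step[OF st2 s2(1) s2'(1) sp(1,2) s2'(2) sp(4) u]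
  have fr3: "frame (writes mark_vertex) ?s2 ?s3" by (rule seval_frame) (simp add: mark_vertex_def)
  have st3: "static r z ?s3" by (rule static_frame[OF st2 fr3]) simp
  have s': "s' = nupd PP 0 (prev (src p) p) ?s3"
  proof -
    have "nats ?s3 PP 0 = p" "nats ?s3 NEXT p = prev (src p) p"
      using frame_nats[OF fr3] s2'(3) st3 p(2) by (simp_all add: static_def adjacent_def)
    then show ?thesis unfolding s'_def scan_slot_def by (simp only: seval.simps nval.simps)
  qed
  show "core_at r z s'" using s3(1) unfolding s' by (simp add: core_at_def)
  have "extends r s ?s3" using extends_trans[OF extends_trans[OF s1(5) s2(2)] s3(2)] .
  then show "extends r s s'" unfolding s' by (simp add: extends_def)
  have "nats ?s3 STAMP (eid p) = Suc r" using s2(3) s3(2) unfolding extends_def by blast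
  then show "scanned_at r s' p" using s3(3) unfolding s' by (simp add: scanned_at_def scanned_def)
  show "nats s' PP 0 = prev (src p) p" unfolding s' by simp
qed

definition deg :: "nat \<Rightarrow> nat" where
  "deg v = card {p \<in> slots. src p = v}"

text \<open>The part of the list of \<open>u\<close> that starts at slot \<open>p\<close>; its size
  is the potential of the loop over the list.\<close>

definition in_list :: "nat \<Rightarrow> nat \<Rightarrow> nat set" where
  "in_list u p = {q \<in> slots. src q = u \<and> q \<le> p}"

lemma finite_slots: "finite slots"
  by (simp add: slots_def)

lemma in_list_prev:
  assumes "p \<in> slots" "src p = u"
  shows "in_list u p = insert p (in_list u (prev u p))" "p \<notin> in_list u (prev u p)"
proof -
  have lt: "prev u p < p"
    using prev_src[of u p] assms(1) by (cases "prev u p = 0") (auto simp: slots_def)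
  then show "p \<notin> in_list u (prev u p)" by (simp add: in_list_def)
  show "in_list u p = insert p (in_list u (prev u p))"
  proof (rule set_eqI)
    fix q
    have "q \<le> prev u p" if "q \<noteq> p" "q \<le> p" "src q = u"
      using prev_gap[of u p q] that by (cases "q \<le> prev u p") simp_all
    then show "q \<in> in_list u p \<longleftrightarrow> q \<in> insert p (in_list u (prev u p))"
      using assms lt by (cases "q = p") (auto simp: in_list_def)
  qed
qed

definition vertex_scanned :: "nat \<Rightarrow> state \<Rightarrow> nat \<Rightarrow> bool" where
  "vertex_scanned r s u \<longleftrightarrow> (\<forall>p\<in>slots. src p = u \<longrightarrow> scanned_at r s p)"

lemma run_scan_list:
  assumes s: "static r z s" "core_at r z s" "nats s PP 0 = prev u (2 * m + 1)" "nats s MARK u = 1"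
  shows "run (While (NLess (NConst 0) (sc PP)) scan_slot) s (300 * deg u + 5)
    (\<lambda>s'. core_at r z s' \<and> extends r s s' \<and> vertex_scanned r s' u)"
proof -
  let ?b = "NLess (NConst 0) (sc PP)"
  let ?I = "\<lambda>s'. core_at r z s' \<and> extends r s s' \<and>
    (nats s' PP 0 = 0 \<or> nats s' PP 0 \<in> slots \<and> src (nats s' PP 0) = u) \<and>
    (\<forall>p\<in>slots. src p = u \<longrightarrow> nats s' PP 0 < p \<longrightarrow> scanned_at r s' p)"
  let ?\<Phi> = "\<lambda>s'. 300 * card (in_list u (nats s' PP 0))"
  have "run (While ?b scan_slot) s (?\<Phi> s + 1 + bcost ?b)
      (\<lambda>s'. ?I s' \<and> \<not> bval ?b s' \<and> frame (writes scan_slot) s s')"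
  proof (rule run_While[where I = ?I and \<Phi> = ?\<Phi>])
    define q where "q = prev u (2 * m + 1)"
    have "q = 0 \<or> q \<in> slots \<and> src q = u"
      using prev_src[of u "2 * m + 1"] unfolding q_def[symmetric] by (auto simp: slots_def)
    moreover have "\<not> q < p" if "p \<in> slots" "src p = u" for p
      using prev_gap[of u "2 * m + 1" p] that unfolding q_def[symmetric] by (auto simp: slots_def)
    moreover have "nats s PP 0 = q" using s(3) q_def by simp
    ultimately show "?I s" using s(2) by (simp add: extends_refl)
  next
    fix s' assume I: "?I s'" and fr: "frame (writes scan_slot) s s'" and b: "bval ?b s'"
    let ?p = "nats s' PP 0"
    have p: "?p \<in> slots" "src ?p = u" using I b by auto
    have st: "static r z s'" by (rule static_frame[OF s(1) fr]) simp
    have "nats s' MARK (src ?p) = 1" using I s(4) p(2) by (simp add: extends_def)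
    note step = scan_slot_step[OF st _ refl p(1) this]
    let ?s = "seval scan_slot s'"
    have c: "core_at r z s'" using I by simp
    have pp: "nats ?s PP 0 = prev u ?p" using step(4)[OF c] p(2) by simp
    have "scanned_at r ?s q" if q: "q \<in> slots" "src q = u" "prev u ?p < q" for q
    proof (cases "q \<le> ?p")
      case True
      then have "q = ?p" using prev_gap[OF q(3)] q(2) by (cases "q = ?p") auto
      then show ?thesis using step(3)[OF c] by simp
    next
      case False
      then show ?thesis using I q extends_scanned[OF step(2)[OF c]] by auto
    qed
    moreover have "extends r s ?s" using I extends_trans step(2)[OF c] by blast
    moreover have "prev u ?p = 0 \<or> prev u ?p \<in> slots \<and> src (prev u ?p) = u"
      using prev_src[of u ?p] p(1) by (auto simp: slots_def)
    ultimately have I': "?I ?s" using step(1)[OF c] by (simp add: pp)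
    have "card (in_list u ?p) = Suc (card (in_list u (prev u ?p)))"
      using in_list_prev[OF p] finite_slots by (simp add: in_list_def)
    \<comment> \<open>One slot costs at most 200 steps, which leaves room for the loop test within
      the 300 units paid by each slot.\<close>
    then have le: "1 + bcost ?b + 200 + ?\<Phi> ?s \<le> ?\<Phi> s'" by (simp add: pp)
    show "\<exists>\<tau>. run scan_slot s' \<tau> (\<lambda>s''. ?I s'' \<and> 1 + bcost ?b + \<tau> + ?\<Phi> s'' \<le> ?\<Phi> s')"
    proof (rule exI[of _ 200], rule run_loopfree)
      show "?I ?s \<and> 1 + bcost ?b + 200 + ?\<Phi> ?s \<le> ?\<Phi> s'" using I' le by blast
    qed (simp_all add: scan_slot_def stamp_edge_def mark_vertex_def)
  qed
  then show ?thesis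
  proof (rule run_mono)
    have "card (in_list u (nats s PP 0)) \<le> deg u"
      unfolding deg_def in_list_def using finite_slots by (intro card_mono) auto
    then show "?\<Phi> s + 1 + bcost ?b \<le> 300 * deg u + 5" by simp
  next
    fix s' assume "?I s' \<and> \<not> bval ?b s' \<and> frame (writes scan_slot) s s'"
    then show "core_at r z s' \<and> extends r s s' \<and> vertex_scanned r s' u"
      by (auto simp: vertex_scanned_def slots_def)
  qed
qed

lemma slot_edge: "p \<in> slots \<Longrightarrow> {src p, oth p} \<in> set es"
  using slot_props(1,2)[of p] nth_mem[of "eid p" es] by simp

text \<open>A slot is determined by its edge and its orientation, so the slots leaving
  \<open>U r\<close> inject into two copies of \<open>E\<^sub>r r\<close>.\<close>

lemma sum_deg: "(\<Sum>v\<in>U r. deg v) \<le> 2 * card (E\<^sub>r r)" if "r \<in> R"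
proof -
  have fin: "finite (U r)" using U_D(1)[OF _ that] by (intro finite_subset[OF _ finite_V]) auto
  have "(\<Sum>v\<in>U r. deg v) = card (\<Union>v\<in>U r. {p \<in> slots. src p = v})"
    unfolding deg_def using fin finite_slots by (intro card_UN_disjoint[symmetric]) auto
  also have "\<dots> = card ((\<lambda>p. (es ! eid p, odd p)) ` (\<Union>v\<in>U r. {p \<in> slots. src p = v}))"
  proof (rule card_image[symmetric], rule inj_onI)
    fix p q assume p: "p \<in> (\<Union>v\<in>U r. {p \<in> slots. src p = v})" and q: "q \<in> (\<Union>v\<in>U r. {p \<in> slots. src p = v})"
      and eq: "(es ! eid p, odd p) = (es ! eid q, odd q)"
    then have pq: "p \<in> slots" "q \<in> slots" by auto
    then have "eid p = eid q"
      using eq slot_props(1) distinct_es by (simp add: nth_eq_iff_index_eq)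
    moreover have "0 < p" "0 < q" "odd p = odd q" using pq eq by (auto simp: slots_def)
    ultimately show "p = q" unfolding eid_def by presburger
  qed
  also have "\<dots> \<le> card (E\<^sub>r r \<times> (UNIV :: bool set))"
  proof (rule card_mono)
    show "finite (E\<^sub>r r \<times> (UNIV :: bool set))" using finite_Er by simp
    show "(\<lambda>p. (es ! eid p, odd p)) ` (\<Union>v\<in>U r. {p \<in> slots. src p = v}) \<subseteq> E\<^sub>r r \<times> UNIV"
      using slot_props(2) slot_edge by (auto simp: E\<^sub>r_def)
  qed
  also have "\<dots> = 2 * card (E\<^sub>r r)" by (simp add: card_cartesian_product)
  finally show ?thesis .
qed

definition searched :: "nat \<Rightarrow> nat \<Rightarrow> state \<Rightarrow> bool" where
  "searched r z s \<longleftrightarrow> core_at r z s \<and> {v. v < n \<and> nats s MARK v = 1} = U r \<and>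
    {v. v < n \<and> nats s MARK v = 2} = bnd r \<and>
    {j. j < m \<and> nats s STAMP j = Suc r} = {j. j < m \<and> es ! j \<in> E\<^sub>r r}"

lemma run_search:
  assumes s: "static r z s" and r: "r \<in> R"
    and init: "\<And>v. v < n \<Longrightarrow> nats s MARK v = 0" "\<And>j. j < m \<Longrightarrow> nats s STAMP j \<le> r"
  shows "run search s (40 * n + 600 * card (E\<^sub>r r) + 60) (searched r z)"
proof -
  let ?init = "NAssign MARK (sc RC) (NConst 1) ;; NAssign QUE (NConst 0) (sc RC) ;;
    nset QH (NConst 0) ;; nset QT (NConst 1) ;; nset CC (NConst 0)"
  let ?s0 = "seval ?init s"
  let ?b = "NLess (sc QH) (sc QT)"
  let ?rest = "\<lambda>s'. U r - nats s' QUE ` {..<nats s' QH 0}"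
  let ?I = "\<lambda>s'. core_at r z s' \<and> nats s' MARK r = 1 \<and> nats s' QH 0 \<le> nats s' QT 0 \<and>
    (\<forall>i<nats s' QH 0. vertex_scanned r s' (nats s' QUE i))"
  \<comment> \<open>Each vertex of \<open>U r\<close> not yet taken from the queue carries 40 units
    for itself and 300 for each of its slots. The queue has no repetitions, so every vertex pays
    once.\<close>
  let ?\<Phi> = "\<lambda>s'. \<Sum>v\<in>?rest s'. 40 + 300 * deg v"
  have finU: "finite (U r)" using U_D(1)[OF _ r] by (intro finite_subset[OF _ finite_V]) auto
  have rn: "r < n" "nats s RC 0 = r" using R_n r s by (auto simp: static_def)
  have s0: "static r z ?s0" using s by (simp add: static_def saved_def adjacent_def collected_def)
  have "run (While ?b scan_vertex) ?s0 (?\<Phi> ?s0 + 1 + bcost ?b)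
      (\<lambda>s'. ?I s' \<and> \<not> bval ?b s' \<and> frame (writes scan_vertex) ?s0 s')"
  proof (rule run_While[where I = ?I and \<Phi> = ?\<Phi>])
    have stamp: "nats s STAMP j \<noteq> Suc r" if "j < m" for j using init(2)[OF that] by simp
    have "core r z (nats s MARK) (nats s QUE) 0 (nats s STAMP) (nats s CODE) 0
        (nats s ''tail'') (nats s ''head'') (weights s ''edge_weight'')"
      unfolding core_def using init(1) le_SucI[OF init(2)] stamp
      by (auto simp: listed_def bij_betw_def)
    from core_push[OF this rn(1)] show "?I ?s0" using init rn by (simp add: core_at_def U_def)
  next
    fix s' assume I: "?I s'" and fr: "frame (writes scan_vertex) ?s0 s'" and b: "bval ?b s'"
    let ?h = "nats s' QH 0"
    let ?u = "nats s' QUE ?h"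
    let ?s1 = "seval (nset PP (NCell FIRST (cell QUE QH)) ;; nset QH (NAdd (sc QH) (NConst 1))) s'"
    have st: "static r z s'" by (rule static_frame[OF s0 fr]) simp
    have bij: "bij_betw (nats s' QUE) {0..<nats s' QT 0} {v. v < n \<and> nats s' MARK v = 1}"
      using I by (simp add: core_at_def core_def)
    have h: "?h < nats s' QT 0" using b by simp
    then have u: "?u < n" "nats s' MARK ?u = 1" using bij_betwE[OF bij] by auto
    have uU: "?u \<in> U r" using u I by (auto simp: core_at_def core_def)
    have s1: "static r z ?s1" "core_at r z ?s1" "nats ?s1 PP 0 = prev ?u (2 * m + 1)" "nats ?s1 MARK ?u = 1"
    proof -
      show "static r z ?s1" by (rule static_frame[OF st seval_frame]) simp_all
      show "core_at r z ?s1" using I by (simp add: core_at_def)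
      show "nats ?s1 PP 0 = prev ?u (2 * m + 1)" using st u(1) by (simp add: static_def adjacent_def)
      show "nats ?s1 MARK ?u = 1" using u by simp
    qed
    show "\<exists>\<tau>. run scan_vertex s' \<tau> (\<lambda>s''. ?I s'' \<and> 1 + bcost ?b + \<tau> + ?\<Phi> s'' \<le> ?\<Phi> s')"
    proof (rule exI[of _ "300 * deg ?u + 30"], unfold scan_vertex_def, rule run_prefix)
      show "run (While (NLess (NConst 0) (sc PP)) scan_slot) ?s1 (300 * deg ?u + 5)
          (\<lambda>s''. ?I s'' \<and> 1 + bcost ?b + (300 * deg ?u + 30) + ?\<Phi> s'' \<le> ?\<Phi> s')"
      proof (rule run_mono[OF run_frame[OF run_scan_list[OF s1]] order_refl])
        fix s'' assume s'': "(core_at r z s'' \<and> extends r ?s1 s'' \<and> vertex_scanned r s'' ?u) \<and>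
          frame (writes (While (NLess (NConst 0) (sc PP)) scan_slot)) ?s1 s''"
        then have fr2: "frame (writes (While (NLess (NConst 0) (sc PP)) scan_slot)) ?s1 s''"
          and ext: "extends r ?s1 s''" and core: "core_at r z s''" and vs: "vertex_scanned r s'' ?u" by auto
        have QH: "nats s'' QH 0 = Suc ?h" using frame_nats[OF fr2] by simp
        have QT: "nats s' QT 0 \<le> nats s'' QT 0" "\<And>i. i < nats s' QT 0 \<Longrightarrow> nats s'' QUE i = nats s' QUE i"
          using ext by (simp_all add: extends_def)
        have old: "vertex_scanned r s'' (nats s' QUE i)" if "i < ?h" for i
        proof -
          have "vertex_scanned r ?s1 (nats s' QUE i)"
            using I that by (simp add: vertex_scanned_def scanned_at_def)
          then show ?thesis using extends_scanned[OF ext] by (simp add: vertex_scanned_def)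
        qed
        have "vertex_scanned r s'' (nats s'' QUE i)" if "i < Suc ?h" for i
          using that h vs old[of i] QT(2)[of i] by (cases "i = ?h") simp_all
        moreover have "nats s'' MARK r = 1" using I ext by (simp add: extends_def)
        ultimately have I'': "?I s''" using core QH QT(1) h by simp
        have "nats s'' QUE ` {..<Suc ?h} = nats s' QUE ` {..<Suc ?h}"
          using QT(2) h by (intro image_cong) auto
        then have rest: "?rest s'' = ?rest s' - {?u}" by (auto simp: QH lessThan_Suc)
        have "?u \<in> ?rest s'"
        proof -
          have "?u \<noteq> nats s' QUE i" if "i < ?h" for i
            using inj_onD[OF bij_betw_imp_inj_on[OF bij], of ?h i] h that by auto
          then have "?u \<notin> nats s' QUE ` {..<?h}" by blast
          then show ?thesis using uU by simp
        qed
        then have "?\<Phi> s' = (40 + 300 * deg ?u) + ?\<Phi> s''"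
          unfolding rest using finU by (intro sum.remove) auto
        then show "?I s'' \<and> 1 + bcost ?b + (300 * deg ?u + 30) + ?\<Phi> s'' \<le> ?\<Phi> s'"
          using I'' by simp
      qed
    qed simp_all
  qed
  then have "run (While ?b scan_vertex) ?s0 (40 * n + 600 * card (E\<^sub>r r) + 10) (searched r z)"
  proof (rule run_mono)
    have "?\<Phi> ?s0 = (\<Sum>v\<in>U r. 40 + 300 * deg v)" by simp
    also have "\<dots> = 40 * card (U r) + 300 * (\<Sum>v\<in>U r. deg v)"
      by (simp only: sum.distrib sum_distrib_left sum_constant mult.commute of_nat_id)
    also have "\<dots> \<le> 40 * n + 300 * (2 * card (E\<^sub>r r))"
    proof (intro add_mono mult_le_mono2 sum_deg[OF r])
      show "card (U r) \<le> n" using card_mono[of "{..<n}" "U r"] U_D(1)[OF _ r] by auto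
    qed
    finally show "?\<Phi> ?s0 + 1 + bcost ?b \<le> 40 * n + 600 * card (E\<^sub>r r) + 10" by simp
  next
    fix s' assume s': "?I s' \<and> \<not> bval ?b s' \<and> frame (writes scan_vertex) ?s0 s'"
    then have I: "?I s'" and eq: "nats s' QH 0 = nats s' QT 0" by auto
    then have core: "core r z (nats s' MARK) (nats s' QUE) (nats s' QT 0) (nats s' STAMP) (nats s' CODE)
     (nats s' CC 0) (nats s' ''tail'') (nats s' ''head'') (weights s' ''edge_weight'')"
      by (simp add: core_at_def)
    then have bij: "bij_betw (nats s' QUE) {0..<nats s' QT 0} {v. v < n \<and> nats s' MARK v = 1}"
      by (simp add: core_def)
    have "scanned r (nats s' MARK) (nats s' STAMP) p" if p: "p \<in> slots" "nats s' MARK (src p) = 1" for p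
    proof -
      \<comment> \<open>The queue is exhausted, so every reached vertex has been taken out and
        scanned.\<close>
      have "src p \<in> {v. v < n \<and> nats s' MARK v = 1}" using p slot_props(3) by simp
      then have "src p \<in> nats s' QUE ` {0..<nats s' QT 0}"
        unfolding bij_betw_imp_surj_on[OF bij] .
      then obtain i where "i < nats s' QT 0" "nats s' QUE i = src p" by auto
      then have "vertex_scanned r s' (src p)" using I eq by metis
      then show ?thesis using p(1) by (simp add: vertex_scanned_def scanned_at_def)
    qed
    from core_complete[OF core r _ this] I show "searched r z s'" by (simp add: searched_def)
  qed
  then show ?thesis unfolding search_def by (rule run_prefix) simp_all
qed

section \<open>The edge list handed to the black box\<close>

definition G_list :: "state \<Rightarrow> nat set list" where
  "G_list s = map (\<lambda>c. {nats s ''tail'' c, nats s ''head'' c}) [0..<nats s CC 0]"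

lemma length_G_list [simp]: "length (G_list s) = nats s CC 0"
  by (simp add: G_list_def)

lemma decode_inj: "inj_on (decode n es) {..<n + m}"
  using distinct_es by (auto simp: inj_on_def decode_def nth_eq_iff_index_eq split: if_splits)

lemma card_Er_index: "card {j. j < m \<and> es ! j \<in> E\<^sub>r r} = card (E\<^sub>r r)"
proof -
  have "(!) es ` {j. j < m \<and> es ! j \<in> E\<^sub>r r} = E\<^sub>r r"
    by (auto simp: E\<^sub>r_def in_set_conv_nth image_iff)
  moreover have "inj_on ((!) es) {j. j < m \<and> es ! j \<in> E\<^sub>r r}"
    using distinct_es by (auto simp: inj_on_def nth_eq_iff_index_eq)
  ultimately show ?thesis using card_image by metis
qed

context
  fixes r z s assumes r: "r \<in> R" and z: "z \<in> R" "z \<noteq> r" and s: "searched r z s"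
begin

text \<open>Positions of the edge list are in bijection with these codes, from which its
  distinctness, its edge set and its length are read off.\<close>

definition "codes = bnd r \<union> (+) n ` {j. j < m \<and> es ! j \<in> E\<^sub>r r}"

lemma code_bij: "bij_betw (nats s CODE) {0..<nats s CC 0} codes"
  using s unfolding searched_def core_at_def core_def codes_def by (elim conjE) (simp only:)

lemma codes_less: "x \<in> codes \<Longrightarrow> x < n + m"
  using bnd_D[OF r z] by (fastforce simp: codes_def)

lemma G_list_nth:
  assumes c: "c < nats s CC 0"
  shows "G_list s ! c \<in> G_edges r z"
    and "back r z (Edge (G_list s ! c)) = decode n es (nats s CODE c)"
    and "weights s ''edge_weight'' c = ereal (\<omega> (decode n es (nats s CODE c)))"
    and "G_list s ! c = {tail_of z (nats s CODE c), head_of z (nats s CODE c)}"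
proof -
  let ?x = "nats s CODE c"
  have l: "nats s ''tail'' c = tail_of z ?x" "nats s ''head'' c = head_of z ?x"
    "weights s ''edge_weight'' c = ereal (\<omega> (decode n es ?x))"
    using s c by (simp_all add: searched_def core_at_def core_def listed_def)
  show G: "G_list s ! c = {tail_of z ?x, head_of z ?x}" using c l by (simp add: G_list_def)
  show "weights s ''edge_weight'' c = ereal (\<omega> (decode n es ?x))" by (rule l)
  have "?x \<in> codes" using bij_betwE[OF code_bij] c by simp
  then consider "?x \<in> bnd r" | j where "?x = n + j" "j < m" "es ! j \<in> E\<^sub>r r" by (auto simp: codes_def)
  then have "G_list s ! c \<in> G_edges r z \<and> back r z (Edge (G_list s ! c)) = decode n es ?x"
  proof cases
    case 1
    then have "G_list s ! c = {?x, z}" "?x < n"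
      using bnd_D[OF r z 1] unfolding G by (simp_all add: tail_of_def head_of_def)
    then show ?thesis using 1 back_bnd[OF r z 1] by (simp add: G_edges_def decode_def)
  next
    case 2
    then have "G_list s ! c = es ! j" unfolding G by (simp add: tail_of_def head_of_def es_nth)
    then show ?thesis using 2 by (simp add: G_edges_def decode_def)
  qed
  then show "G_list s ! c \<in> G_edges r z" "back r z (Edge (G_list s ! c)) = decode n es ?x" by auto
qed

text \<open>Different codes decode to different elements, and \<open>back\<close> recovers the
  element from the edge alone, so the edges differ too.\<close>

lemma distinct_G_list: "distinct (G_list s)"
proof (unfold distinct_conv_nth, intro allI impI)
  fix c d assume cd: "c < length (G_list s)" "d < length (G_list s)" "c \<noteq> d"
  then have "nats s CODE c \<noteq> nats s CODE d"
    using bij_betw_imp_inj_on[OF code_bij] by (auto simp: inj_on_def)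
  moreover have "nats s CODE c < n + m" "nats s CODE d < n + m"
    using bij_betwE[OF code_bij] codes_less cd by auto
  ultimately have "decode n es (nats s CODE c) \<noteq> decode n es (nats s CODE d)"
    using decode_inj by (auto simp: inj_on_def)
  then show "G_list s ! c \<noteq> G_list s ! d" using G_list_nth(2) cd by (metis length_G_list)
qed

lemma set_G_list: "set (G_list s) = G_edges r z"
proof
  show "set (G_list s) \<subseteq> G_edges r z" using G_list_nth(1) by (auto simp: in_set_conv_nth)
  show "G_edges r z \<subseteq> set (G_list s)"
  proof
    fix e assume "e \<in> G_edges r z"
    then obtain x where x: "x \<in> codes" "e = {tail_of z x, head_of z x}"
    proof (unfold G_edges_def, elim UnE imageE, goal_cases)
      case 1
      then obtain j where "j < m" "es ! j = e" by (auto simp: E\<^sub>r_def in_set_conv_nth)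
      then show ?case using 1 by (intro 1(1)[of "n + j"]) (auto simp: codes_def tail_of_def head_of_def es_nth)
    next
      case (2 v)
      then show ?case using bnd_D[OF r z, of v] by (intro 2(1)[of v]) (auto simp: codes_def tail_of_def head_of_def)
    qed
    then have "x \<in> nats s CODE ` {0..<nats s CC 0}"
      unfolding bij_betw_imp_surj_on[OF code_bij] by simp
    then obtain c where "c < nats s CC 0" "nats s CODE c = x" by auto
    then show "e \<in> set (G_list s)" using G_list_nth(4) x(2) by (auto simp: in_set_conv_nth)
  qed
qed

lemma CC_eq: "nats s CC 0 = card (E\<^sub>r r) + card (bnd r)"
proof -
  have "nats s CC 0 = card codes" using bij_betw_same_card[OF code_bij] by simp
  also have "\<dots> = card (bnd r) + card ((+) n ` {j. j < m \<and> es ! j \<in> E\<^sub>r r})"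
    unfolding codes_def using bnd_D[OF r z] finite_bnd[OF r] by (intro card_Un_disjoint) fastforce+
  also have "card ((+) n ` {j. j < m \<and> es ! j \<in> E\<^sub>r r}) = card (E\<^sub>r r)"
    by (simp add: card_image card_Er_index)
  finally show ?thesis by simp
qed

end

end

section \<open>Building and solving a small graph\<close>

context blackbox
begin

abbreviation "POS \<equiv> fresh P 31"
abbreviation "OFF \<equiv> fresh P 32"
abbreviation "OUT \<equiv> fresh P 33"

text \<open>The search has already filled the edge arrays, so only vertex data are missing. The
  single source is entered into the array of sources after the loop.\<close>

definition build_vertex :: com where
  "build_vertex =
    WAssign ''vertex_weight'' (sc I) (wcell VW I) ;;
    NAssign ''A'' (sc I) (NConst 0) ;; NAssign ''B'' (sc I) (NConst 0) ;;
    If (is1 (cell XV I)) (NAssign ''terminal'' (sc I) (NConst 0))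
      (If (is1 (cell MARK I)) (NAssign ''terminal'' (sc I) (cell TM I))
        (NAssign ''terminal'' (sc I) (NConst 1) ;; NAssign ''B'' (sc I) (NConst 1)))"

definition build :: com where
  "build = For I N build_vertex ;; NAssign ''A'' (sc RC) (NConst 1) ;; nset ''n'' (sc N) ;; nset ''m'' (sc CC)"

definition emit :: "nexp \<Rightarrow> com" where
  "emit e = NAssign OUT (sc POS) e ;; nset POS (NAdd (sc POS) (NConst 1))"

text \<open>A code below \<open>n\<close> belongs to the edge from that vertex to the sink. It is
  turned into a vertex mark instead of being printed, since \<open>P\<close> may cut both the vertex
  and that edge while the output must be free of repetitions.\<close>

definition extract_edge :: com where
  "extract_edge = When (is1 (cell ''cut_edge'' I))
    (If (NLess (cell CODE I) (sc N)) (NAssign ''cut_vertex'' (cell CODE I) (NConst 1)) (emit (cell CODE I)))"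

definition extract_vertex :: com where
  "extract_vertex = When (is1 (cell ''cut_vertex'' I)) (emit (sc I))"

definition output_cut :: com where
  "output_cut = For I CC extract_edge ;; For I N extract_vertex"

definition solve :: com where
  "solve = search ;; build ;; P ;; output_cut"

lemma writes_build_vertex [simp]: "writes build_vertex = {''vertex_weight'', ''A'', ''B'', ''terminal''}"
  by (auto simp: build_vertex_def)

lemma writes_build [simp]: "writes build = {I, ''vertex_weight'', ''A'', ''B'', ''terminal'', ''n'', ''m''}"
  by (auto simp: build_def)

lemma writes_extract_edge [simp]: "writes extract_edge = {''cut_vertex'', OUT, POS}"
  by (auto simp: extract_edge_def emit_def)

lemma writes_extract_vertex [simp]: "writes extract_vertex = {OUT, POS}"
  by (auto simp: extract_vertex_def emit_def)

lemma writes_output_cut [simp]: "writes output_cut = {I, ''cut_vertex'', OUT, POS}"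
  by (auto simp: output_cut_def)

lemma writes_solve [simp]:
  "writes solve = writes search \<union> writes build \<union> writes P \<union> writes output_cut"
  by (auto simp: solve_def)

end

context main
begin

definition "G_weight r z x = ereal (\<omega> (back r z x))"

lemma run_build:
  assumes s: "static r z s" "searched r z s" and r: "r \<in> R" and z: "z \<in> R" "z \<noteq> r"
  shows "run build s (200 * n + 60) (\<lambda>s'. stores_instance s' n (G_list s) (G_terms r) (G_weight r z) \<and>
    stores_set s' ''A'' n {r} \<and> stores_set s' ''B'' n (G_sink r))"
proof -
  have mark: "nats s MARK v = 1 \<longleftrightarrow> v \<in> U r" if "v < n" for v
    using s(2) that by (auto simp: searched_def)
  let ?Inv = "\<lambda>k s'. \<forall>v<k. nats s' ''terminal'' v = of_bool (v \<in> G_terms r) \<and>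
    (v \<notin> T \<longrightarrow> weights s' ''vertex_weight'' v = ereal (\<omega> (Vertex v))) \<and>
    nats s' ''A'' v = 0 \<and> nats s' ''B'' v = of_bool (v \<in> G_sink r)"
  have V: "run (For I N build_vertex) s (200 * n + 9)
      (\<lambda>s'. ?Inv n s' \<and> frame (insert I (writes build_vertex)) s s')"
  proof (rule run_For_loopfree[where Inv = ?Inv])
    fix k s' assume k: "k < n" "nats s' I 0 = k" and fr: "frame (insert I (writes build_vertex)) s s'"
      and inv: "?Inv k s'"
    have eqs: "nats s' XV k = of_bool (Vertex k \<in> X\<^sub>0)" "nats s' TM k = of_bool (k \<in> T)"
      "k \<notin> T \<Longrightarrow> weights s' VW k = ereal (\<omega> (Vertex k))" "nats s' MARK k = 1 \<longleftrightarrow> k \<in> U r"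
      using frame_nats[OF fr] frame_weights[OF fr] s(1) k(1) mark[OF k(1)]
      by (simp_all add: static_def saved_def collected_def)
    have T0: "k \<in> T \<Longrightarrow> Vertex k \<notin> X\<^sub>0" by (rule T_not_X0)
    have new: "nats (seval build_vertex s') ''terminal'' k = of_bool (k \<in> G_terms r) \<and>
      (k \<notin> T \<longrightarrow> weights (seval build_vertex s') ''vertex_weight'' k = ereal (\<omega> (Vertex k))) \<and>
      nats (seval build_vertex s') ''A'' k = 0 \<and> nats (seval build_vertex s') ''B'' k = of_bool (k \<in> G_sink r)"
      using k eqs T0 by (simp add: build_vertex_def G_terms_def G_sink_def)
    have old: "nats (seval build_vertex s') a v = nats s' a v"
      "weights (seval build_vertex s') a v = weights s' a v" if "v < k" for v a
      using that k by (simp_all add: build_vertex_def)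
    show "?Inv (Suc k) (nupd I 0 (Suc k) (seval build_vertex s'))"
      using new old inv by (simp add: less_Suc_eq)
  qed (use s in \<open>simp_all add: build_vertex_def static_def saved_def\<close>)
  have "run build s ((200 * n + 9) + 40) (\<lambda>s'. stores_instance s' n (G_list s) (G_terms r) (G_weight r z) \<and>
    stores_set s' ''A'' n {r} \<and> stores_set s' ''B'' n (G_sink r))"
    unfolding build_def
  proof (rule run_Seq[OF V], rule run_loopfree)
    let ?fin = "NAssign ''A'' (sc RC) (NConst 1) ;; nset ''n'' (sc N) ;; nset ''m'' (sc CC)"
    fix s' assume s': "?Inv n s' \<and> frame (insert I (writes build_vertex)) s s'"
    then have fr: "frame (insert I (writes build_vertex)) s s'" by simp
    have eqs: "nats s' RC 0 = r" "nats s' N 0 = n" "nats s' CC = nats s CC" "nats s' ''tail'' = nats s ''tail''"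
      "nats s' ''head'' = nats s ''head''" "weights s' ''edge_weight'' = weights s ''edge_weight''"
      using frame_nats[OF fr] frame_weights[OF fr] s(1) by (simp_all add: static_def saved_def)
    have e: "G_list s ! j = {nats s ''tail'' j, nats s ''head'' j} \<and>
        weights s ''edge_weight'' j = G_weight r z (Edge (G_list s ! j))" if "j < nats s CC 0" for j
      using G_list_nth[OF r z s(2) that] that by (simp add: G_weight_def) (simp add: G_list_def)
    have "v \<notin> T" if "v < n" "v \<notin> G_terms r" for v
      using that T_not_X0 by (auto simp: G_terms_def)
    then show "stores_instance (seval ?fin s') n (G_list s) (G_terms r) (G_weight r z) \<and>
      stores_set (seval ?fin s') ''A'' n {r} \<and> stores_set (seval ?fin s') ''B'' n (G_sink r)"
      using s' eqs e by (simp add: stores_instance_def stores_set_def G_weight_def)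
  qed simp_all
  then show ?thesis by (rule run_mono) simp_all
qed

lemma run_output_cut:
  assumes N: "nats s N 0 = n" and CC: "nats s CC 0 = c0" and POS: "nats s POS 0 = p0"
    and code: "inj_on (nats s CODE) {0..<c0}"
    and cv: "\<And>v. v < n \<Longrightarrow> nats s ''cut_vertex'' v = of_bool (v \<in> CV)"
    and ce: "\<And>c. c < c0 \<Longrightarrow> nats s ''cut_edge'' c = of_bool (c \<in> CE)"
  shows "run output_cut s (200 * n + 200 * c0 + 20) (\<lambda>s'. nats s' POS 0 \<le> p0 + c0 + n \<and> p0 \<le> nats s' POS 0 \<and>
    bij_betw (nats s' OUT) {p0..<nats s' POS 0} (nats s CODE ` {c. c < c0 \<and> c \<in> CE} \<union> {v. v < n \<and> v \<in> CV}) \<and>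
    (\<forall>i<p0. nats s' OUT i = nats s OUT i))"
proof -
  let ?S1 = "\<lambda>k. nats s CODE ` {c. c < k \<and> c \<in> CE}"
  \<comment> \<open>Only codes of original edges, which are at least \<open>n\<close>, have been
    printed so far; boundary vertices are pending as vertex marks.\<close>
  let ?EI = "\<lambda>k s'. nats s' POS 0 \<le> p0 + k \<and> p0 \<le> nats s' POS 0 \<and>
    bij_betw (nats s' OUT) {p0..<nats s' POS 0} {x \<in> ?S1 k. n \<le> x} \<and>
    (\<forall>i<p0. nats s' OUT i = nats s OUT i) \<and>
    (\<forall>v<n. nats s' ''cut_vertex'' v = of_bool (v \<in> CV \<or> v \<in> ?S1 k))"
  have E: "run (For I CC extract_edge) s (200 * c0 + 9) (\<lambda>s'. ?EI c0 s' \<and> frame (insert I (writes extract_edge)) s s')"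
  proof (rule run_For_loopfree[where Inv = ?EI])
    fix k s' assume k: "k < c0" "nats s' I 0 = k" and fr: "frame (insert I (writes extract_edge)) s s'"
      and inv: "?EI k s'"
    have eqs: "nats s' ''cut_edge'' k = of_bool (k \<in> CE)" "nats s' CODE = nats s CODE" "nats s' N 0 = n"
      using frame_nats[OF fr] ce k(1) N by simp_all
    let ?x = "nats s CODE k"
    show "?EI (Suc k) (nupd I 0 (Suc k) (seval extract_edge s'))"
    proof (cases "k \<in> CE")
      case False
      then have "{c. c < Suc k \<and> c \<in> CE} = {c. c < k \<and> c \<in> CE}" using less_Suc_eq by auto
      then show ?thesis using inv k False eqs by (simp add: extract_edge_def)
    next
      case True
      then have S: "?S1 (Suc k) = insert ?x (?S1 k)" by (auto simp: less_Suc_eq)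
      have nin: "?x \<notin> ?S1 k" using inj_onD[OF code, of k] k(1) by fastforce
      show ?thesis
      proof (cases "?x < n")
        case True
        then have "{x \<in> insert ?x (?S1 k). n \<le> x} = {x \<in> ?S1 k. n \<le> x}" by auto
        then show ?thesis using inv k \<open>k \<in> CE\<close> eqs True unfolding S by (simp add: extract_edge_def)
      next
        case False
        then have "{x \<in> insert ?x (?S1 k). n \<le> x} = insert ?x {x \<in> ?S1 k. n \<le> x}" by auto
        moreover have "bij_betw ((nats s' OUT)(nats s' POS 0 := ?x)) {p0..<Suc (nats s' POS 0)}
            (insert ?x {x \<in> ?S1 k. n \<le> x})"
          using inv nin by (intro bij_betw_append) auto
        ultimately show ?thesis using inv k \<open>k \<in> CE\<close> eqs False unfolding S
          by (simp add: extract_edge_def emit_def)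
      qed
    qed
  qed (use POS CC cv in \<open>simp_all add: extract_edge_def emit_def bij_betw_def\<close>)
  have "run output_cut s ((200 * c0 + 9) + (200 * n + 9)) (\<lambda>s'. nats s' POS 0 \<le> p0 + c0 + n \<and> p0 \<le> nats s' POS 0 \<and>
    bij_betw (nats s' OUT) {p0..<nats s' POS 0} (?S1 c0 \<union> {v. v < n \<and> v \<in> CV}) \<and>
    (\<forall>i<p0. nats s' OUT i = nats s OUT i))"
    unfolding output_cut_def
  proof (rule run_Seq[OF E])
    fix s1 assume s1: "?EI c0 s1 \<and> frame (insert I (writes extract_edge)) s s1"
    then have fr1: "frame (insert I (writes extract_edge)) s s1" by simp
    let ?S2 = "\<lambda>k. {x \<in> ?S1 c0. n \<le> x} \<union> {v. v < k \<and> (v \<in> CV \<or> v \<in> ?S1 c0)}"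
    let ?VI = "\<lambda>k s'. nats s' POS 0 \<le> p0 + c0 + k \<and> p0 \<le> nats s' POS 0 \<and>
      bij_betw (nats s' OUT) {p0..<nats s' POS 0} (?S2 k) \<and>
      (\<forall>i<p0. nats s' OUT i = nats s OUT i)"
    have V: "run (For I N extract_vertex) s1 (200 * n + 9)
        (\<lambda>s'. ?VI n s' \<and> frame (insert I (writes extract_vertex)) s1 s')"
    proof (rule run_For_loopfree[where Inv = ?VI])
      show "?VI 0 (nupd I 0 0 s1)" using s1 by simp
    next
      fix k s' assume k: "k < n" "nats s' I 0 = k" and fr: "frame (insert I (writes extract_vertex)) s1 s'"
        and inv: "?VI k s'"
      have eqs: "nats s' ''cut_vertex'' k = of_bool (k \<in> CV \<or> k \<in> ?S1 c0)"
        using frame_nats[OF fr] s1 k(1) by simp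
      show "?VI (Suc k) (nupd I 0 (Suc k) (seval extract_vertex s'))"
      proof (cases "k \<in> CV \<or> k \<in> ?S1 c0")
        case True
        then have "?S2 (Suc k) = insert k (?S2 k)" by (auto simp: less_Suc_eq)
        moreover have "bij_betw ((nats s' OUT)(nats s' POS 0 := k)) {p0..<Suc (nats s' POS 0)} (insert k (?S2 k))"
          using inv k(1) by (intro bij_betw_append) auto
        moreover have "nats (nupd I 0 (Suc k) (seval extract_vertex s')) POS 0 = Suc (nats s' POS 0)"
          "nats (nupd I 0 (Suc k) (seval extract_vertex s')) OUT = (nats s' OUT)(nats s' POS 0 := k)"
          using True eqs k(2) by (simp_all add: extract_vertex_def emit_def)
        ultimately show ?thesis using inv by simp
      next
        case False
        then have "?S2 (Suc k) = ?S2 k" by (auto simp: less_Suc_eq)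
        moreover have "nats (nupd I 0 (Suc k) (seval extract_vertex s')) POS 0 = nats s' POS 0"
          "nats (nupd I 0 (Suc k) (seval extract_vertex s')) OUT = nats s' OUT"
          using False eqs k(2) by (simp_all add: extract_vertex_def emit_def)
        ultimately show ?thesis using inv by simp
      qed
    qed (use N frame_nats[OF fr1] in \<open>simp_all add: extract_vertex_def emit_def\<close>)
    have "?S2 n = ?S1 c0 \<union> {v. v < n \<and> v \<in> CV}" by (auto simp: not_less)
    then show "run (For I N extract_vertex) s1 (200 * n + 9) (\<lambda>s'. nats s' POS 0 \<le> p0 + c0 + n \<and> p0 \<le> nats s' POS 0 \<and>
        bij_betw (nats s' OUT) {p0..<nats s' POS 0} (?S1 c0 \<union> {v. v < n \<and> v \<in> CV}) \<and>
        (\<forall>i<p0. nats s' OUT i = nats s OUT i))"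
      by (intro run_mono[OF V]) simp_all
  qed
  then show ?thesis by (rule run_mono) simp_all
qed

definition "G_size r = card (E\<^sub>r r) + card (bnd r)"

lemma card_G_edges:
  assumes r: "r \<in> R" and z: "z \<in> R" "z \<noteq> r"
  shows "card (G_edges r z) = G_size r"
proof -
  have "inj_on (\<lambda>v. {v, z}) (bnd r)"
    by (auto simp: inj_on_def doubleton_eq_iff)
  then show ?thesis
    unfolding G_edges_def G_size_def using finite_Er finite_bnd[OF r] bnd_edge[OF r z]
    by (subst card_Un_disjoint) (auto simp: card_image)
qed

lemma G_ec_instance:
  assumes "r \<in> R" "z \<in> R" "z \<noteq> r"
  shows "ec_instance {..<n} (G_edges r z) (G_terms r) (G_weight r z)"
proof -
  interpret G: weighted_instance "{..<n}" "G_edges r z" "G_terms r" "\<omega> \<circ> back r z"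
    by (rule G_instance[OF assms])
  show ?thesis using G.finite_V G.edges G.T_V G.pos by (auto simp: ec_instance_def G_weight_def)
qed

text \<open>The lower bound on \<open>Tec\<close>, applied to the small graph, pays for building it
  and for printing its cut.\<close>

lemma Tec_G_size:
  assumes "r \<in> R" "z \<in> R" "z \<noteq> r"
  shows "n + G_size r \<le> Tec (G_size r) n"
proof -
  have "finite (G_edges r z)"
    using finite_Er finite_bnd[OF assms(1)] by (simp add: G_edges_def)
  then obtain gs where gs: "set gs = G_edges r z" "distinct gs" using finite_distinct_list by blast
  then have "length gs = G_size r" using card_G_edges[OF assms] distinct_card[OF gs(2)] by simp
  then show ?thesis using Tec_ge[OF P, of n gs] G_ec_instance[OF assms] gs by metis
qed

lemma run_solve:
  assumes s: "static r z s" and r: "r \<in> R" and z: "z \<in> R" "z \<noteq> r"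
    and init: "\<And>v. v < n \<Longrightarrow> nats s MARK v = 0" "\<And>j. j < m \<Longrightarrow> nats s STAMP j \<le> r"
    and POS: "nats s POS 0 = p0"
  shows "run solve s (500 * n + 1000 * G_size r + Tec (G_size r) n + 200) (\<lambda>s'. \<exists>S. S \<subseteq> {..<n + m} \<and>
    min_element_cut {..<n} (set es) T w {r} (R - {r}) (decode n es ` S) \<and>
    nats s' POS 0 \<le> p0 + G_size r + n \<and> p0 \<le> nats s' POS 0 \<and>
    bij_betw (nats s' OUT) {p0..<nats s' POS 0} S \<and>
    (\<forall>i<p0. nats s' OUT i = nats s OUT i) \<and> (\<forall>j<m. nats s' STAMP j \<le> Suc r))"
  (is "run solve s _ ?Q")
proof -
  interpret G: weighted_instance "{..<n}" "G_edges r z" "G_terms r" "\<omega> \<circ> back r z"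
    by (rule G_instance[OF r z])
  have Ginst: "ec_instance {..<n} (G_edges r z) (G_terms r) (G_weight r z)"
    by (rule G_ec_instance[OF r z])
  have sets: "{r} \<subseteq> G_terms r" "G_sink r \<subseteq> G_terms r" "{r} \<inter> G_sink r = {}"
    using r R_sub R_n T_not_X0 by (auto simp: G_terms_def G_sink_def U_def)
  have search: "run search s (40 * n + 600 * card (E\<^sub>r r) + 60) (searched r z)"
    using run_search[OF s r] init by blast
  have total: "run solve s ((40 * n + 600 * card (E\<^sub>r r) + 60) + ((200 * n + 60) + (Tec (G_size r) n +
      (200 * n + 200 * G_size r + 20)))) ?Q"
    unfolding solve_def
  proof (rule run_Seq[OF search])
    fix s1 assume s1: "searched r z s1" and fr1: "frame (writes search) s s1"
    have st1: "static r z s1" by (rule static_frame[OF s fr1]) simp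
    note set_G [simp] = set_G_list[OF r z s1]
    have len: "length (G_list s1) = G_size r" using CC_eq[OF r z s1] by (simp add: G_size_def)
    show "run (build ;; P ;; output_cut) s1 ((200 * n + 60) + (Tec (G_size r) n + (200 * n + 200 * G_size r + 20))) ?Q"
    proof (rule run_Seq[OF run_build[OF st1 s1 r z]], elim conjE)
      fix s2 assume s2: "stores_instance s2 n (G_list s1) (G_terms r) (G_weight r z)"
        "stores_set s2 ''A'' n {r}" "stores_set s2 ''B'' n (G_sink r)" and fr2: "frame (writes build) s1 s2"
      have P2: "run P s2 (Tec (G_size r) n)
          (\<lambda>s'. \<exists>Y. min_element_cut {..<n} (G_edges r z) (G_terms r) (G_weight r z) {r} (G_sink r) Y \<and>
            stores_cut s' n (G_list s1) Y)"
        using run_P[OF _ distinct_G_list[OF r z s1] sets s2] Ginst len by simp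
      show "run (P ;; output_cut) s2 (Tec (G_size r) n + (200 * n + 200 * G_size r + 20)) ?Q"
      proof (rule run_Seq[OF P2], elim exE conjE)
        fix s3 Y assume Y: "min_element_cut {..<n} (G_edges r z) (G_terms r) (G_weight r z) {r} (G_sink r) Y"
          "stores_cut s3 n (G_list s1) Y" and fr3: "frame (writes P) s2 s3"
        let ?CV = "{v. Vertex v \<in> Y}" and ?CE = "{c. Edge (G_list s1 ! c) \<in> Y}"
        have eqs: "nats s3 CODE = nats s1 CODE" "nats s3 CC = nats s1 CC" "nats s3 POS 0 = p0"
          "nats s3 OUT = nats s OUT" "nats s3 STAMP = nats s1 STAMP" "nats s3 N 0 = n"
          using frame_nats[OF fr1] frame_nats[OF fr2] frame_nats[OF fr3] POS st1
          by (simp_all add: static_def saved_def)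
        have code: "inj_on (nats s3 CODE) {0..<G_size r}"
          using bij_betw_imp_inj_on[OF code_bij[OF r z s1]] CC_eq[OF r z s1] by (simp add: eqs G_size_def)
        let ?S = "nats s3 CODE ` {c. c < G_size r \<and> c \<in> ?CE} \<union> {v. v < n \<and> v \<in> ?CV}"
        have "run output_cut s3 (200 * n + 200 * G_size r + 20) (\<lambda>s'. nats s' POS 0 \<le> p0 + G_size r + n \<and> p0 \<le> nats s' POS 0 \<and>
          bij_betw (nats s' OUT) {p0..<nats s' POS 0} ?S \<and> (\<forall>i<p0. nats s' OUT i = nats s3 OUT i))"
          using Y(2) CC_eq[OF r z s1] len
          by (intro run_output_cut code) (simp_all add: eqs stores_cut_def G_size_def)
        then show "run output_cut s3 (200 * n + 200 * G_size r + 20) ?Q"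
        proof (rule run_mono[OF run_frame order_refl], elim conjE)
          fix s4 assume s4: "nats s4 POS 0 \<le> p0 + G_size r + n" "p0 \<le> nats s4 POS 0"
            "bij_betw (nats s4 OUT) {p0..<nats s4 POS 0} ?S" "\<forall>i<p0. nats s4 OUT i = nats s3 OUT i"
            and fr4: "frame (writes output_cut) s3 s4"
          have Ye: "Y \<subseteq> elements {..<n} (G_edges r z) (G_terms r)"
            using Y(1) by (simp add: min_element_cut_def element_cut_def)
          have nth: "back r z (Edge (G_list s1 ! c)) = decode n es (nats s3 CODE c)" "nats s3 CODE c < n + m"
            if "c < G_size r" for c
            using G_list_nth(2)[OF r z s1, of c] that CC_eq[OF r z s1] codes_less[OF r z s1]
              bij_betwE[OF code_bij[OF r z s1]] by (simp_all add: eqs G_size_def)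
          \<comment> \<open>Each position of the edge list decodes to the element that
            \<open>back\<close> assigns to its edge, so the printed codes describe the image of the
            cut found by \<open>P\<close>.\<close>
          have "decode n es ` ?S = back r z ` Y"
          proof
            show "decode n es ` ?S \<subseteq> back r z ` Y"
            proof (rule image_subsetI, elim UnE imageE CollectE conjE)
              fix x c assume "x = nats s3 CODE c" "c < G_size r" "Edge (G_list s1 ! c) \<in> Y"
              then show "decode n es x \<in> back r z ` Y" using nth(1) by (metis imageI)
            next
              fix v assume "v < n" "Vertex v \<in> Y"
              then show "decode n es v \<in> back r z ` Y"
                by (intro rev_image_eqI[of "Vertex v"]) (simp_all add: decode_def)
            qed
            show "back r z ` Y \<subseteq> decode n es ` ?S"
            proof (rule image_subsetI)
              fix y assume y: "y \<in> Y"
              show "back r z y \<in> decode n es ` ?S"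
              proof (cases y)
                case (Vertex v)
                then have "v < n" using Ye y by (auto simp: elements_def)
                then show ?thesis using Vertex y
                  by (intro rev_image_eqI[of v]) (simp_all add: decode_def)
              next
                case (Edge e)
                then have "e \<in> set (G_list s1)" using Ye y by (auto simp: elements_def)
                then obtain c where c: "c < G_size r" "G_list s1 ! c = e"
                  using len unfolding in_set_conv_nth by auto
                then show ?thesis using nth(1)[OF c(1)] Edge y
                  by (intro rev_image_eqI[of "nats s3 CODE c"]) auto
              qed
            qed
          qed
          moreover have "min_cut {r} (R - {r}) (back r z ` Y)"
            using G_min_cut[OF r z] Y(1) G.min_element_cut_iff[of "G_weight r z"] by (simp add: G_weight_def)
          then have "min_element_cut {..<n} (set es) T w {r} (R - {r}) (back r z ` Y)"
            using cap_min_cut[OF inst big_pos] by (simp add: big_def)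
          moreover have "?S \<subseteq> {..<n + m}" using nth(2) by auto
          moreover have "nats s4 STAMP j \<le> Suc r" if "j < m" for j
            using s1 that frame_nats[OF fr4] by (simp add: eqs searched_def core_at_def core_def)
          ultimately show "?Q s4" using s4 by (intro exI[of _ ?S]) (simp add: eqs)
        qed
      qed
    qed
  qed
  have "card (E\<^sub>r r) \<le> G_size r" by (simp add: G_size_def)
  then show ?thesis by (intro run_mono[OF total]) simp_all
qed

end

section \<open>All terminals in turn, and the output\<close>

context blackbox
begin

abbreviation "N1 \<equiv> fresh P 37"

text \<open>Clears the marks at a cost linear in \<open>n\<close>, which is affordable for each
  terminal, and chooses the sink. \<open>Z\<close> keeps its initial value \<open>n\<close> if
  \<open>R\<close> has no other terminal.\<close>

definition find_other :: com where
  "find_other = NAssign MARK (sc I) (NConst 0) ;;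
    When (BAnd (is1 (cell RR I)) (BNot (NEq (sc I) (sc RC)))) (nset Z (sc I))"

definition isolate :: com where
  "isolate = nset Z (sc N) ;; For I N find_other ;; If (NLess (sc Z) (sc N)) solve Skip"

text \<open>An offset is recorded after every vertex, also outside \<open>R\<close>, because the
  output convention wants offsets to be monotone over all vertices.\<close>

definition isolate_all :: com where
  "isolate_all = (nset POS (NConst 0) ;; NAssign OFF (NConst 0) (NConst 0)) ;;
    For RC N (If (is1 (cell RR RC)) isolate Skip ;; NAssign OFF (NAdd (sc RC) (NConst 1)) (sc POS))"

text \<open>Results are buffered in fresh arrays and copied at the very end, as a later call of
  \<open>P\<close> might overwrite the output arrays. There are \<open>n + 1\<close>
  offsets.\<close>

definition copy_output :: com where
  "copy_output = nset N1 (NAdd (sc N) (NConst 1)) ;;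
    For I N1 (NAssign ''offset'' (sc I) (cell OFF I)) ;;
    For I POS (NAssign ''cuts'' (sc I) (cell OUT I))"

definition isolating_cuts :: com where
  "isolating_cuts =
    save ;; cap_weights ;; index ;; rounds ;; adjacency ;; isolate_all ;; copy_output"

lemma writes_find_other [simp]: "writes find_other = {MARK, Z}"
  by (auto simp: find_other_def)

lemma writes_isolate [simp]: "writes isolate = {Z, I, MARK} \<union> writes solve"
  by (auto simp: isolate_def)

lemma writes_isolate_all [simp]: "writes isolate_all = {POS, OFF, RC} \<union> writes isolate"
  by (auto simp: isolate_all_def)

end

context main
begin

text \<open>If \<open>R = {r}\<close>, the empty cut is output without calling \<open>P\<close>, so
  this terminal is charged as an edgeless graph.\<close>

definition "gs r = (if R = {r} then 0 else G_size r)"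

lemma Tec_gs:
  assumes "r \<in> R"
  shows "n + gs r \<le> Tec (gs r) n"
proof (cases "R = {r}")
  case True
  have "ec_instance {..<n} (set []) T w" using inst by (auto simp: ec_instance_def elements_def)
  moreover have "gs r = 0" unfolding gs_def using True by (rule if_P)
  ultimately show ?thesis using Tec_ge[OF P, of n "[]"] by simp
next
  case False
  then obtain z where "z \<in> R" "z \<noteq> r" using assms by blast
  then show ?thesis using Tec_G_size[OF assms] False by (simp add: gs_def)
qed

lemma sum_gs: "(\<Sum>r\<in>R. gs r) \<le> 2 * m"
proof -
  have "(\<Sum>r\<in>R. gs r) \<le> (\<Sum>r\<in>R. card (E\<^sub>r r) + card (bnd r))"
    by (intro sum_mono) (simp add: gs_def G_size_def)
  also have "\<dots> \<le> 2 * m" using sum_G_edges distinct_es by (simp add: distinct_card)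
  finally show ?thesis .
qed

lemma min_cut_trivial:
  assumes "r \<in> T"
  shows "min_element_cut {..<n} (set es) T w {r} {} {}"
proof -
  have "0 \<le> sum w Y" if "element_cut {..<n} (set es) T {r} {} Y" for Y
    using that inst by (intro sum_nonneg) (auto simp: element_cut_def ec_instance_def less_imp_le)
  then show ?thesis by (auto simp: min_element_cut_def element_cut_def)
qed

lemma run_isolate:
  assumes s: "saved s" "adjacent s" "collected X\<^sub>0 s" "nats s RC 0 = r" and r: "r \<in> R"
    and stamp: "\<And>j. j < m \<Longrightarrow> nats s STAMP j \<le> r" and POS: "nats s POS 0 = p0"
  shows "run isolate s (800 * n + 1000 * gs r + Tec (gs r) n + 300) (\<lambda>s'. \<exists>S. S \<subseteq> {..<n + m} \<and>
    min_element_cut {..<n} (set es) T w {r} (R - {r}) (decode n es ` S) \<and>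
    nats s' POS 0 \<le> p0 + gs r + n \<and> p0 \<le> nats s' POS 0 \<and>
    bij_betw (nats s' OUT) {p0..<nats s' POS 0} S \<and>
    (\<forall>i<p0. nats s' OUT i = nats s OUT i) \<and> (\<forall>j<m. nats s' STAMP j \<le> Suc r))"
  (is "run isolate s _ ?Q")
proof -
  let ?s0 = "seval (nset Z (sc N)) s"
  let ?Inv = "\<lambda>k s'. (\<forall>v<k. nats s' MARK v = 0) \<and>
    (if \<exists>v<k. v \<in> R - {r} then nats s' Z 0 \<in> R - {r} else nats s' Z 0 = n)"
  have N0: "nats s N 0 = n" using s by (simp add: saved_def)
  have loop: "run (For I N find_other) ?s0 (200 * n + 9)
      (\<lambda>s'. ?Inv n s' \<and> frame (insert I (writes find_other)) ?s0 s')"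
  proof (rule run_For_loopfree[where Inv = ?Inv])
    fix k s' assume k: "k < n" "nats s' I 0 = k" and fr: "frame (insert I (writes find_other)) ?s0 s'"
      and inv: "?Inv k s'"
    have eqs: "nats s' RR k = of_bool (k \<in> R)" "nats s' RC 0 = r"
      using frame_nats[OF fr] s k(1) by (simp_all add: saved_def)
    show "?Inv (Suc k) (nupd I 0 (Suc k) (seval find_other s'))"
    proof (cases "k \<in> R - {r}")
      case True
      then have "\<exists>v<Suc k. v \<in> R - {r}" by blast
      then show ?thesis using inv k eqs True by (simp add: find_other_def less_Suc_eq)
    next
      case False
      then have ex: "(\<exists>v<Suc k. v \<in> R - {r}) \<longleftrightarrow> (\<exists>v<k. v \<in> R - {r})" by (auto simp: less_Suc_eq)
      have Z: "nats (nupd I 0 (Suc k) (seval find_other s')) Z 0 = nats s' Z 0"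
        and MARK: "\<forall>v<Suc k. nats (nupd I 0 (Suc k) (seval find_other s')) MARK v = 0"
        using inv k eqs False by (auto simp: find_other_def less_Suc_eq)
      show ?thesis
        by (rule conjI[OF MARK], unfold ex Z) (rule conjunct2[OF inv])
    qed
  qed (use N0 in \<open>simp_all add: find_other_def\<close>)
  have "run (For I N find_other ;; If (NLess (sc Z) (sc N)) solve Skip) ?s0
      ((200 * n + 9) + (500 * n + 1000 * gs r + Tec (gs r) n + 220)) ?Q"
  proof (rule run_Seq[OF loop])
    fix s1 assume s1: "?Inv n s1 \<and> frame (insert I (writes find_other)) ?s0 s1"
    then have fr: "frame (insert I (writes find_other)) ?s0 s1" by simp
    have st: "static r (nats s1 Z 0) s1"
      using frame_nats[OF fr] frame_weights[OF fr] s
      by (simp add: static_def saved_def adjacent_def collected_def)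
    have eqs: "nats s1 N 0 = n" "nats s1 POS 0 = p0" "nats s1 OUT = nats s OUT" "nats s1 STAMP = nats s STAMP"
      using frame_nats[OF fr] N0 POS by simp_all
    have ex: "(\<exists>v<n. v \<in> R - {r}) \<longleftrightarrow> R \<noteq> {r}" using R_n r by blast
    show "run (If (NLess (sc Z) (sc N)) solve Skip) s1 (500 * n + 1000 * gs r + Tec (gs r) n + 220) ?Q"
    proof (cases "R = {r}")
      case True
      then have Zn: "nats s1 Z 0 = n" using s1 ex by presburger
      have empty: "R - {r} = {}" using True by blast
      have "\<forall>j<m. nats s1 STAMP j \<le> Suc r" using le_SucI[OF stamp] by (simp add: eqs)
      moreover have "min_element_cut {..<n} (set es) T w {r} (R - {r}) (decode n es ` {})"
        unfolding empty image_empty using r R_sub by (intro min_cut_trivial) blast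
      ultimately have "?Q s1"
        by (intro exI[of _ "{}"]) (simp add: eqs bij_betw_def)
      then have "run Skip s1 1 ?Q" by (intro run_loopfree) simp_all
      then show ?thesis by (rule run_If_False[rotated]) (simp_all add: eqs Zn)
    next
      case False
      then have z: "nats s1 Z 0 \<in> R" "nats s1 Z 0 \<noteq> r" using s1 ex by auto
      have "run solve s1 (500 * n + 1000 * gs r + Tec (gs r) n + 200) ?Q"
        using run_solve[OF st r z _ _ eqs(2)] s1 stamp False by (simp add: eqs gs_def)
      then show ?thesis by (rule run_If_True[rotated]) (use R_n z in \<open>simp_all add: eqs\<close>)
    qed
  qed
  then have "run isolate s (700 * n + 1000 * gs r + Tec (gs r) n + 240) ?Q"
    unfolding isolate_def by (rule run_prefix) simp_all
  then show ?thesis by (rule run_mono) simp_all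
qed

text \<open>The bound on \<open>POS\<close> limits the length of the output and thereby the cost of
  copying it.\<close>

definition isolated :: "nat \<Rightarrow> state \<Rightarrow> bool" where
  "isolated k s \<longleftrightarrow> (\<forall>v<k. nats s OFF v \<le> nats s OFF (Suc v)) \<and> (\<forall>v\<le>k. nats s OFF v \<le> nats s POS 0) \<and>
    nats s OFF k = nats s POS 0 \<and>
    nats s POS 0 \<le> (\<Sum>r\<in>{r \<in> R. r < k}. gs r + n) \<and>
    (\<forall>r\<in>R. r < k \<longrightarrow> (\<exists>S. S \<subseteq> {..<n + m} \<and>
      min_element_cut {..<n} (set es) T w {r} (R - {r}) (decode n es ` S) \<and>
      bij_betw (nats s OUT) {nats s OFF r..<nats s OFF (Suc r)} S))"

text \<open>Earlier segments end at or before the old \<open>POS\<close>, and cells below it are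
  left alone.\<close>

lemma isolated_Suc:
  assumes k: "isolated k s" and s': "nats s' OFF = (nats s OFF)(Suc k := nats s' POS 0)"
    "nats s POS 0 \<le> nats s' POS 0" "\<forall>i<nats s POS 0. nats s' OUT i = nats s OUT i"
    and le: "nats s' POS 0 \<le> nats s POS 0 + (if k \<in> R then gs k + n else 0)"
    and new: "k \<in> R \<Longrightarrow> \<exists>S. S \<subseteq> {..<n + m} \<and>
      min_element_cut {..<n} (set es) T w {k} (R - {k}) (decode n es ` S) \<and>
      bij_betw (nats s' OUT) {nats s POS 0..<nats s' POS 0} S"
  shows "isolated (Suc k) s'"
proof -
  have sum: "(\<Sum>r\<in>{r \<in> R. r < Suc k}. gs r + n) = (\<Sum>r\<in>{r \<in> R. r < k}. gs r + n) + (if k \<in> R then gs k + n else 0)"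
  proof (cases "k \<in> R")
    case True
    then have "{r \<in> R. r < Suc k} = insert k {r \<in> R. r < k}" by auto
    then show ?thesis using True by simp
  next
    case False
    then have "{r \<in> R. r < Suc k} = {r \<in> R. r < k}" by (auto simp: less_Suc_eq)
    then show ?thesis using False by simp
  qed
  have "\<exists>S. S \<subseteq> {..<n + m} \<and> min_element_cut {..<n} (set es) T w {r} (R - {r}) (decode n es ` S) \<and>
      bij_betw (nats s' OUT) {nats s' OFF r..<nats s' OFF (Suc r)} S" if r: "r \<in> R" "r < Suc k" for r
  proof (cases "r = k")
    case True
    then show ?thesis using new r k by (simp add: isolated_def s'(1))
  next
    case False
    then have rk: "r < k" using r by simp
    then obtain S where S: "S \<subseteq> {..<n + m}" "min_element_cut {..<n} (set es) T w {r} (R - {r}) (decode n es ` S)"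
      "bij_betw (nats s OUT) {nats s OFF r..<nats s OFF (Suc r)} S" using k r by (auto simp: isolated_def)
    have "nats s OFF (Suc r) \<le> nats s POS 0" using k rk by (simp add: isolated_def)
    then have "bij_betw (nats s' OUT) {nats s OFF r..<nats s OFF (Suc r)} S"
      using S(3) s'(3) by (subst bij_betw_cong[where g = "nats s OUT"]) auto
    then show ?thesis using S rk by (intro exI[of _ S]) (simp add: s'(1))
  qed
  then show ?thesis
    using k le s'(2) sum unfolding isolated_def s'(1)
    by (auto simp: less_Suc_eq le_Suc_eq intro: order_trans)
qed

definition "isolate_cost k = (if k \<in> R then 800 * n + 1000 * gs k + Tec (gs k) n + 320 else 20)"

lemma run_isolate_all:
  assumes s: "saved s" "adjacent s" "collected X\<^sub>0 s" "\<And>j. j < m \<Longrightarrow> nats s STAMP j = 0"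
  shows "run isolate_all s ((\<Sum>k<n. isolate_cost k + 12) + 20) (isolated n)"
proof -
  let ?init = "nset POS (NConst 0) ;; NAssign OFF (NConst 0) (NConst 0)"
  let ?body = "If (is1 (cell RR RC)) isolate Skip ;; NAssign OFF (NAdd (sc RC) (NConst 1)) (sc POS)"
  let ?s0 = "seval ?init s"
  let ?Inv = "\<lambda>k s'. isolated k s' \<and> (\<forall>j<m. nats s' STAMP j \<le> k)"
  have "run (For RC N ?body) ?s0 ((\<Sum>k<n. isolate_cost k + 12) + 9)
      (\<lambda>s'. ?Inv n s' \<and> frame (insert RC (writes ?body)) ?s0 s')"
  proof (rule run_For[where Inv = ?Inv])
    fix k s' assume k: "k < n" "nats s' RC 0 = k" and fr: "frame (insert RC (writes ?body)) ?s0 s'"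
      and inv: "?Inv k s'"
    have st: "saved s'" "adjacent s'" "collected X\<^sub>0 s'"
      using frame_nats[OF fr] frame_weights[OF fr] s
      by (simp_all add: saved_def adjacent_def collected_def)
    have RR: "nats s' RR k = of_bool (k \<in> R)" using st(1) k(1) by (simp add: saved_def)
    let ?Q1 = "\<lambda>s1. nats s' POS 0 \<le> nats s1 POS 0 \<and> (\<forall>i<nats s' POS 0. nats s1 OUT i = nats s' OUT i) \<and>
      nats s1 POS 0 \<le> nats s' POS 0 + (if k \<in> R then gs k + n else 0) \<and> (\<forall>j<m. nats s1 STAMP j \<le> Suc k) \<and>
      (k \<in> R \<longrightarrow> (\<exists>S. S \<subseteq> {..<n + m} \<and>
        min_element_cut {..<n} (set es) T w {k} (R - {k}) (decode n es ` S) \<and>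
        bij_betw (nats s1 OUT) {nats s' POS 0..<nats s1 POS 0} S))"
    have 1: "run (If (is1 (cell RR RC)) isolate Skip) s' (isolate_cost k - 8) ?Q1"
    proof (cases "k \<in> R")
      case True
      have "run isolate s' (800 * n + 1000 * gs k + Tec (gs k) n + 300) ?Q1"
      proof (rule run_mono[OF run_isolate[OF st k(2) True _ refl] order_refl])
        show "nats s' STAMP j \<le> k" if "j < m" for j using inv that by simp
      qed (use True in auto)
      then show ?thesis by (rule run_If_True[rotated]) (use RR k True in \<open>simp_all add: isolate_cost_def\<close>)
    next
      case False
      have "\<forall>j<m. nats s' STAMP j \<le> Suc k" using inv le_SucI by blast
      then have "?Q1 s'" using False by simp
      then have "run Skip s' 1 ?Q1" by (intro run_loopfree) simp_all
      then show ?thesis by (rule run_If_False[rotated]) (use RR k False in \<open>simp_all add: isolate_cost_def\<close>)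
    qed
    have "run ?body s' ((isolate_cost k - 8) + 8) (\<lambda>s''. ?Inv (Suc k) (nupd RC 0 (Suc k) s''))"
    proof (rule run_Seq[OF 1], rule run_loopfree)
      fix s1 assume s1: "?Q1 s1" and fr1: "frame (writes (If (is1 (cell RR RC)) isolate Skip)) s' s1"
      let ?s2 = "nupd RC 0 (Suc k) (seval (NAssign OFF (NAdd (sc RC) (NConst 1)) (sc POS)) s1)"
      have eqs: "nats s1 RC 0 = k" "nats s1 OFF = nats s' OFF" using frame_nats[OF fr1] k by simp_all
      have "isolated (Suc k) ?s2"
        by (rule isolated_Suc[of k s']) (use inv s1 eqs in auto)
      then show "?Inv (Suc k) ?s2" using s1 by simp
    qed simp_all
    moreover have "8 \<le> isolate_cost k" by (simp add: isolate_cost_def)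
    ultimately show "run ?body s' (isolate_cost k) (\<lambda>s''. ?Inv (Suc k) (nupd RC 0 (Suc k) s''))" by simp
  qed (use s in \<open>simp_all add: saved_def isolated_def\<close>)
  then have "run (For RC N ?body) ?s0 ((\<Sum>k<n. isolate_cost k + 12) + 9) (isolated n)"
    by (rule run_mono) simp_all
  then show ?thesis unfolding isolate_all_def by (rule run_prefix) simp_all
qed

lemma run_copy_output:
  assumes s: "nats s N 0 = n" "isolated n s"
  shows "run copy_output s (200 * n + 200 * (\<Sum>r\<in>R. gs r + n) + 300) (\<lambda>s'. \<exists>X. stores_cuts s' n es R X \<and>
    (\<forall>r\<in>R. min_element_cut {..<n} (set es) T w {r} (R - {r}) (X r)))"
  (is "run copy_output s _ ?Q")
proof -
  let ?s0 = "seval (nset N1 (NAdd (sc N) (NConst 1))) s"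
  let ?off = "NAssign ''offset'' (sc I) (cell OFF I)" and ?cut = "NAssign ''cuts'' (sc I) (cell OUT I)"
  let ?I1 = "\<lambda>k s'. \<forall>v<k. nats s' ''offset'' v = nats s OFF v"
  let ?I2 = "\<lambda>k s'. \<forall>i<k. nats s' ''cuts'' i = nats s OUT i"
  let ?p = "nats s POS 0"
  have 1: "run (For I N1 ?off) ?s0 (200 * (n + 1) + 9) (\<lambda>s'. ?I1 (n + 1) s' \<and> frame (insert I (writes ?off)) ?s0 s')"
  proof (rule run_For_loopfree[where Inv = ?I1])
    fix k s' assume k: "k < n + 1" "nats s' I 0 = k" and fr: "frame (insert I (writes ?off)) ?s0 s'"
      and inv: "?I1 k s'"
    show "?I1 (Suc k) (nupd I 0 (Suc k) (seval ?off s'))"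
      using inv k frame_nats[OF fr] by (simp add: less_Suc_eq)
  qed (use s in simp_all)
  have "run (For I N1 ?off ;; For I POS ?cut) ?s0 ((200 * (n + 1) + 9) + (200 * ?p + 9)) ?Q"
  proof (rule run_Seq[OF 1])
    fix s1 assume s1: "?I1 (n + 1) s1 \<and> frame (insert I (writes ?off)) ?s0 s1"
    then have fr1: "frame (insert I (writes ?off)) ?s0 s1" by simp
    have 2: "run (For I POS ?cut) s1 (200 * ?p + 9) (\<lambda>s'. ?I2 ?p s' \<and> frame (insert I (writes ?cut)) s1 s')"
    proof (rule run_For_loopfree[where Inv = ?I2])
      fix k s' assume k: "k < ?p" "nats s' I 0 = k" and fr: "frame (insert I (writes ?cut)) s1 s'"
        and inv: "?I2 k s'"
      show "?I2 (Suc k) (nupd I 0 (Suc k) (seval ?cut s'))"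
        using inv k frame_nats[OF fr] frame_nats[OF fr1] by (simp add: less_Suc_eq)
    qed (use frame_nats[OF fr1] in simp_all)
    show "run (For I POS ?cut) s1 (200 * ?p + 9) ?Q"
    proof (rule run_mono[OF 2])
      fix s2 assume s2: "?I2 ?p s2 \<and> frame (insert I (writes ?cut)) s1 s2"
      then have fr2: "frame (insert I (writes ?cut)) s1 s2" by simp
      have off: "nats s2 ''offset'' v = nats s OFF v" if "v \<le> n" for v
        using frame_nats[OF fr2] s1 that by simp
      let ?L = "\<lambda>r. map (nats s2 ''cuts'') [nats s2 ''offset'' r..<nats s2 ''offset'' (Suc r)]"
      have L: "distinct (?L r) \<and> set (?L r) \<subseteq> {..<n + m} \<and>
          min_element_cut {..<n} (set es) T w {r} (R - {r}) (decode n es ` set (?L r))" if rR: "r \<in> R" for r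
      proof -
        have r: "r < n" using R_n rR by simp
        obtain S where S: "S \<subseteq> {..<n + m}" "min_element_cut {..<n} (set es) T w {r} (R - {r}) (decode n es ` S)"
          "bij_betw (nats s OUT) {nats s OFF r..<nats s OFF (Suc r)} S"
          using s(2)[unfolded isolated_def, THEN conjunct2, THEN conjunct2, THEN conjunct2, THEN conjunct2,
            rule_format, OF rR r] by (elim exE conjE)
        have "nats s OFF (Suc r) \<le> ?p" using s(2) r by (simp add: isolated_def)
        then have "bij_betw (nats s2 ''cuts'') {nats s OFF r..<nats s OFF (Suc r)} S"
          using S(3) s2 by (subst bij_betw_cong[where g = "nats s OUT"]) auto
        then have "inj_on (nats s2 ''cuts'') {nats s2 ''offset'' r..<nats s2 ''offset'' (Suc r)}"
          "set (?L r) = S"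
          using off r by (simp_all add: bij_betw_def)
        then show ?thesis using S by (simp add: distinct_map)
      qed
      have "stores_cuts s2 n es R (\<lambda>r. decode n es ` set (?L r))"
        unfolding stores_cuts_def Let_def using L off s(2) by (auto simp: isolated_def)
      then show "?Q s2" using L by blast
    qed simp
  qed
  moreover have "?p \<le> (\<Sum>r\<in>R. gs r + n)"
  proof -
    have "{r \<in> R. r < n} = R" using R_n by auto
    then show ?thesis using s(2) by (simp add: isolated_def)
  qed
  ultimately show ?thesis unfolding copy_output_def
    by (elim run_prefix) simp_all
qed

end

section \<open>The total running time\<close>

definition max_total :: "(nat \<Rightarrow> nat \<Rightarrow> nat) \<Rightarrow> nat \<Rightarrow> nat \<Rightarrow> nat \<Rightarrow> nat" where
  "max_total Tec m n k = Max {\<Sum>m'\<leftarrow>ms. Tec m' n | ms :: nat list. length ms = k \<and> sum_list ms \<le> 2 * m}"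

text \<open>The entries of an admissible list are at most \<open>2 * m\<close>, so the maximum is
  taken over a finite set.\<close>

lemma max_total_ge:
  assumes "length ms = k" "sum_list ms \<le> 2 * m"
  shows "(\<Sum>m'\<leftarrow>ms. Tec m' n) \<le> max_total Tec m n k"
proof -
  let ?L = "{ms :: nat list. length ms = k \<and> sum_list ms \<le> 2 * m}"
  have "?L \<subseteq> {ms. set ms \<subseteq> {..2 * m} \<and> length ms = k}"
    using member_le_sum_list by (fastforce intro: order_trans)
  then have "finite ?L" using finite_lists_length_eq[of "{..2 * m}" k] by (simp add: finite_subset)
  then have "finite ((\<lambda>ms. \<Sum>m'\<leftarrow>ms. Tec m' n) ` ?L)" by simp
  moreover have "(\<lambda>ms. \<Sum>m'\<leftarrow>ms. Tec m' n) ` ?L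
      = {\<Sum>m'\<leftarrow>ms. Tec m' n | ms :: nat list. length ms = k \<and> sum_list ms \<le> 2 * m}" by auto
  ultimately show ?thesis unfolding max_total_def using assms by (intro Max_ge) auto
qed

text \<open>There may be fewer than \<open>k\<close> graphs; padding the list with zeros can only
  increase its total.\<close>

lemma max_total_sum:
  assumes "finite A" "card A \<le> k" "sum f A \<le> 2 * m"
  shows "(\<Sum>a\<in>A. Tec (f a) n) \<le> max_total Tec m n k"
proof -
  obtain xs where xs: "set xs = A" "distinct xs" using assms(1) finite_distinct_list by blast
  let ?ms = "map f xs @ replicate (k - card A) 0"
  have "length ?ms = k" using assms(2) distinct_card[OF xs(2)] xs(1) by simp
  moreover have "sum_list ?ms \<le> 2 * m"
    using assms(3) xs by (simp add: sum_list_distinct_conv_sum_set sum_list_replicate)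
  ultimately have "(\<Sum>m'\<leftarrow>?ms. Tec m' n) \<le> max_total Tec m n k" by (rule max_total_ge)
  moreover have "(\<Sum>a\<in>A. Tec (f a) n) \<le> (\<Sum>m'\<leftarrow>?ms. Tec m' n)"
    using xs by (simp add: sum_list_distinct_conv_sum_set o_def)
  ultimately show ?thesis by simp
qed

context input
begin

abbreviation "budget \<equiv> max_total Tec m n (card T)"

lemma finite_T: "finite T"
  by (rule finite_subset[OF T_V finite_V])

lemma card_T_pos: "0 < card T"
  using finite_T T_nonempty by (simp add: card_gt_0_iff)

lemma n_pos: "0 < n"
  using T_nonempty T_n by fastforce

lemma Tec_m: "n + m \<le> Tec m n"
  by (rule Tec_ge[OF P inst distinct_es])

text \<open>All \<open>m\<close> edges may be put into one part. The second term of the bound thus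
  pays for the preprocessing even when \<open>card T\<close> is 1 and the logarithm
  vanishes.\<close>

lemma Tec_m_total: "Tec m n \<le> budget"
  using max_total_sum[of "{undefined :: nat}" "card T" "\<lambda>_. m" m Tec n] card_T_pos by simp

end

context main
begin

lemma sum_Tec_gs: "(\<Sum>r\<in>R. Tec (gs r) n) \<le> budget"
  using card_mono[OF finite_T R_sub] by (intro max_total_sum finite_R sum_gs)

text \<open>This bounds the joint length of all printed cuts, hence the cost of copying
  them.\<close>

lemma sum_gs_total: "(\<Sum>r\<in>R. gs r + n) \<le> budget"
proof -
  have "(\<Sum>r\<in>R. gs r + n) \<le> (\<Sum>r\<in>R. Tec (gs r) n)"
    using Tec_gs by (intro sum_mono) (simp add: add.commute)
  then show ?thesis using sum_Tec_gs by linarith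
qed

text \<open>For terminals in \<open>R\<close>, linear terms are absorbed by
  \<open>n + gs k \<le> Tec (gs k) n\<close> and constants by \<open>0 < n\<close>. The other 32
  steps per vertex are paid by \<open>n \<le> budget\<close>.\<close>

lemma sum_isolate_cost: "(\<Sum>k<n. isolate_cost k + 12) \<le> 1200 * budget"
proof -
  have "(\<Sum>k<n. isolate_cost k + 12) \<le> (\<Sum>k<n. (if k \<in> R then 1121 * Tec (gs k) n else 0) + 32)"
  proof (intro sum_mono)
    fix k assume "k \<in> {..<n}"
    then show "isolate_cost k + 12 \<le> (if k \<in> R then 1121 * Tec (gs k) n else 0) + 32"
      using Tec_gs[of k] n_pos by (cases "k \<in> R") (simp_all add: isolate_cost_def)
  qed
  also have "\<dots> = 1121 * (\<Sum>k\<in>R. Tec (gs k) n) + 32 * n"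
  proof -
    have "(\<Sum>k<n. if k \<in> R then 1121 * Tec (gs k) n else 0) = (\<Sum>k\<in>R. 1121 * Tec (gs k) n)"
      using R_n by (intro sum.mono_neutral_cong_right) auto
    then show ?thesis by (simp add: sum.distrib sum_distrib_left)
  qed
  also have "\<dots> \<le> 1121 * budget + 32 * budget"
    using sum_Tec_gs Tec_m Tec_m_total by (intro add_mono mult_le_mono2) linarith+
  finally show ?thesis by simp
qed

lemma run_isolation:
  assumes s: "saved s" "collected X\<^sub>0 s" "\<forall>v<n. nats s FIRST v = 0" "\<forall>j<m. nats s STAMP j = 0"
  shows "run (adjacency ;; isolate_all ;; copy_output) s (3000 * budget) (\<lambda>s'. \<exists>X. stores_cuts s' n es R X \<and>
    (\<forall>r\<in>R. min_element_cut {..<n} (set es) T w {r} (R - {r}) (X r)))"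
  (is "run _ s _ ?Q")
proof -
  have "run (adjacency ;; isolate_all ;; copy_output) s ((200 * m + 20) +
      (((\<Sum>k<n. isolate_cost k + 12) + 20) + (200 * n + 200 * (\<Sum>r\<in>R. gs r + n) + 300))) ?Q"
  proof (rule run_Seq[OF run_adjacency[OF s(1,3)]])
    fix s1 assume s1: "adjacent s1" and fr1: "frame (writes adjacency) s s1"
    have st1: "saved s1" using saved_frame[OF s(1) fr1] by simp
    have "collected X\<^sub>0 s1" "\<And>j. j < m \<Longrightarrow> nats s1 STAMP j = 0"
      using frame_nats[OF fr1] s by (simp_all add: collected_def)
    note iso = run_isolate_all[OF st1 s1 this]
    show "run (isolate_all ;; copy_output) s1 (((\<Sum>k<n. isolate_cost k + 12) + 20) +
        (200 * n + 200 * (\<Sum>r\<in>R. gs r + n) + 300)) ?Q"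
    proof (rule run_Seq[OF iso])
      fix s2 assume s2: "isolated n s2" and fr2: "frame (writes isolate_all) s1 s2"
      have "saved s2" using saved_frame[OF st1 fr2] by simp
      then show "run copy_output s2 (200 * n + 200 * (\<Sum>r\<in>R. gs r + n) + 300) ?Q"
        using s2 by (intro run_copy_output) (simp_all add: saved_def)
    qed
  qed
  then show ?thesis
    by (rule run_mono) (use sum_isolate_cost sum_gs_total Tec_m Tec_m_total n_pos in linarith)
qed

end

context input
begin

lemma run_isolating_cuts:
  assumes s: "stores_instance s n es T w" "stores_set s ''R'' n R"
    and th: "\<And>j. j < m \<Longrightarrow> nats s ''tail'' j = tl j \<and> nats s ''head'' j = hd j"
  shows "run isolating_cuts s (511 * (nbits (card R - 1) * Tec m n) + 5000 * budget)
    (\<lambda>s'. \<exists>X. stores_cuts s' n es R X \<and>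
      (\<forall>r\<in>R. min_element_cut {..<n} (set es) T w {r} (R - {r}) (X r)))"
  (is "run _ s _ ?Q")
proof -
  let ?rounds = "nbits (card R - 1) * (Tec m n + 400 * n + 400 * m + 110) + 5"
  have "run isolating_cuts s ((200 * n + 200 * m + 40) + ((200 * n + 200 * m + 18) + ((200 * n + 50) +
      (?rounds + 3000 * budget)))) ?Q"
    unfolding isolating_cuts_def
  proof (rule run_Seq[OF run_save[OF s th]], assumption, elim conjE)
    fix s1 assume s1: "saved0 s1" "cleared s1"
    show "run (cap_weights ;; index ;; rounds ;; adjacency ;; isolate_all ;; copy_output) s1
        ((200 * n + 200 * m + 18) + ((200 * n + 50) + (?rounds + 3000 * budget))) ?Q"
    proof (rule run_Seq[OF run_cap_weights[OF s1]], elim conjE)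
      fix s2 assume s2: "saved s2" "cleared s2"
      show "run (index ;; rounds ;; adjacency ;; isolate_all ;; copy_output) s2
          ((200 * n + 50) + (?rounds + 3000 * budget)) ?Q"
      proof (rule run_Seq[OF run_index[OF s2(1)]], elim conjE)
        fix s3 assume s3: "nats s3 KK 0 = card R - 1" "\<forall>r\<in>R. nats s3 IDX r < card R"
          "inj_on (nats s3 IDX) R" "\<forall>x\<le>n. nats s3 HALF x = x div 2 \<and> nats s3 PAR x = x mod 2"
          and fr3: "frame (writes index) s2 s3"
        have st3: "saved s3" using saved_frame[OF s2(1) fr3] by simp
        have cl3: "cleared s3" using frame_nats[OF fr3] s2(2) by (simp add: cleared_def)
        have "tables s3" "collected {} s3" using s3(4) cl3 by (simp_all add: tables_def collected_def cleared_def)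
        note r = run_rounds[OF st3 this s3(1,2,3)]
        show "run (rounds ;; adjacency ;; isolate_all ;; copy_output) s3 (?rounds + 3000 * budget) ?Q"
        proof (rule run_Seq[OF r], elim conjE exE)
          fix s4 CS assume s4: "saved s4" "isolation {..<n} (set es) T \<omega> R CS" "collected (removed CS) s4"
            and fr4: "frame (writes rounds) s3 s4"
          interpret isolation "{..<n}" "set es" T \<omega> R CS by (rule s4(2))
          interpret main P Tec n es T w R tl hd CS ..
          have "\<forall>v<n. nats s4 FIRST v = 0" "\<forall>j<m. nats s4 STAMP j = 0"
            using frame_nats[OF fr4] cl3 by (simp_all add: cleared_def)
          then show "run (adjacency ;; isolate_all ;; copy_output) s4 (3000 * budget) ?Q"
            by (rule run_isolation[OF s4(1,3)])
        qed
      qed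
    qed
  qed
  then show ?thesis
  proof (rule run_mono)
    \<comment> \<open>511 is 1 + 400 + 110: both \<open>n + m\<close> and 1 are at most
      \<open>Tec m n\<close>.\<close>
    have "Tec m n + 400 * n + 400 * m + 110 \<le> 511 * Tec m n" using Tec_m n_pos by linarith
    then have "nbits (card R - 1) * (Tec m n + 400 * n + 400 * m + 110) \<le> nbits (card R - 1) * (511 * Tec m n)"
      by (rule mult_le_mono2)
    also have "\<dots> = 511 * (nbits (card R - 1) * Tec m n)" by simp
    finally show "(200 * n + 200 * m + 40) + ((200 * n + 200 * m + 18) + ((200 * n + 50) +
      (?rounds + 3000 * budget))) \<le> 511 * (nbits (card R - 1) * Tec m n) + 5000 * budget"
      using Tec_m Tec_m_total n_pos by linarith
  qed
qed

text \<open>A round takes place only if \<open>R\<close> has two elements. Then the logarithm is at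
  least 1 and absorbs the additive 1 of \<open>nbits_le_log\<close>, at the price of the factor
  2.\<close>

lemma nbits_log: "real (nbits (card R - 1)) \<le> 2 * log 2 (real (card T))"
proof (cases "card R \<le> 1")
  case True
  then show ?thesis using card_T_pos by (simp add: nbits.simps[of 0])
next
  case False
  have k: "card R \<le> card T" by (rule card_mono[OF finite_T R_sub])
  have "real (nbits (card R - 1)) \<le> 1 + log 2 (real (card R - 1))"
    using False by (intro nbits_le_log) simp
  also have "log 2 (real (card R - 1)) \<le> log 2 (real (card T))"
    using False k by (subst log_le_cancel_iff) auto
  also have "1 = log 2 (2 :: real)" by simp
  also have "log 2 (2 :: real) \<le> log 2 (real (card T))"
    using False k by (subst log_le_cancel_iff) auto
  finally show ?thesis by simp
qed

end

lemma (in blackbox) computes_isolating_cuts: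
  "computes_isolating_element_cuts isolating_cuts
    (\<lambda>m n k. 5000 * (real (Tec m n) * log 2 (real k) + real (max_total Tec m n k)))"
  unfolding computes_isolating_element_cuts_def
proof (intro allI impI, elim conjE)
  fix s n es T w R
  assume a: "ec_instance {..<n} (set es) T w" "distinct es" "T \<noteq> {}" "R \<subseteq> T"
    "stores_instance s n es T w" "stores_set s ''R'' n R"
  interpret input P Tec n es T w R "nats s ''tail''" "nats s ''head''"
    by unfold_locales (use a in \<open>simp_all add: stores_instance_def\<close>)
  obtain t s' X where X: "exec isolating_cuts s t s'"
    "t \<le> 511 * (nbits (card R - 1) * Tec (length es) n) + 5000 * budget"
    "stores_cuts s' n es R X" "\<forall>r\<in>R. min_element_cut {..<n} (set es) T w {r} (R - {r}) (X r)"
    using run_isolating_cuts[OF a(5,6)] by (auto simp: run_def)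
  have "real t \<le> real (511 * (nbits (card R - 1) * Tec (length es) n) + 5000 * budget)"
    using X(2) by (rule of_nat_mono)
  also have "\<dots> = 511 * (real (nbits (card R - 1)) * real (Tec (length es) n)) + 5000 * real budget"
    by simp
  also have "\<dots> \<le> 511 * (2 * log 2 (real (card T)) * real (Tec (length es) n)) + 5000 * real budget"
    using nbits_log by (intro add_mono mult_left_mono mult_right_mono) simp_all
  \<comment> \<open>The first coefficient \<open>511 * 2\<close> is below 5000; enlarging it is
    sound because the product with the logarithm is nonnegative.\<close>
  also have "\<dots> \<le> 5000 * (real (Tec (length es) n) * log 2 (real (card T)) + real budget)"
  proof -
    have "0 \<le> real (Tec (length es) n) * log 2 (real (card T))"
      using card_T_pos by (intro mult_nonneg_nonneg zero_le_log_cancel_iff[THEN iffD2]) simp_all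
    then show ?thesis by (simp add: algebra_simps)
  qed
  finally show "\<exists>t s' X. exec isolating_cuts s t s' \<and>
      real t \<le> 5000 * (real (Tec (length es) n) * log 2 (real (card T)) + real budget) \<and>
      (\<forall>r\<in>R. min_element_cut {..<n} (set es) T w {r} (R - {r}) (X r)) \<and> stores_cuts s' n es R X"
    using X by blast
qed

text \<open>One constant serves all black boxes, since their own cost enters only through
  \<open>Tec\<close>. The program itself depends on \<open>P\<close> through the calls and through
  the choice of fresh names.\<close>

theorem theorem3p1:
  "\<exists>C :: real. \<forall>P Tec. computes_min_element_cuts P Tec \<longrightarrow>
     (\<exists>Q. computes_isolating_element_cuts Q
        (\<lambda>m n k. C * (real (Tec m n) * log 2 (real k) +
           real (Max {\<Sum>m'\<leftarrow>ms. Tec m' n | ms :: nat list. length ms = k \<and> sum_list ms \<le> 2 * m}))))"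
proof (intro exI[of _ 5000] allI impI)
  fix P Tec assume "computes_min_element_cuts P Tec"
  then interpret blackbox P Tec by unfold_locales
  show "\<exists>Q. computes_isolating_element_cuts Q
      (\<lambda>m n k. 5000 * (real (Tec m n) * log 2 (real k) +
         real (Max {\<Sum>m'\<leftarrow>ms. Tec m' n | ms :: nat list. length ms = k \<and> sum_list ms \<le> 2 * m})))"
    using computes_isolating_cuts unfolding max_total_def by blast
qed

end
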